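(* Let $p$ be a prime, $X$ a countable set, and let $(A_n)_{n\in\mathbb{N}}$ be an increasing sequence of norm-closed sub-$\mathbb{Z}_p$-algebras of $\mathcal{B}(\mathbb{Q}_p(X))$. Let $A$ be the norm closure of $\bigcup_n A_n$. Then $K_0(A)$ is isomorphic to the direct limit of the sequence $(K_0(A_n))_n$ with the homomorphisms induced by the inclusions.
   Context: $\mathbb{Q}_p(X)$ is the set of maps $\xi:X\to\mathbb{Q}_p$ with $|\xi(i)|_p\le1$ for all but finitely many $i$, a $\mathbb{Z}_p$-module under coordinatewise operations, with the topology $\tau$ in which $A\subseteq\mathbb{Q}_p(X)$ is open iff for every finite $P\subseteq X$ the set $A\cap\big(\prod_{i\in P}\mathbb{Q}_p\times\prod_{j\in X\setminus P}\mathbb{Z}_p\big)$ is open in the product topology. $\mathcal{B}(\mathbb{Q}_p(X))$ is the $\mathbb{Z}_p$-algebra of $\tau$-continuous $\mathbb{Z}_p$-linear maps on $\mathbb{Q}_p(X)$, normed by $\|T\|=\sup_{\|\xi\|\le1}\|T\xi\|$ where $\|\xi\|=\max_i|\xi(i)|_p$. $K_0$ is the algebraic $K_0$-group of a (possibly non-unital) ring. *)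

theory Defs
  imports "HOL-Algebra.Algebra" "HOL-Computational_Algebra.Primes"
    "HOL-Library.Countable_Set" "HOL-Library.FuncSet"
begin

definition rat_pval :: "nat \<Rightarrow> rat \<Rightarrow> int" where
  "rat_pval p q = (let (a, b) = quotient_of q in
      int (multiplicity (int p) a) - int (multiplicity (int p) b))"

definition rat_pabs :: "nat \<Rightarrow> rat \<Rightarrow> real" where
  "rat_pabs p q = (if q = 0 then 0 else real p powr (- real_of_int (rat_pval p q)))"

definition qcauchy :: "nat \<Rightarrow> (nat \<Rightarrow> rat) \<Rightarrow> bool" where
  "qcauchy p s = (\<forall>e>0. \<exists>N. \<forall>m\<ge>N. \<forall>n\<ge>N. rat_pabs p (s m - s n) < e)"

definition qequiv :: "nat \<Rightarrow> (nat \<Rightarrow> rat) \<Rightarrow> (nat \<Rightarrow> rat) \<Rightarrow> bool" where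
  "qequiv p s t = ((\<lambda>n. rat_pabs p (s n - t n)) \<longlonglongrightarrow> 0)"

text \<open>An element of Q_p is an equivalence class of p-adic Cauchy sequences of rationals.\<close>
type_synonym qp = "(nat \<Rightarrow> rat) set"

definition qp_class :: "nat \<Rightarrow> (nat \<Rightarrow> rat) \<Rightarrow> qp" where
  "qp_class p s = {t. qcauchy p t \<and> qequiv p s t}"

definition Qp :: "nat \<Rightarrow> qp set" where
  "Qp p = {qp_class p s | s. qcauchy p s}"

definition qp_rep :: "qp \<Rightarrow> nat \<Rightarrow> rat" where
  "qp_rep x = (SOME s. s \<in> x)"

definition qp_zero :: "nat \<Rightarrow> qp" where
  "qp_zero p = qp_class p (\<lambda>_. 0)"

definition qp_add :: "nat \<Rightarrow> qp \<Rightarrow> qp \<Rightarrow> qp" where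
  "qp_add p x y = qp_class p (\<lambda>n. qp_rep x n + qp_rep y n)"

definition qp_neg :: "nat \<Rightarrow> qp \<Rightarrow> qp" where
  "qp_neg p x = qp_class p (\<lambda>n. - qp_rep x n)"

definition qp_sub :: "nat \<Rightarrow> qp \<Rightarrow> qp \<Rightarrow> qp" where
  "qp_sub p x y = qp_class p (\<lambda>n. qp_rep x n - qp_rep y n)"

definition qp_mul :: "nat \<Rightarrow> qp \<Rightarrow> qp \<Rightarrow> qp" where
  "qp_mul p x y = qp_class p (\<lambda>n. qp_rep x n * qp_rep y n)"

definition qp_abs :: "nat \<Rightarrow> qp \<Rightarrow> real" where
  "qp_abs p x = lim (\<lambda>n. rat_pabs p (qp_rep x n))"

definition Zp :: "nat \<Rightarrow> qp set" where
  "Zp p = {x \<in> Qp p. qp_abs p x \<le> 1}"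

definition QpX :: "nat \<Rightarrow> 'x set \<Rightarrow> ('x \<Rightarrow> qp) set" where
  "QpX p Ix = {xi. (\<forall>i\<in>Ix. xi i \<in> Qp p) \<and> (\<forall>i. i \<notin> Ix \<longrightarrow> xi i = qp_zero p)
               \<and> finite {i\<in>Ix. qp_abs p (xi i) > 1}}"

definition vzero :: "nat \<Rightarrow> 'x set \<Rightarrow> 'x \<Rightarrow> qp" where
  "vzero p Ix = (\<lambda>i. qp_zero p)"

definition vadd :: "nat \<Rightarrow> 'x set \<Rightarrow> ('x \<Rightarrow> qp) \<Rightarrow> ('x \<Rightarrow> qp) \<Rightarrow> 'x \<Rightarrow> qp" where
  "vadd p Ix xi eta = (\<lambda>i. if i \<in> Ix then qp_add p (xi i) (eta i) else qp_zero p)"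

definition vsub :: "nat \<Rightarrow> 'x set \<Rightarrow> ('x \<Rightarrow> qp) \<Rightarrow> ('x \<Rightarrow> qp) \<Rightarrow> 'x \<Rightarrow> qp" where
  "vsub p Ix xi eta = (\<lambda>i. if i \<in> Ix then qp_sub p (xi i) (eta i) else qp_zero p)"

definition vsmul :: "nat \<Rightarrow> 'x set \<Rightarrow> qp \<Rightarrow> ('x \<Rightarrow> qp) \<Rightarrow> 'x \<Rightarrow> qp" where
  "vsmul p Ix a xi = (\<lambda>i. if i \<in> Ix then qp_mul p a (xi i) else qp_zero p)"

text \<open>The sup norm ||xi|| = max_i |xi(i)|_p (taken to be 0 if Ix is empty).\<close>
definition vnorm :: "nat \<Rightarrow> 'x set \<Rightarrow> ('x \<Rightarrow> qp) \<Rightarrow> real" where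
  "vnorm p Ix xi = Sup (insert 0 ((\<lambda>i. qp_abs p (xi i)) ` Ix))"

definition box :: "nat \<Rightarrow> 'x set \<Rightarrow> 'x set \<Rightarrow> ('x \<Rightarrow> qp) set" where
  "box p Ix P = {xi \<in> QpX p Ix. \<forall>j\<in>Ix - P. xi j \<in> Zp p}"

text \<open>U is open in W for the subspace topology of the product topology of Q_p^Ix.\<close>
definition prod_rel_open :: "nat \<Rightarrow> 'x set \<Rightarrow> ('x \<Rightarrow> qp) set \<Rightarrow> ('x \<Rightarrow> qp) set \<Rightarrow> bool" where
  "prod_rel_open p Ix W U = (U \<subseteq> W \<and> (\<forall>xi\<in>U. \<exists>F e. finite F \<and> F \<subseteq> Ix \<and> e > 0 \<and>
      {eta \<in> W. \<forall>i\<in>F. qp_abs p (qp_sub p (eta i) (xi i)) < e} \<subseteq> U))"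

definition tau_open :: "nat \<Rightarrow> 'x set \<Rightarrow> ('x \<Rightarrow> qp) set \<Rightarrow> bool" where
  "tau_open p Ix U = (U \<subseteq> QpX p Ix \<and>
      (\<forall>P. finite P \<and> P \<subseteq> Ix \<longrightarrow> prod_rel_open p Ix (box p Ix P) (U \<inter> box p Ix P)))"

type_synonym 'x qpop = "('x \<Rightarrow> qp) \<Rightarrow> ('x \<Rightarrow> qp)"

definition tau_continuous :: "nat \<Rightarrow> 'x set \<Rightarrow> 'x qpop \<Rightarrow> bool" where
  "tau_continuous p Ix T = (\<forall>U. tau_open p Ix U \<longrightarrow> tau_open p Ix {xi \<in> QpX p Ix. T xi \<in> U})"

definition zp_linear :: "nat \<Rightarrow> 'x set \<Rightarrow> 'x qpop \<Rightarrow> bool" where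
  "zp_linear p Ix T = ((\<forall>xi\<in>QpX p Ix. \<forall>eta\<in>QpX p Ix. T (vadd p Ix xi eta) = vadd p Ix (T xi) (T eta)) \<and>
      (\<forall>a\<in>Zp p. \<forall>xi\<in>QpX p Ix. T (vsmul p Ix a xi) = vsmul p Ix a (T xi)))"

definition Bops :: "nat \<Rightarrow> 'x set \<Rightarrow> 'x qpop set" where
  "Bops p Ix = {T \<in> QpX p Ix \<rightarrow>\<^sub>E QpX p Ix. zp_linear p Ix T \<and> tau_continuous p Ix T}"

definition opnorm :: "nat \<Rightarrow> 'x set \<Rightarrow> 'x qpop \<Rightarrow> real" where
  "opnorm p Ix T = Sup ((\<lambda>xi. vnorm p Ix (T xi)) ` {xi \<in> QpX p Ix. vnorm p Ix xi \<le> 1})"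

definition opsub :: "nat \<Rightarrow> 'x set \<Rightarrow> 'x qpop \<Rightarrow> 'x qpop \<Rightarrow> 'x qpop" where
  "opsub p Ix S T = restrict (\<lambda>xi. vsub p Ix (S xi) (T xi)) (QpX p Ix)"

definition opsmul :: "nat \<Rightarrow> 'x set \<Rightarrow> qp \<Rightarrow> 'x qpop \<Rightarrow> 'x qpop" where
  "opsmul p Ix a T = restrict (\<lambda>xi. vsmul p Ix a (T xi)) (QpX p Ix)"

definition Bring :: "nat \<Rightarrow> 'x set \<Rightarrow> 'x qpop ring" where
  "Bring p Ix = \<lparr>carrier = Bops p Ix,
     monoid.mult = (\<lambda>S T. restrict (\<lambda>xi. S (T xi)) (QpX p Ix)),
     monoid.one = restrict (\<lambda>xi. xi) (QpX p Ix),
     ring.zero = restrict (\<lambda>xi. vzero p Ix) (QpX p Ix),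
     ring.add = (\<lambda>S T. restrict (\<lambda>xi. vadd p Ix (S xi) (T xi)) (QpX p Ix))\<rparr>"

text \<open>Sub-Z_p-algebras (not necessarily unital) of B(Q_p(Ix)).\<close>
definition is_subalg :: "nat \<Rightarrow> 'x set \<Rightarrow> 'x qpop set \<Rightarrow> bool" where
  "is_subalg p Ix A = (A \<subseteq> Bops p Ix \<and> \<zero>\<^bsub>Bring p Ix\<^esub> \<in> A \<and>
     (\<forall>S\<in>A. \<forall>T\<in>A. S \<oplus>\<^bsub>Bring p Ix\<^esub> T \<in> A \<and> opsub p Ix S T \<in> A \<and> S \<otimes>\<^bsub>Bring p Ix\<^esub> T \<in> A) \<and>
     (\<forall>a\<in>Zp p. \<forall>T\<in>A. opsmul p Ix a T \<in> A))"

definition norm_closure :: "nat \<Rightarrow> 'x set \<Rightarrow> 'x qpop set \<Rightarrow> 'x qpop set" where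
  "norm_closure p Ix A = {T \<in> Bops p Ix. \<forall>e>0. \<exists>S\<in>A. opnorm p Ix (opsub p Ix T S) < e}"

definition norm_closed :: "nat \<Rightarrow> 'x set \<Rightarrow> 'x qpop set \<Rightarrow> bool" where
  "norm_closed p Ix A = (norm_closure p Ix A \<subseteq> A)"

type_synonym 'a mat = "nat \<Rightarrow> nat \<Rightarrow> 'a"

definition mats :: "('a, 'b) ring_scheme \<Rightarrow> nat \<Rightarrow> nat \<Rightarrow> 'a mat set" where
  "mats R n m = {M. (\<forall>i<n. \<forall>j<m. M i j \<in> carrier R) \<and>
                    (\<forall>i j. \<not> (i < n \<and> j < m) \<longrightarrow> M i j = \<zero>\<^bsub>R\<^esub>)}"

definition mmul :: "('a, 'b) ring_scheme \<Rightarrow> nat \<Rightarrow> nat \<Rightarrow> nat \<Rightarrow> 'a mat \<Rightarrow> 'a mat \<Rightarrow> 'a mat" where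
  "mmul R n k m M N = (\<lambda>i j. if i < n \<and> j < m then finsum R (\<lambda>l. M i l \<otimes>\<^bsub>R\<^esub> N l j) {..<k}
                               else \<zero>\<^bsub>R\<^esub>)"

type_synonym 'a idm = "nat \<times> 'a mat"

definition idems :: "('a, 'b) ring_scheme \<Rightarrow> 'a idm set" where
  "idems R = {(n, e). e \<in> mats R n n \<and> mmul R n n n e e = e}"

text \<open>(Murray-von Neumann / algebraic) equivalence of idempotents, i.e. isomorphism
  of the f.g. projective modules e R^n and f R^m.\<close>
definition idm_equiv :: "('a, 'b) ring_scheme \<Rightarrow> 'a idm \<Rightarrow> 'a idm \<Rightarrow> bool" where
  "idm_equiv R E F = (case E of (n, e) \<Rightarrow> case F of (m, f) \<Rightarrow>
     \<exists>x \<in> mats R n m. \<exists>y \<in> mats R m n. mmul R n m n x y = e \<and> mmul R m n m y x = f \<and>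
        mmul R n n m e x = x \<and> mmul R n m m x f = x \<and>
        mmul R m m n f y = y \<and> mmul R m n n y e = y)"

definition dsum :: "('a, 'b) ring_scheme \<Rightarrow> 'a idm \<Rightarrow> 'a idm \<Rightarrow> 'a idm" where
  "dsum R E F = (case E of (n, e) \<Rightarrow> case F of (m, f) \<Rightarrow>
     (n + m, \<lambda>i j. if i < n \<and> j < n then e i j
                 else if n \<le> i \<and> i < n + m \<and> n \<le> j \<and> j < n + m then f (i - n) (j - n)
                 else \<zero>\<^bsub>R\<^esub>))"

text \<open>Grothendieck group of the monoid of equivalence classes of idempotent matrices:
  formal differences [e] - [f].\<close>
definition k0_rel :: "('a, 'b) ring_scheme \<Rightarrow> ('a idm \<times> 'a idm) \<Rightarrow> ('a idm \<times> 'a idm) \<Rightarrow> bool" where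
  "k0_rel R P Q = (\<exists>g \<in> idems R.
      idm_equiv R (dsum R (dsum R (fst P) (snd Q)) g) (dsum R (dsum R (fst Q) (snd P)) g))"

definition k0_cls :: "('a, 'b) ring_scheme \<Rightarrow> ('a idm \<times> 'a idm) \<Rightarrow> ('a idm \<times> 'a idm) set" where
  "k0_cls R P = {Q \<in> idems R \<times> idems R. k0_rel R P Q}"

definition k0_rep :: "('a idm \<times> 'a idm) set \<Rightarrow> 'a idm \<times> 'a idm" where
  "k0_rep c = (SOME P. P \<in> c)"

definition K0u :: "('a, 'b) ring_scheme \<Rightarrow> ('a idm \<times> 'a idm) set monoid" where
  "K0u R = \<lparr>carrier = k0_cls R ` (idems R \<times> idems R),
     monoid.mult = (\<lambda>c d. k0_cls R (dsum R (fst (k0_rep c)) (fst (k0_rep d)),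
                             dsum R (snd (k0_rep c)) (snd (k0_rep d)))),
     monoid.one = k0_cls R ((0, \<lambda>i j. \<zero>\<^bsub>R\<^esub>), (0, \<lambda>i j. \<zero>\<^bsub>R\<^esub>))\<rparr>"

definition k0_map :: "('a \<Rightarrow> 'c) \<Rightarrow> ('c, 'd) ring_scheme \<Rightarrow> ('a idm \<times> 'a idm) set
                      \<Rightarrow> ('c idm \<times> 'c idm) set" where
  "k0_map f R' c = (let ((n, e), (m, e')) = k0_rep c in
       k0_cls R' ((n, \<lambda>i j. f (e i j)), (m, \<lambda>i j. f (e' i j))))"

definition unitz :: "('a, 'b) ring_scheme \<Rightarrow> 'a set \<Rightarrow> (int \<times> 'a) ring" where
  "unitz R S = \<lparr>carrier = UNIV \<times> S,
     monoid.mult = (\<lambda>(k, a) (l, b). (k * l, ([k] \<cdot>\<^bsub>R\<^esub> b) \<oplus>\<^bsub>R\<^esub> ([l] \<cdot>\<^bsub>R\<^esub> a) \<oplus>\<^bsub>R\<^esub> (a \<otimes>\<^bsub>R\<^esub> b))),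
     monoid.one = (1, \<zero>\<^bsub>R\<^esub>),
     ring.zero = (0, \<zero>\<^bsub>R\<^esub>),
     ring.add = (\<lambda>(k, a) (l, b). (k + l, a \<oplus>\<^bsub>R\<^esub> b))\<rparr>"

definition K0 :: "('a, 'b) ring_scheme \<Rightarrow> 'a set \<Rightarrow> ((int \<times> 'a) idm \<times> (int \<times> 'a) idm) set monoid" where
  "K0 R S = \<lparr>carrier = {c \<in> carrier (K0u (unitz R S)). k0_map fst \<Z> c = \<one>\<^bsub>K0u \<Z>\<^esub>},
     monoid.mult = monoid.mult (K0u (unitz R S)),
     monoid.one = monoid.one (K0u (unitz R S))\<rparr>"

text \<open>Map K_0(S) -> K_0(S') induced by an inclusion S \<subseteq> S' (whose unitization is the
  inclusion Z x S \<subseteq> Z x S').\<close>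
definition k0_incl :: "('a, 'b) ring_scheme \<Rightarrow> 'a set
                       \<Rightarrow> ((int \<times> 'a) idm \<times> (int \<times> 'a) idm) set \<Rightarrow> ((int \<times> 'a) idm \<times> (int \<times> 'a) idm) set" where
  "k0_incl R S' c = k0_map (\<lambda>x. x) (unitz R S') c"

definition dl_rel :: "(nat \<Rightarrow> nat \<Rightarrow> 'g \<Rightarrow> 'g) \<Rightarrow> nat \<times> 'g \<Rightarrow> nat \<times> 'g \<Rightarrow> bool" where
  "dl_rel \<phi> a b = (\<exists>k. fst a \<le> k \<and> fst b \<le> k \<and> \<phi> (fst a) k (snd a) = \<phi> (fst b) k (snd b))"

definition dl_cls :: "(nat \<Rightarrow> 'g monoid) \<Rightarrow> (nat \<Rightarrow> nat \<Rightarrow> 'g \<Rightarrow> 'g) \<Rightarrow> nat \<times> 'g \<Rightarrow> (nat \<times> 'g) set" where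
  "dl_cls G \<phi> a = {b. snd b \<in> carrier (G (fst b)) \<and> dl_rel \<phi> a b}"

definition dirlim :: "(nat \<Rightarrow> 'g monoid) \<Rightarrow> (nat \<Rightarrow> nat \<Rightarrow> 'g \<Rightarrow> 'g) \<Rightarrow> (nat \<times> 'g) set monoid" where
  "dirlim G \<phi> = \<lparr>carrier = {dl_cls G \<phi> (n, x) | n x. x \<in> carrier (G n)},
     monoid.mult = (\<lambda>c d. let (n, x) = (SOME a. a \<in> c); (m, y) = (SOME a. a \<in> d); k = max n m in
                    dl_cls G \<phi> (k, \<phi> n k x \<otimes>\<^bsub>G k\<^esub> \<phi> m k y)),
     monoid.one = dl_cls G \<phi> (0, \<one>\<^bsub>G 0\<^esub>)\<rparr>"

end

theory Submission
  imports Defs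
begin

text \<open>
The operator norm makes \<open>\<B>(\<rat>\<^sub>p(X))\<close> a complete ultrametric ring, and giving \<open>\<int>\<close> the trivial
absolute value extends this to unitizations and then, by the maximum norm, to matrix rings; two elements
of a unitization at distance less than 1 have the same integral part. In a complete ultrametric ring an
element \<open>f\<close> with \<open>\<parallel>f\<^sup>2 - f\<parallel> < 1\<close> is corrected to an idempotent by Newton's iteration for \<open>x\<^sup>2 - x\<close>,
and an approximate equivalence of two idempotents is corrected to an exact one by a geometric series;
both corrections stay in any closed subring containing the data. Hence idempotent matrices over the
closure, and equivalences between them, already come from some \<open>A\<^sub>n\<close>, which is the surjectivity,
respectively the injectivity, of the map from the direct limit.
\<close>

section \<open>Complete ultrametric rings\<close>

text \<open>Idempotents need not have norm at most 1: on Q_p^2 the matrix with rows (1, 1/p) and (0,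
  0) is an idempotent of norm p. How close is close enough therefore depends on the norms involved,
  and every correction carries a bound \<open>C\<close> or \<open>B\<close> whose powers determine
  the tolerances. The corrections use only integral coefficients and no division, so they work for
  every p and survive the passage to unitizations over the integers. Discreteness of p-adic absolute
  values is what makes the operator norm submultiplicative: Q_p(X) is only a Z_p-module, and vectors
  can be rescaled only by powers of p. Since K_0 is defined by stable equivalence, injectivity
  requires the stabilizing idempotent, too, to be moved to a finite stage. The limit argument is
  carried out for abstract rings that share their operations and differ only in their carriers, so
  that inclusions are identity maps; unitizations and operators enter only as an instance.\<close>

lemma tendsto_0_squeeze:
  fixes f g :: "nat \<Rightarrow> real"
  assumes "\<And>n. 0 \<le> f n" "\<And>n. f n \<le> g n" "g \<longlonglongrightarrow> 0"
  shows "f \<longlonglongrightarrow> 0"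
  by (rule tendsto_sandwich[OF _ _ tendsto_const assms(3)]) (use assms in auto)

context ring begin

lemma minus_telescope:
  "x \<in> carrier R \<Longrightarrow> y \<in> carrier R \<Longrightarrow> z \<in> carrier R \<Longrightarrow> x \<ominus> z = (x \<ominus> y) \<oplus> (y \<ominus> z)"
  by algebra

lemma minus_add_self: "x \<in> carrier R \<Longrightarrow> y \<in> carrier R \<Longrightarrow> x \<ominus> (x \<oplus> y) = \<ominus> y"
  by algebra

lemma minus_plus: "x \<in> carrier R \<Longrightarrow> y \<in> carrier R \<Longrightarrow> x = (x \<ominus> y) \<oplus> y"
  by algebra

text \<open>The defect of an idempotent is zero, so that of \<open>f\<close> is a combination of
  terms each containing \<open>f \<ominus> e\<close>; an approximation of an idempotent is therefore
  almost idempotent.\<close>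

lemma defect_near_idempotent:
  assumes c: "f \<in> carrier R" "e \<in> carrier R" and ee: "e \<otimes> e = e"
  shows "f \<otimes> f \<ominus> f = (f \<ominus> e) \<otimes> f \<oplus> e \<otimes> (f \<ominus> e) \<ominus> (f \<ominus> e)"
proof -
  have "f \<otimes> f \<ominus> f = ((f \<ominus> e) \<otimes> f \<oplus> e \<otimes> (f \<ominus> e) \<ominus> (f \<ominus> e)) \<oplus> (e \<otimes> e \<ominus> e)"
    using c by algebra
  also have "e \<otimes> e \<ominus> e = \<zero>" using c by (simp add: ee)
  finally show ?thesis using c by simp
qed

end

text \<open>\<open>N_minus\<close> packs invariance under negation and the strong triangle
  inequality into one axiom. Completeness can be stated with consecutive differences, since in an
  ultrametric these already decide whether a sequence is Cauchy. \<open>N_one\<close> is an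
  inequality so that the zero ring qualifies, which occurs as the ring of 0 by 0 matrices.\<close>

locale ultrametric_ring = ring R for R (structure) +
  fixes N :: "'a \<Rightarrow> real"
  assumes N_nonneg: "x \<in> carrier R \<Longrightarrow> 0 \<le> N x"
    and N_zero: "N \<zero> = 0"
    and N_eq_0: "x \<in> carrier R \<Longrightarrow> N x = 0 \<Longrightarrow> x = \<zero>"
    and N_one: "N \<one> \<le> 1"
    and N_minus: "x \<in> carrier R \<Longrightarrow> y \<in> carrier R \<Longrightarrow> N (x \<ominus> y) \<le> max (N x) (N y)"
    and N_mult: "x \<in> carrier R \<Longrightarrow> y \<in> carrier R \<Longrightarrow> N (x \<otimes> y) \<le> N x * N y"
    and complete: "(\<And>n. s n \<in> carrier R) \<Longrightarrow> (\<lambda>n. N (s (Suc n) \<ominus> s n)) \<longlonglongrightarrow> 0 \<Longrightarrow>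
      \<exists>l\<in>carrier R. (\<lambda>n. N (l \<ominus> s n)) \<longlonglongrightarrow> 0"
begin

section \<open>Elementary ultrametric estimates and uniqueness of limits\<close>

lemma N_uminus: assumes "x \<in> carrier R" shows "N (\<ominus> x) = N x"
proof -
  have *: "N (\<ominus> y) \<le> N y" if "y \<in> carrier R" for y
    using N_minus[of \<zero> y] that N_nonneg[of y] by (simp add: N_zero minus_eq)
  show ?thesis using *[of x] *[of "\<ominus> x"] assms by simp
qed

lemma N_add: assumes "x \<in> carrier R" "y \<in> carrier R" shows "N (x \<oplus> y) \<le> max (N x) (N y)"
  using N_minus[of x "\<ominus> y"] assms by (simp add: minus_eq N_uminus)

lemma N_add_le: "x \<in> carrier R \<Longrightarrow> y \<in> carrier R \<Longrightarrow> N x \<le> b \<Longrightarrow> N y \<le> b \<Longrightarrow> N (x \<oplus> y) \<le> b"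
  using N_add[of x y] by linarith

lemma N_minus_le: "x \<in> carrier R \<Longrightarrow> y \<in> carrier R \<Longrightarrow> N x \<le> b \<Longrightarrow> N y \<le> b \<Longrightarrow> N (x \<ominus> y) \<le> b"
  using N_minus[of x y] by linarith

lemma N_mult_le: "x \<in> carrier R \<Longrightarrow> y \<in> carrier R \<Longrightarrow> N x \<le> a \<Longrightarrow> N y \<le> b \<Longrightarrow> N (x \<otimes> y) \<le> a * b"
  using N_mult[of x y] N_nonneg[of x] N_nonneg[of y] mult_mono[of "N x" a "N y" b] by linarith

text \<open>Positivity of \<open>b\<close> provides a term \<open>s n\<close> at distance less than
  \<open>b\<close> from \<open>l\<close>; the strong triangle inequality does the rest.\<close>

lemma tendsto_N_bounded:
  assumes l: "l \<in> carrier R" and s: "\<And>n. s n \<in> carrier R" and lim: "(\<lambda>n. N (l \<ominus> s n)) \<longlonglongrightarrow> 0"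
    and b: "\<And>n. N (s n) \<le> b" and "b > 0"
  shows "N l \<le> b"
proof -
  obtain n where "N (l \<ominus> s n) < b"
    using LIMSEQ_D[OF lim \<open>b > 0\<close>] by (auto simp: abs_less_iff)
  moreover have "l = (l \<ominus> s n) \<oplus> s n" using l s[of n] by algebra
  ultimately show ?thesis using N_add_le[of "l \<ominus> s n" "s n" b] l s b[of n] by simp
qed

lemma tendsto_N_unique:
  assumes l: "l \<in> carrier R" "l' \<in> carrier R" and s: "\<And>n. s n \<in> carrier R"
    and lim: "(\<lambda>n. N (l \<ominus> s n)) \<longlonglongrightarrow> 0" "(\<lambda>n. N (l' \<ominus> s n)) \<longlonglongrightarrow> 0"
  shows "l = l'"
proof -
  have "N (l \<ominus> l') \<le> max (N (l \<ominus> s n)) (N (l' \<ominus> s n))" for n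
  proof -
    have "l \<ominus> l' = (l \<ominus> s n) \<ominus> (l' \<ominus> s n)" using l s[of n] by algebra
    thus ?thesis using N_minus[of "l \<ominus> s n" "l' \<ominus> s n"] l s[of n] by simp
  qed
  hence "N (l \<ominus> l') \<le> max 0 0"
    by (intro LIMSEQ_le_const[OF tendsto_max[OF lim]]) auto
  hence "l \<ominus> l' = \<zero>" using N_nonneg[of "l \<ominus> l'"] N_eq_0[of "l \<ominus> l'"] l by auto
  thus ?thesis using l by simp
qed

text \<open>Submultiplicativity gives \<open>N q \<le> N q * N q\<close>, impossible for
  \<open>N q\<close> strictly between 0 and 1. This turns an approximate equality of two nested
  idempotents into an exact one.\<close>

lemma small_idempotent_eq_zero:
  assumes q: "q \<in> carrier R" "q \<otimes> q = q" and "N q < 1"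
  shows "q = \<zero>"
proof (rule ccontr)
  assume "q \<noteq> \<zero>"
  hence "N q > 0" using N_nonneg[of q] N_eq_0[of q] q by force
  moreover have "N q \<le> N q * N q" using N_mult[of q q] q by simp
  ultimately show False using \<open>N q < 1\<close> mult_strict_right_mono[of "N q" 1 "N q"] by simp
qed

text \<open>\<open>w\<close> is the sum of all powers of \<open>d\<close>, a right inverse of
  \<open>\<one> \<ominus> d\<close>, described as a fixed point so that no infinite sum has to be
  formed; the iterates \<open>s\<close> are the partial sums.\<close>

lemma geometric_series:
  assumes d: "d \<in> carrier R" and "N d < 1"
  obtains w where "w \<in> carrier R" "w = \<one> \<oplus> d \<otimes> w" "N w \<le> 1"
proof -
  define s where "s = rec_nat \<one> (\<lambda>_ x. \<one> \<oplus> d \<otimes> x)"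
  have s_Suc: "s (Suc n) = \<one> \<oplus> d \<otimes> s n" and s0: "s 0 = \<one>" for n by (simp_all add: s_def)
  have sc: "s n \<in> carrier R" for n by (induction n) (auto simp: s0 s_Suc d)
  have diff: "N (s (Suc n) \<ominus> s n) \<le> N d ^ Suc n" for n
  proof (induction n)
    case 0
    have "s (Suc 0) \<ominus> s 0 = d" using d by (simp add: s_Suc s0) algebra
    thus ?case by simp
  next
    case (Suc n)
    have "s (Suc (Suc n)) \<ominus> s (Suc n) = d \<otimes> (s (Suc n) \<ominus> s n)"
      unfolding s_Suc[of "Suc n"] s_Suc[of n] using d sc[of n] by algebra
    thus ?case using N_mult_le[of d "s (Suc n) \<ominus> s n", OF _ _ order_refl Suc.IH] d sc by simp
  qed
  have lim0: "(\<lambda>n. N d ^ n) \<longlonglongrightarrow> 0"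
    using \<open>N d < 1\<close> N_nonneg[OF d] by (intro LIMSEQ_power_zero) auto
  have "(\<lambda>n. N (s (Suc n) \<ominus> s n)) \<longlonglongrightarrow> 0"
    by (rule tendsto_sandwich[OF _ _ tendsto_const LIMSEQ_Suc[OF lim0]])
       (use diff N_nonneg sc in \<open>auto intro!: always_eventually\<close>)
  then obtain w where w: "w \<in> carrier R" and lim: "(\<lambda>n. N (w \<ominus> s n)) \<longlonglongrightarrow> 0"
    using complete[of s] sc by blast
  have "N (s n) \<le> 1" for n
  proof (induction n)
    case (Suc n)
    thus ?case using N_mult_le[of d "s n" 1 1] N_one \<open>N d < 1\<close> d sc
      by (auto simp: s_Suc intro!: N_add_le)
  qed (simp add: s0 N_one)
  hence "N w \<le> 1" using tendsto_N_bounded[OF w sc lim, of 1] by simp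
  have "w = \<one> \<oplus> d \<otimes> w"
  proof (rule tendsto_N_unique[of _ _ "\<lambda>n. s (Suc n)"])
    have le: "N (\<one> \<oplus> d \<otimes> w \<ominus> s (Suc n)) \<le> N (w \<ominus> s n)" for n
    proof -
      have "\<one> \<oplus> d \<otimes> w \<ominus> s (Suc n) = d \<otimes> (w \<ominus> s n)"
        unfolding s_Suc using d w sc[of n] by algebra
      thus ?thesis using N_mult_le[of d "w \<ominus> s n" 1] d w sc \<open>N d < 1\<close> by simp
    qed
    show "(\<lambda>n. N (\<one> \<oplus> d \<otimes> w \<ominus> s (Suc n))) \<longlonglongrightarrow> 0"
      by (rule tendsto_sandwich[OF _ _ tendsto_const lim])
         (use le N_nonneg sc d w in \<open>auto intro!: always_eventually\<close>)
    show "(\<lambda>n. N (w \<ominus> s (Suc n))) \<longlonglongrightarrow> 0" using LIMSEQ_Suc[OF lim] .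
  qed (use w d sc in auto)
  thus ?thesis using that w \<open>N w \<le> 1\<close> by blast
qed

text \<open>In the corner of \<open>e\<close> the product
  \<open>x \<otimes> y = e \<ominus> d\<close> is inverted by the geometric series \<open>w\<close>;
  absorbing the inverse into \<open>y\<close> makes this product exactly \<open>e\<close>. The other
  product is then an idempotent below \<open>f\<close>, and its difference from \<open>f\<close> is
  an idempotent of norm less than 1, hence zero. One series thus corrects both products.\<close>

lemma perturb_equivalence:
  assumes c: "e \<in> carrier R" "f \<in> carrier R" "x \<in> carrier R" "y \<in> carrier R"
    and ee: "e \<otimes> e = e" and ff: "f \<otimes> f = f"
    and ex: "e \<otimes> x = x" "x \<otimes> f = x" and fy: "f \<otimes> y = y" "y \<otimes> e = y"
    and small: "N (e \<ominus> x \<otimes> y) < 1" "N y * N (e \<ominus> x \<otimes> y) * N x < 1" "N (f \<ominus> y \<otimes> x) < 1"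
  shows "\<exists>x'\<in>carrier R. \<exists>y'\<in>carrier R. x' \<otimes> y' = e \<and> y' \<otimes> x' = f"
proof -
  define d where "d = e \<ominus> x \<otimes> y"
  have d: "d \<in> carrier R" using c by (simp add: d_def)
  obtain w where w: "w \<in> carrier R" "w = \<one> \<oplus> d \<otimes> w" "N w \<le> 1"
    using geometric_series[OF d] small(1) unfolding d_def by blast
  have ed: "e \<otimes> d = d"
  proof -
    have "e \<otimes> d = e \<otimes> e \<ominus> (e \<otimes> x) \<otimes> y" unfolding d_def using c by algebra
    thus ?thesis by (simp add: ee ex d_def)
  qed
  have xy: "x \<otimes> y = e \<ominus> d" unfolding d_def using c by algebra
  \<comment> \<open>The factor \<open>e\<close> on the right gives
    \<open>y' \<otimes> e = y'\<close>, on which the idempotency of \<open>y' \<otimes> x\<close>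
    rests.\<close>
  define y' where "y' = y \<otimes> w \<otimes> e"
  have y': "y' \<in> carrier R" using c w by (simp add: y'_def)
  have 1: "x \<otimes> y' = e"
  proof -
    have "x \<otimes> y' = (x \<otimes> y) \<otimes> w \<otimes> e" unfolding y'_def using c w(1) by (simp add: m_assoc)
    also have "\<dots> = (e \<otimes> w \<ominus> d \<otimes> w) \<otimes> e" unfolding xy using c w(1) d by algebra
    \<comment> \<open>Because \<open>d\<close> absorbs \<open>e\<close> on the left,
      \<open>e\<close> can be pulled out, and what remains is
      \<open>w \<ominus> d \<otimes> w = \<one>\<close>.\<close>
    also have "d \<otimes> w = e \<otimes> (d \<otimes> w)" using ed c(1) d w(1) by (simp add: m_assoc[symmetric])
    also have "e \<otimes> w \<ominus> e \<otimes> (d \<otimes> w) = e \<otimes> (w \<ominus> d \<otimes> w)" using c(1) d w(1) by algebra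
    also have "w \<ominus> d \<otimes> w = \<one>"
    proof -
      have "w \<ominus> d \<otimes> w = (\<one> \<oplus> d \<otimes> w) \<ominus> d \<otimes> w" using w(2) by simp
      also have "\<dots> = \<one>" using d w(1) by algebra
      finally show ?thesis .
    qed
    finally show ?thesis using c(1) ee by simp
  qed
  have fy': "f \<otimes> y' = y'" unfolding y'_def using c w(1) fy(1) by (simp add: m_assoc[symmetric])
  have ye: "y' \<otimes> e = y'" unfolding y'_def using c w(1) ee by (simp add: m_assoc)
  define z where "z = y' \<otimes> x"
  have z: "z \<in> carrier R" using y' c by (simp add: z_def)
  have zz: "z \<otimes> z = z"
  proof -
    have "z \<otimes> z = (y' \<otimes> (x \<otimes> y')) \<otimes> x" unfolding z_def using c y' by (simp add: m_assoc)
    thus ?thesis by (simp add: 1 ye z_def)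
  qed
  have fz: "f \<otimes> z = z" unfolding z_def using c y' fy' by (simp add: m_assoc[symmetric])
  have zf: "z \<otimes> f = z" unfolding z_def using c y' ex(2) by (simp add: m_assoc)
  have q_idem: "(f \<ominus> z) \<otimes> (f \<ominus> z) = f \<ominus> z"
  proof -
    have "(f \<ominus> z) \<otimes> (f \<ominus> z) = (f \<otimes> f \<ominus> f \<otimes> z) \<ominus> (z \<otimes> f \<ominus> z \<otimes> z)" using c z by algebra
    also have "\<dots> = f \<ominus> z" unfolding ff fz zf zz using c z by algebra
    finally show ?thesis .
  qed
  \<comment> \<open>Expanding \<open>w\<close> once splits off the given error
    \<open>f \<ominus> y \<otimes> x\<close>; the remaining term contains the factor
    \<open>d\<close>, and the second smallness assumption is made for it.\<close>
  have "N (f \<ominus> z) < 1"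
  proof -
    have "z = y \<otimes> w \<otimes> x" unfolding z_def y'_def using c w(1) ex(1) by (simp add: m_assoc)
    also have "\<dots> = y \<otimes> (\<one> \<oplus> d \<otimes> w) \<otimes> x" using w(2) by simp
    also have "\<dots> = y \<otimes> x \<oplus> y \<otimes> d \<otimes> w \<otimes> x" using c d w(1) by algebra
    finally have "f \<ominus> z = (f \<ominus> y \<otimes> x) \<ominus> y \<otimes> d \<otimes> w \<otimes> x" using c d w(1) by algebra
    moreover have "N (y \<otimes> d \<otimes> w \<otimes> x) \<le> N y * N d * 1 * N x"
      using c d w by (intro N_mult_le) auto
    ultimately show ?thesis
      using N_minus[of "f \<ominus> y \<otimes> x" "y \<otimes> d \<otimes> w \<otimes> x"] c d w small unfolding d_def by simp
  qed
  hence "f \<ominus> z = \<zero>" using small_idempotent_eq_zero[OF _ q_idem] c z by simp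
  hence "z = f" using c z by (metis r_right_minus_eq)
  thus ?thesis using 1 c y' by (auto simp: z_def)
qed

text \<open>The approximate witnesses are \<open>e \<otimes> f\<close> and
  \<open>f \<otimes> e\<close>. Their errors are
  \<open>e \<otimes> (e \<ominus> f) \<otimes> e\<close> and its mirror image, of norm at most
  \<open>C ^ 2\<close> times the distance. In \<open>perturb_equivalence\<close> the first error is
  multiplied by the norms of both witnesses, each at most \<open>C ^ 2\<close>; this is the origin
  of the exponent 6.\<close>

lemma close_idempotents_equivalent:
  assumes c: "e \<in> carrier R" "f \<in> carrier R"
    and ee: "e \<otimes> e = e" and ff: "f \<otimes> f = f"
    and C: "N e \<le> C" "N f \<le> C" "C \<ge> 1" and close: "N (f \<ominus> e) * C ^ 6 < 1"
  shows "\<exists>x'\<in>carrier R. \<exists>y'\<in>carrier R. x' \<otimes> y' = e \<and> y' \<otimes> x' = f"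
proof -
  let ?\<delta> = "N (f \<ominus> e)"
  have \<delta>: "?\<delta> \<ge> 0" using N_nonneg c by simp
  have pow: "C ^ 2 * ?\<delta> < 1"
  proof -
    have "C ^ 2 * ?\<delta> \<le> C ^ 6 * ?\<delta>" using C \<delta> by (intro mult_right_mono power_increasing) auto
    thus ?thesis using close by (simp add: mult.commute)
  qed
  have bd: "N (a \<otimes> d \<otimes> a) \<le> C ^ 2 * ?\<delta>" if "a \<in> carrier R" "N a \<le> C" "d \<in> carrier R" "N d = ?\<delta>" for a d
  proof -
    have "N (a \<otimes> d \<otimes> a) \<le> C * ?\<delta> * C" using that by (intro N_mult_le) auto
    thus ?thesis by (simp add: power2_eq_square mult_ac)
  qed
  have b1: "N (e \<ominus> (e \<otimes> f) \<otimes> (f \<otimes> e)) \<le> C ^ 2 * ?\<delta>"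
  proof -
    have "(e \<otimes> f) \<otimes> (f \<otimes> e) = e \<otimes> (f \<otimes> f) \<otimes> e" using c by (simp add: m_assoc)
    also have "\<dots> = e \<otimes> f \<otimes> e" by (simp add: ff)
    finally have "e \<ominus> (e \<otimes> f) \<otimes> (f \<otimes> e) = (e \<otimes> e) \<otimes> e \<ominus> e \<otimes> f \<otimes> e" by (simp add: ee)
    also have "\<dots> = e \<otimes> (e \<ominus> f) \<otimes> e" using c by algebra
    also have "e \<ominus> f = \<ominus> (f \<ominus> e)" using c by algebra
    finally show ?thesis using bd[of e "\<ominus> (f \<ominus> e)"] c C by (simp add: N_uminus)
  qed
  have b2: "N (f \<ominus> (f \<otimes> e) \<otimes> (e \<otimes> f)) \<le> C ^ 2 * ?\<delta>"
  proof -
    have "(f \<otimes> e) \<otimes> (e \<otimes> f) = f \<otimes> (e \<otimes> e) \<otimes> f" using c by (simp add: m_assoc)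
    also have "\<dots> = f \<otimes> e \<otimes> f" by (simp add: ee)
    finally have "f \<ominus> (f \<otimes> e) \<otimes> (e \<otimes> f) = (f \<otimes> f) \<otimes> f \<ominus> f \<otimes> e \<otimes> f" by (simp add: ff)
    also have "\<dots> = f \<otimes> (f \<ominus> e) \<otimes> f" using c by algebra
    finally show ?thesis using bd[of f "f \<ominus> e"] c C by simp
  qed
  have b3: "N (f \<otimes> e) \<le> C * C" "N (e \<otimes> f) \<le> C * C" using c C by (auto intro!: N_mult_le)
  have "N (f \<otimes> e) * N (e \<ominus> (e \<otimes> f) \<otimes> (f \<otimes> e)) * N (e \<otimes> f) \<le> (C * C) * (C ^ 2 * ?\<delta>) * (C * C)"
    using b1 b3 C \<delta> c by (intro mult_mono) (auto simp: N_nonneg)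
  also have "\<dots> = ?\<delta> * C ^ 6" by (simp add: power2_eq_square numeral_eq_Suc mult_ac)
  finally have b4: "N (f \<otimes> e) * N (e \<ominus> (e \<otimes> f) \<otimes> (f \<otimes> e)) * N (e \<otimes> f) < 1" using close by simp
  have *: "e \<otimes> (e \<otimes> f) = e \<otimes> f" "e \<otimes> f \<otimes> f = e \<otimes> f" "f \<otimes> (f \<otimes> e) = f \<otimes> e" "f \<otimes> e \<otimes> e = f \<otimes> e"
    using c by (simp_all add: m_assoc ee ff m_assoc[symmetric, of e e f] m_assoc[symmetric, of f f e])
  show ?thesis
    by (rule perturb_equivalence[of e f "e \<otimes> f" "f \<otimes> e"]) (use * b1 b2 b4 pow c ee ff in auto)
qed

text \<open>Newton's step for x^2 - x would divide by 2 f - 1, whose square is 1 + 4 u; so 2 f - 1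
  is its own inverse up to a multiple of \<open>u\<close>, and the correction \<open>b\<close>,
  which is (1 - 2 f) u, avoids the division. All elements are polynomials in \<open>f\<close>, but
  the ring is not commutative, so the commutations that occur are derived one by one.\<close>

lemma newton_step:
  assumes f: "f \<in> carrier R"
  defines "u \<equiv> f \<otimes> f \<ominus> f"
  defines "b \<equiv> u \<ominus> (f \<oplus> f) \<otimes> u"
  shows "(f \<oplus> b) \<otimes> (f \<oplus> b) \<ominus> (f \<oplus> b)
      = u \<otimes> u \<otimes> (\<ominus> (\<one> \<oplus> \<one> \<oplus> \<one>) \<oplus> (u \<oplus> u \<oplus> u \<oplus> u))"
proof -
  have u: "u \<in> carrier R" and ff: "f \<otimes> f = f \<oplus> u" using f unfolding u_def by (simp, algebra)
  have b: "b \<in> carrier R" using f u by (simp add: b_def)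
  have uf: "u \<otimes> f = f \<otimes> u" unfolding u_def using f by algebra
  have ffu: "f \<otimes> (f \<otimes> u) = f \<otimes> u \<oplus> u \<otimes> u"
    using ff f u by (simp add: m_assoc[symmetric] l_distr)
  define fu where "fu = f \<otimes> u"
  have fu: "fu \<in> carrier R" using f u by (simp add: fu_def)
  have b': "b = u \<ominus> (fu \<oplus> fu)" unfolding b_def fu_def using f u by algebra
  have fb: "f \<otimes> b = \<ominus> fu \<ominus> (u \<otimes> u \<oplus> u \<otimes> u)"
  proof -
    have "f \<otimes> b = f \<otimes> u \<ominus> (f \<otimes> (f \<otimes> u) \<oplus> f \<otimes> (f \<otimes> u))"
      unfolding b' fu_def using f u by algebra
    also have "\<dots> = \<ominus> fu \<ominus> (u \<otimes> u \<oplus> u \<otimes> u)"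
      unfolding ffu fu_def using f u by algebra
    finally show ?thesis .
  qed
  have bf: "b \<otimes> f = f \<otimes> b"
  proof -
    have "b \<otimes> f = u \<otimes> f \<ominus> (f \<otimes> (u \<otimes> f) \<oplus> f \<otimes> (u \<otimes> f))"
      unfolding b' fu_def using f u by algebra
    also have "\<dots> = f \<otimes> b" unfolding b' uf fu_def using f u by algebra
    finally show ?thesis .
  qed
  define v where "v = u \<otimes> u"
  have v: "v \<in> carrier R" using u by (simp add: v_def)
  have bu: "u \<otimes> b = b \<otimes> u"
  proof -
    have "u \<otimes> b = u \<otimes> u \<ominus> ((u \<otimes> f) \<otimes> u \<oplus> (u \<otimes> f) \<otimes> u)"
      unfolding b' fu_def using f u by algebra
    also have "\<dots> = b \<otimes> u" unfolding b' uf fu_def using f u by algebra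
    finally show ?thesis .
  qed
  define w where "w = u \<otimes> v \<oplus> u \<otimes> v \<oplus> u \<otimes> v \<oplus> u \<otimes> v"
  have w: "w \<in> carrier R" using u v by (simp add: w_def)
  have bb: "b \<otimes> b = v \<oplus> w"
  proof -
    have "b \<otimes> b = u \<otimes> b \<ominus> (f \<otimes> (u \<otimes> b) \<oplus> f \<otimes> (u \<otimes> b))"
      by (subst (1) b_def) (use f u b in algebra)
    also have "\<dots> = (b \<ominus> (f \<otimes> b \<oplus> f \<otimes> b)) \<otimes> u"
      unfolding bu using f u b by algebra
    also have "b \<ominus> (f \<otimes> b \<oplus> f \<otimes> b) = u \<oplus> (v \<oplus> v \<oplus> v \<oplus> v)"
      unfolding fb v_def[symmetric] unfolding b' using fu u v by algebra
    also have "\<dots> \<otimes> u = v \<oplus> w"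
      unfolding v_def w_def using u by algebra
    finally show ?thesis .
  qed
  have "(f \<oplus> b) \<otimes> (f \<oplus> b) \<ominus> (f \<oplus> b) = (f \<otimes> f \<ominus> f) \<oplus> (f \<otimes> b \<oplus> b \<otimes> f) \<oplus> b \<otimes> b \<ominus> b"
    using f b by algebra
  also have "\<dots> = u \<oplus> (f \<otimes> b \<oplus> f \<otimes> b) \<oplus> b \<otimes> b \<ominus> b" unfolding bf u_def ..
  also have "\<dots> = \<ominus> (v \<oplus> v \<oplus> v) \<oplus> w"
    unfolding bb fb v_def[symmetric] unfolding b' using fu u v w by algebra
  also have "\<dots> = u \<otimes> u \<otimes> (\<ominus> (\<one> \<oplus> \<one> \<oplus> \<one>) \<oplus> (u \<oplus> u \<oplus> u \<oplus> u))"
    unfolding v_def w_def using u by algebra simp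
  finally show ?thesis .
qed

text \<open>Newton's iteration \<open>f \<mapsto> 3 f\<^sup>2 - 2 f\<^sup>3\<close> squares the defect \<open>f\<^sup>2 - f\<close> up to an integral factor.\<close>
lemma almost_idempotent_lift:
  assumes f: "f \<in> carrier R" and C: "N f \<le> C" "1 \<le> C" and small: "N (f \<otimes> f \<ominus> f) < 1"
  obtains g where "g \<in> carrier R" "g \<otimes> g = g" "N (g \<ominus> f) \<le> C * N (f \<otimes> f \<ominus> f)"
\<comment> \<open>A vanishing defect is treated apart because \<open>tendsto_N_bounded\<close> is
  going to be applied with the bound \<open>C * r\<close>, which must be positive.\<close>
proof (cases "N (f \<otimes> f \<ominus> f) = 0")
  case True
  hence "f \<otimes> f = f" using N_eq_0[of "f \<otimes> f \<ominus> f"] f by simp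
  moreover have "f \<ominus> f = \<zero>" using f by algebra
  ultimately show ?thesis using that[of f] f True by (simp add: N_zero)
next
  case False
  define U where "U x = x \<otimes> x \<ominus> x" for x
  define r where "r = N (U f)"
  have r: "0 < r" "r < 1" using False N_nonneg[of "U f"] f small by (auto simp: r_def U_def)
  define B where "B x = U x \<ominus> (x \<oplus> x) \<otimes> U x" for x
  define s where "s = rec_nat f (\<lambda>_ x. x \<oplus> B x)"
  have s0: "s 0 = f" and s_Suc: "s (Suc n) = s n \<oplus> B (s n)" for n by (simp_all add: s_def)
  have Uc: "U x \<in> carrier R" and Bc: "B x \<in> carrier R" if "x \<in> carrier R" for x
    using that by (simp_all add: U_def B_def)
  have sc: "s n \<in> carrier R" for n by (induction n) (auto simp: s0 s_Suc f Bc)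
  have NB: "N (B x) \<le> C * b" if x: "x \<in> carrier R" "N x \<le> C" "N (U x) \<le> b" for x b
  proof -
    have b: "0 \<le> b" using N_nonneg[OF Uc[OF x(1)]] x(3) by simp
    hence "N (U x) \<le> C * b" using x(3) C(2) mult_right_mono[of 1 C b] by simp
    moreover have "N ((x \<oplus> x) \<otimes> U x) \<le> C * b" using x Uc by (intro N_mult_le N_add_le) auto
    ultimately show ?thesis unfolding B_def using x Uc by (intro N_minus_le) auto
  qed
  \<comment> \<open>Quadratic convergence is not exploited: one factor \<open>r\<close> per step is
    enough. The bounds on \<open>s n\<close> and \<open>s n \<ominus> f\<close> keep the constant
    \<open>C\<close> the same along the whole iteration.\<close>
  have main: "N (U (s n)) \<le> r ^ Suc n \<and> N (s n) \<le> C \<and> N (s n \<ominus> f) \<le> C * r" for n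
  proof (induction n)
    case 0
    have "f \<ominus> f = \<zero>" using f by algebra
    thus ?case using C r by (simp add: s0 r_def N_zero)
  next
    case (Suc n)
    let ?x = "s n" and ?u = "U (s n)"
    have x: "?x \<in> carrier R" and u: "?u \<in> carrier R" using sc Uc by auto
    have "r ^ Suc n \<le> r * 1" unfolding power_Suc using r by (intro mult_left_mono power_le_one) auto
    hence ur: "N ?u \<le> r ^ Suc n" "N ?u \<le> r" "N ?u \<le> 1"
      using Suc.IH r(2) by linarith+
    have "N (B ?x) \<le> C * r" using NB[OF x _ ur(2)] Suc.IH by auto
    moreover have "N (B ?x) \<le> C"
      using NB[OF x _ ur(3)] Suc.IH by auto
    moreover have "s (Suc n) \<ominus> f = (?x \<ominus> f) \<oplus> B ?x"
      unfolding s_Suc using x f Bc[OF x] by algebra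
    ultimately have 1: "N (s (Suc n)) \<le> C" "N (s (Suc n) \<ominus> f) \<le> C * r"
      using Suc.IH x f Bc[OF x] by (auto simp: s_Suc intro!: N_add_le)
    have "U (s (Suc n)) = ?u \<otimes> ?u \<otimes> (\<ominus> (\<one> \<oplus> \<one> \<oplus> \<one>) \<oplus> (?u \<oplus> ?u \<oplus> ?u \<oplus> ?u))"
      using newton_step[OF x] unfolding s_Suc B_def U_def .
    also have "N \<dots> \<le> (r ^ Suc n * r) * 1"
      using u ur N_one by (intro N_mult_le N_add_le) (auto simp: N_uminus intro!: N_add_le)
    finally show ?case using 1 by (simp add: mult_ac)
  qed
  have lim0: "(\<lambda>n. C * r ^ n) \<longlonglongrightarrow> C * 0" using r by (intro tendsto_intros LIMSEQ_power_zero) auto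
  have "(\<lambda>n. N (s (Suc n) \<ominus> s n)) \<longlonglongrightarrow> 0"
  proof (rule tendsto_sandwich[OF _ _ tendsto_const LIMSEQ_Suc[OF lim0, simplified]])
    have "s (Suc n) \<ominus> s n = B (s n)" for n
      unfolding s_Suc using sc[of n] Bc[OF sc[of n]] by algebra
    thus "\<forall>\<^sub>F n in sequentially. N (s (Suc n) \<ominus> s n) \<le> C * (r * r ^ n)"
      using NB[OF sc] main by (auto intro!: always_eventually)
  qed (use N_nonneg sc in \<open>auto intro!: always_eventually\<close>)
  then obtain g where g: "g \<in> carrier R" and lim: "(\<lambda>n. N (g \<ominus> s n)) \<longlonglongrightarrow> 0"
    using complete[of s] sc by blast
  have "N (g \<ominus> f) \<le> C * r"
  proof (rule tendsto_N_bounded[of _ "\<lambda>n. s n \<ominus> f"])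
    have "g \<ominus> f \<ominus> (s n \<ominus> f) = g \<ominus> s n" for n using g f sc[of n] by algebra
    thus "(\<lambda>n. N (g \<ominus> f \<ominus> (s n \<ominus> f))) \<longlonglongrightarrow> 0" using lim by simp
  qed (use g f sc main C r in auto)
  \<comment> \<open>Both sides are limits of \<open>s\<close>; for \<open>g \<otimes> g\<close> this
    uses that the defects of the iterates tend to zero.\<close>
  moreover have "g \<otimes> g = g"
  proof (rule tendsto_N_unique[of _ _ s])
    have gC: "N g \<le> C" by (rule tendsto_N_bounded[OF g sc lim]) (use main C in auto)
    have "N (g \<otimes> g \<ominus> s n) \<le> C * N (g \<ominus> s n) + r ^ Suc n" for n
    proof -
      let ?x = "s n"
      have eq: "g \<otimes> g \<ominus> ?x = (g \<otimes> (g \<ominus> ?x) \<oplus> (g \<ominus> ?x) \<otimes> ?x) \<oplus> U ?x"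
        unfolding U_def using g sc[of n] by algebra
      have "N (g \<otimes> (g \<ominus> ?x) \<oplus> (g \<ominus> ?x) \<otimes> ?x) \<le> C * N (g \<ominus> ?x)"
        using g sc[of n] gC main[of n] N_mult_le[of "g \<ominus> ?x" ?x "N (g \<ominus> ?x)" C]
          N_mult_le[of g "g \<ominus> ?x" C "N (g \<ominus> ?x)"]
        by (intro N_add_le) (auto simp: mult_ac)
      moreover have "N (U ?x) \<le> r ^ Suc n" using main by blast
      moreover have "0 \<le> C * N (g \<ominus> ?x)" "0 \<le> r ^ Suc n" using C r g sc N_nonneg[of "g \<ominus> ?x"] by auto
      ultimately show ?thesis
        using N_add[of "g \<otimes> (g \<ominus> ?x) \<oplus> (g \<ominus> ?x) \<otimes> ?x" "U ?x"] g sc[of n] Uc[OF sc[of n]]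
        unfolding eq by simp
    qed
    note le = this
    have lim': "(\<lambda>n. C * N (g \<ominus> s n) + r ^ Suc n) \<longlonglongrightarrow> C * 0 + 0"
      using r by (intro tendsto_intros lim LIMSEQ_Suc LIMSEQ_power_zero) auto
    show "(\<lambda>n. N (g \<otimes> g \<ominus> s n)) \<longlonglongrightarrow> 0"
    proof (rule tendsto_0_squeeze)
      show "0 \<le> N (g \<otimes> g \<ominus> s n)" for n using g sc by (intro N_nonneg) auto
      show "N (g \<otimes> g \<ominus> s n) \<le> C * N (g \<ominus> s n) + r ^ Suc n" for n by (rule le)
      show "(\<lambda>n. C * N (g \<ominus> s n) + r ^ Suc n) \<longlonglongrightarrow> 0" using lim' by (simp only: mult_zero_right add_0)
    qed
  qed (use g sc lim in auto)
  ultimately show ?thesis using that g by (simp add: r_def U_def)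
qed

end

section \<open>Matrix rings\<close>

definition matring :: "('a, 'b) ring_scheme \<Rightarrow> nat \<Rightarrow> 'a mat ring" where
  "matring R n = \<lparr>carrier = mats R n n, monoid.mult = mmul R n n n,
     monoid.one = (\<lambda>i j. if i < n \<and> i = j then \<one>\<^bsub>R\<^esub> else \<zero>\<^bsub>R\<^esub>),
     ring.zero = (\<lambda>i j. \<zero>\<^bsub>R\<^esub>), ring.add = (\<lambda>M N i j. M i j \<oplus>\<^bsub>R\<^esub> N i j)\<rparr>"

lemma matring_simps [simp]:
  "carrier (matring R n) = mats R n n" "monoid.mult (matring R n) = mmul R n n n"
  "\<one>\<^bsub>matring R n\<^esub> = (\<lambda>i j. if i < n \<and> i = j then \<one>\<^bsub>R\<^esub> else \<zero>\<^bsub>R\<^esub>)"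
  "\<zero>\<^bsub>matring R n\<^esub> = (\<lambda>i j. \<zero>\<^bsub>R\<^esub>)" "M \<oplus>\<^bsub>matring R n\<^esub> M' = (\<lambda>i j. M i j \<oplus>\<^bsub>R\<^esub> M' i j)"
  by (simp_all add: matring_def)

lemma mats_eqI:
  assumes "A \<in> mats R n m" "B \<in> mats R n m" "\<And>i j. i < n \<Longrightarrow> j < m \<Longrightarrow> A i j = B i j"
  shows "A = B"
proof (intro ext)
  fix i j show "A i j = B i j" using assms by (cases "i < n \<and> j < m") (auto simp: mats_def)
qed

context ring begin

lemma finsum_lessThan_Suc:
  "(\<And>l. l \<le> k \<Longrightarrow> f l \<in> carrier R) \<Longrightarrow> finsum R f {..<Suc k} = f k \<oplus> finsum R f {..<k}"
  unfolding lessThan_Suc by (subst finsum_insert) auto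

lemma finsum_lessThan_closed:
  "(\<And>l. l < (k::nat) \<Longrightarrow> f l \<in> carrier R) \<Longrightarrow> finsum R f {..<k} \<in> carrier R"
  by (intro finsum_closed) auto

lemma finsum_lessThan_cong:
  "(\<And>l. l < (k::nat) \<Longrightarrow> f l = g l) \<Longrightarrow> (\<And>l. l < k \<Longrightarrow> g l \<in> carrier R) \<Longrightarrow> finsum R f {..<k} = finsum R g {..<k}"
  by (intro finsum_cong) (auto simp: simp_implies_def)

lemma finsum_lessThan_add:
  "(\<And>l. l < (k::nat) \<Longrightarrow> f l \<in> carrier R) \<Longrightarrow> (\<And>l. l < k \<Longrightarrow> g l \<in> carrier R) \<Longrightarrow>
   finsum R (\<lambda>l. f l \<oplus> g l) {..<k} = finsum R f {..<k} \<oplus> finsum R g {..<k}"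
  by (intro finsum_addf) auto

lemma finsum_lessThan_mult_right:
  assumes "a \<in> carrier R" "\<And>l. l < (k::nat) \<Longrightarrow> f l \<in> carrier R"
  shows "finsum R f {..<k} \<otimes> a = finsum R (\<lambda>l. f l \<otimes> a) {..<k}"
  using assms by (intro finsum_ldistr) auto

lemma finsum_lessThan_mult_left:
  assumes "a \<in> carrier R" "\<And>l. l < (k::nat) \<Longrightarrow> f l \<in> carrier R"
  shows "a \<otimes> finsum R f {..<k} = finsum R (\<lambda>l. a \<otimes> f l) {..<k}"
  using assms by (intro finsum_rdistr) auto

lemma finsum_lessThan_swap:
  assumes "\<And>i j. i < (a::nat) \<Longrightarrow> j < (b::nat) \<Longrightarrow> f i j \<in> carrier R"
  shows "finsum R (\<lambda>i. finsum R (\<lambda>j. f i j) {..<b}) {..<a} = finsum R (\<lambda>j. finsum R (\<lambda>i. f i j) {..<a}) {..<b}"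
  using assms
proof (induction a)
  case 0
  show ?case by simp
next
  case (Suc a)
  have "finsum R (\<lambda>i. finsum R (\<lambda>j. f i j) {..<b}) {..<Suc a}
      = finsum R (\<lambda>j. f a j) {..<b} \<oplus> finsum R (\<lambda>j. finsum R (\<lambda>i. f i j) {..<a}) {..<b}"
    by (subst finsum_lessThan_Suc) (auto intro!: finsum_lessThan_closed simp: Suc)
  also have "\<dots> = finsum R (\<lambda>j. f a j \<oplus> finsum R (\<lambda>i. f i j) {..<a}) {..<b}"
    by (rule finsum_lessThan_add[symmetric]) (auto intro!: finsum_lessThan_closed simp: Suc)
  also have "\<dots> = finsum R (\<lambda>j. finsum R (\<lambda>i. f i j) {..<Suc a}) {..<b}"
    by (rule finsum_lessThan_cong, subst finsum_lessThan_Suc)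
       (auto intro!: finsum_lessThan_closed simp: Suc)
  finally show ?case .
qed

lemma finsum_lessThan_extend:
  assumes "(k::nat) \<le> k'" "\<And>l. l < k \<Longrightarrow> f l \<in> carrier R" "\<And>l. k \<le> l \<Longrightarrow> l < k' \<Longrightarrow> f l = \<zero>"
  shows "finsum R f {..<k'} = finsum R f {..<k}"
  using assms by (intro add.finprod_mono_neutral_cong_left[symmetric]) (auto, metis not_le zero_closed)

lemma finsum_lessThan_delta:
  assumes "(c::nat) < k" "f c \<in> carrier R"
  shows "finsum R (\<lambda>l. if l = c then f l else \<zero>) {..<k} = f c"
  using assms finsum_singleton[of c "{..<k}" "\<lambda>_. f c"] by (simp add: eq_commute cong: if_cong)

lemma matsD: "A \<in> mats R n m \<Longrightarrow> A i j \<in> carrier R"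
  by (cases "i < n \<and> j < m") (auto simp: mats_def)

lemma mats_mono: "n \<le> n' \<Longrightarrow> m \<le> m' \<Longrightarrow> mats R n m \<subseteq> mats R n' m'"
  by (auto simp: mats_def) (metis le_trans linorder_not_le zero_closed)+

lemma mmul_closed:
  assumes "A \<in> mats R n k" "B \<in> mats R k m" shows "mmul R n k m A B \<in> mats R n m"
  using matsD[OF assms(1)] matsD[OF assms(2)]
  by (auto simp: mats_def mmul_def intro!: finsum_lessThan_closed)

text \<open>\<open>mats\<close> demands zeros outside the block, so a matrix is at the same time a
  matrix of every larger size, and the additional summands vanish. Matrices of different sizes can
  thus be multiplied in one square ring.\<close>

lemma mmul_extend:
  assumes A: "A \<in> mats R n k" and B: "B \<in> mats R k m" and le: "n \<le> n'" "k \<le> k'" "m \<le> m'"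
  shows "mmul R n' k' m' A B = mmul R n k m A B"
proof (intro ext)
  fix i j
  note c = matsD[OF A] matsD[OF B]
  have "finsum R (\<lambda>l. A i l \<otimes> B l j) {..<k'} = finsum R (\<lambda>l. A i l \<otimes> B l j) {..<k}"
    using le A B c by (intro finsum_lessThan_extend) (auto simp: mats_def)
  moreover have "finsum R (\<lambda>l. A i l \<otimes> B l j) {..<k} = \<zero>" if "\<not> (i < n \<and> j < m)"
  proof -
    have "finsum R (\<lambda>l. A i l \<otimes> B l j) {..<k} = finsum R (\<lambda>l. \<zero>) {..<k}"
    proof (rule finsum_lessThan_cong)
      fix l
      have "A i l = \<zero> \<or> B l j = \<zero>" using that A B by (auto simp: mats_def)
      thus "A i l \<otimes> B l j = \<zero>" using c by auto
    qed auto
    thus ?thesis by simp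
  qed
  ultimately show "mmul R n' k' m' A B i j = mmul R n k m A B i j"
    using le by (auto simp: mmul_def)
qed

lemma mmul_assoc:
  assumes A: "A \<in> mats R n k" and B: "B \<in> mats R k l" and C: "C \<in> mats R l m"
  shows "mmul R n l m (mmul R n k l A B) C = mmul R n k m A (mmul R k l m B C)"
proof (rule mats_eqI)
  fix i j assume ij: "i < n" "j < m"
  note c = matsD[OF A] matsD[OF B] matsD[OF C]
  have "mmul R n l m (mmul R n k l A B) C i j
      = finsum R (\<lambda>b. finsum R (\<lambda>a. A i a \<otimes> B a b) {..<k} \<otimes> C b j) {..<l}"
    using ij c by (auto simp: mmul_def intro!: finsum_lessThan_cong finsum_lessThan_closed)
  also have "\<dots> = finsum R (\<lambda>b. finsum R (\<lambda>a. A i a \<otimes> B a b \<otimes> C b j) {..<k}) {..<l}"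
    using c by (intro finsum_lessThan_cong finsum_lessThan_mult_right) (auto intro!: finsum_lessThan_closed)
  also have "\<dots> = finsum R (\<lambda>a. finsum R (\<lambda>b. A i a \<otimes> B a b \<otimes> C b j) {..<l}) {..<k}"
    using c by (intro finsum_lessThan_swap) auto
  also have "\<dots> = finsum R (\<lambda>a. A i a \<otimes> finsum R (\<lambda>b. B a b \<otimes> C b j) {..<l}) {..<k}"
    using c by (intro finsum_lessThan_cong, subst finsum_lessThan_mult_left)
      (auto simp: m_assoc intro!: finsum_lessThan_closed)
  also have "\<dots> = mmul R n k m A (mmul R k l m B C) i j"
    using ij c by (auto simp: mmul_def intro!: finsum_lessThan_cong finsum_lessThan_closed)
  finally show "mmul R n l m (mmul R n k l A B) C i j = mmul R n k m A (mmul R k l m B C) i j" .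
qed (use assms in \<open>auto intro!: mmul_closed\<close>)

lemma ring_matring: "ring (matring R n)"
proof (rule ringI)
  show "abelian_group (matring R n)"
  proof (rule abelian_groupI)
    fix x y z
    assume "x \<in> carrier (matring R n)" "y \<in> carrier (matring R n)" "z \<in> carrier (matring R n)"
    hence x: "x \<in> mats R n n" and y: "y \<in> mats R n n" and z: "z \<in> mats R n n" by auto
    note c = matsD[OF x] matsD[OF y] matsD[OF z]
    show "x \<oplus>\<^bsub>matring R n\<^esub> y \<in> carrier (matring R n)" using x y by (auto simp: mats_def)
    show "x \<oplus>\<^bsub>matring R n\<^esub> y \<oplus>\<^bsub>matring R n\<^esub> z = x \<oplus>\<^bsub>matring R n\<^esub> (y \<oplus>\<^bsub>matring R n\<^esub> z)"
      using c by (simp add: a_assoc)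
    show "x \<oplus>\<^bsub>matring R n\<^esub> y = y \<oplus>\<^bsub>matring R n\<^esub> x" unfolding matring_simps by (intro ext a_comm c)
    show "\<zero>\<^bsub>matring R n\<^esub> \<oplus>\<^bsub>matring R n\<^esub> x = x" using c by simp
    show "\<exists>y\<in>carrier (matring R n). y \<oplus>\<^bsub>matring R n\<^esub> x = \<zero>\<^bsub>matring R n\<^esub>"
      using x c by (intro bexI[of _ "\<lambda>i j. \<ominus> x i j"]) (auto simp: mats_def l_neg)
  next
    show "\<zero>\<^bsub>matring R n\<^esub> \<in> carrier (matring R n)" by (simp add: mats_def)
  qed
  show "monoid (matring R n)"
  proof (rule monoidI)
    fix x y z
    assume x: "x \<in> carrier (matring R n)" and y: "y \<in> carrier (matring R n)" and z: "z \<in> carrier (matring R n)"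
    show "x \<otimes>\<^bsub>matring R n\<^esub> y \<in> carrier (matring R n)" using x y by (auto intro: mmul_closed)
    show "x \<otimes>\<^bsub>matring R n\<^esub> y \<otimes>\<^bsub>matring R n\<^esub> z = x \<otimes>\<^bsub>matring R n\<^esub> (y \<otimes>\<^bsub>matring R n\<^esub> z)"
      using x y z by (simp add: mmul_assoc)
  next
    show one: "\<one>\<^bsub>matring R n\<^esub> \<in> carrier (matring R n)" by (auto simp: mats_def)
    fix x assume x: "x \<in> carrier (matring R n)"
    have c: "x i j \<in> carrier R" for i j using x matsD by auto
    show "\<one>\<^bsub>matring R n\<^esub> \<otimes>\<^bsub>matring R n\<^esub> x = x"
    proof (rule mats_eqI)
      fix i j assume ij: "i < n" "j < n"
      have "(\<one>\<^bsub>matring R n\<^esub> \<otimes>\<^bsub>matring R n\<^esub> x) i j = finsum R (\<lambda>l. if l = i then x l j else \<zero>) {..<n}"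
        using ij c by (auto simp: mmul_def intro!: finsum_lessThan_cong)
      also have "\<dots> = x i j" using ij c by (intro finsum_lessThan_delta) auto
      finally show "(\<one>\<^bsub>matring R n\<^esub> \<otimes>\<^bsub>matring R n\<^esub> x) i j = x i j" .
    qed (use x one in \<open>auto intro!: mmul_closed\<close>)
    show "x \<otimes>\<^bsub>matring R n\<^esub> \<one>\<^bsub>matring R n\<^esub> = x"
    proof (rule mats_eqI)
      fix i j assume ij: "i < n" "j < n"
      have "(x \<otimes>\<^bsub>matring R n\<^esub> \<one>\<^bsub>matring R n\<^esub>) i j = finsum R (\<lambda>l. if l = j then x i l else \<zero>) {..<n}"
        using ij c by (auto simp: mmul_def intro!: finsum_lessThan_cong)
      also have "\<dots> = x i j" using ij c by (intro finsum_lessThan_delta) auto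
      finally show "(x \<otimes>\<^bsub>matring R n\<^esub> \<one>\<^bsub>matring R n\<^esub>) i j = x i j" .
    qed (use x one in \<open>auto intro!: mmul_closed\<close>)
  qed
next
  fix x y z
  assume x: "x \<in> carrier (matring R n)" and y: "y \<in> carrier (matring R n)" and z: "z \<in> carrier (matring R n)"
  have c: "x i j \<in> carrier R" "y i j \<in> carrier R" "z i j \<in> carrier R" for i j using x y z matsD by auto
  show "(x \<oplus>\<^bsub>matring R n\<^esub> y) \<otimes>\<^bsub>matring R n\<^esub> z = x \<otimes>\<^bsub>matring R n\<^esub> z \<oplus>\<^bsub>matring R n\<^esub> y \<otimes>\<^bsub>matring R n\<^esub> z"
    using c by (auto simp: mmul_def l_distr finsum_lessThan_add intro!: ext)
  show "z \<otimes>\<^bsub>matring R n\<^esub> (x \<oplus>\<^bsub>matring R n\<^esub> y) = z \<otimes>\<^bsub>matring R n\<^esub> x \<oplus>\<^bsub>matring R n\<^esub> z \<otimes>\<^bsub>matring R n\<^esub> y"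
    using c by (auto simp: mmul_def r_distr finsum_lessThan_add intro!: ext)
qed

lemma matring_uminus:
  assumes x: "x \<in> mats R n n" shows "\<ominus>\<^bsub>matring R n\<^esub> x = (\<lambda>i j. \<ominus> x i j)"
proof -
  interpret M: ring "matring R n" by (rule ring_matring)
  show ?thesis
    by (rule M.minus_equality) (use x matsD[OF x] in \<open>auto simp: mats_def l_neg\<close>)
qed

lemma matring_minus:
  "x \<in> mats R n n \<Longrightarrow> y \<in> mats R n n \<Longrightarrow> x \<ominus>\<^bsub>matring R n\<^esub> y = (\<lambda>i j. x i j \<ominus> y i j)"
  by (simp add: a_minus_def matring_uminus)

end

section \<open>The maximum norm on matrices\<close>

definition matnorm :: "('a \<Rightarrow> real) \<Rightarrow> nat \<Rightarrow> 'a mat \<Rightarrow> real" where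
  "matnorm N n M = Max (insert 0 ((\<lambda>(i, j). N (M i j)) ` ({..<n} \<times> {..<n})))"

lemma matnorm_le_iff: "matnorm N n M \<le> b \<longleftrightarrow> 0 \<le> b \<and> (\<forall>i<n. \<forall>j<n. N (M i j) \<le> b)"
  unfolding matnorm_def by (subst Max_le_iff) auto

lemma matnorm_nonneg: "0 \<le> matnorm N n M"
  unfolding matnorm_def by (rule Max_ge) auto

lemma matnorm_entry: "i < n \<Longrightarrow> j < n \<Longrightarrow> N (M i j) \<le> matnorm N n M"
  using matnorm_le_iff[of N n M "matnorm N n M"] by simp

context ultrametric_ring begin

lemma N_finsum_le:
  "(\<And>l. l < (k::nat) \<Longrightarrow> f l \<in> carrier R) \<Longrightarrow> (\<And>l. l < k \<Longrightarrow> N (f l) \<le> b) \<Longrightarrow> 0 \<le> b \<Longrightarrow> N (finsum R f {..<k}) \<le> b"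
proof (induction k)
  case (Suc k)
  thus ?case by (subst finsum_lessThan_Suc) (auto intro!: N_add_le finsum_lessThan_closed)
qed (simp add: N_zero)

text \<open>The 0 inserted in \<open>matnorm\<close> gives the empty matrix norm 0. The strong
  triangle inequality makes the maximum of the entries submultiplicative without a factor depending
  on the size.\<close>

lemma ultrametric_matring: "ultrametric_ring (matring R n) (matnorm N n)"
proof (intro ultrametric_ring.intro ultrametric_ring_axioms.intro)
  show "ring (matring R n)" by (rule ring_matring)
  show "0 \<le> matnorm N n x" for x by (rule matnorm_nonneg)
  show "matnorm N n \<zero>\<^bsub>matring R n\<^esub> = 0"
    using matnorm_le_iff[of N n "\<lambda>i j. \<zero>" 0] matnorm_nonneg[of N n "\<lambda>i j. \<zero>"] by (simp add: N_zero)
  show "matnorm N n \<one>\<^bsub>matring R n\<^esub> \<le> 1" by (auto simp: matnorm_le_iff N_zero N_one)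
next
  fix x assume x: "x \<in> carrier (matring R n)" and 0: "matnorm N n x = 0"
  have "x i j = \<zero>" for i j
  proof (cases "i < n \<and> j < n")
    case True
    hence "N (x i j) \<le> 0" using matnorm_entry[of i n j N x] 0 by simp
    thus ?thesis using N_eq_0[of "x i j"] N_nonneg[of "x i j"] x matsD[of x] by force
  qed (use x in \<open>auto simp: mats_def\<close>)
  thus "x = \<zero>\<^bsub>matring R n\<^esub>" by auto
next
  fix x y assume "x \<in> carrier (matring R n)" "y \<in> carrier (matring R n)"
  hence xy: "x \<in> mats R n n" "y \<in> mats R n n" by auto
  note c = matsD[OF xy(1)] matsD[OF xy(2)]
  note e = matnorm_entry[of _ n _ N x] matnorm_entry[of _ n _ N y]
  show "matnorm N n (x \<ominus>\<^bsub>matring R n\<^esub> y) \<le> max (matnorm N n x) (matnorm N n y)"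
  proof -
    have "N (x i j \<ominus> y i j) \<le> max (matnorm N n x) (matnorm N n y)" if "i < n" "j < n" for i j
      using N_minus[OF c(1)[of i j] c(2)[of i j]] e(1)[OF that] e(2)[OF that] by linarith
    thus ?thesis using xy by (simp add: matnorm_le_iff matring_minus matnorm_nonneg max.coboundedI1)
  qed
  show "matnorm N n (x \<otimes>\<^bsub>matring R n\<^esub> y) \<le> matnorm N n x * matnorm N n y"
  proof -
    have "N (finsum R (\<lambda>l. x i l \<otimes> y l j) {..<n}) \<le> matnorm N n x * matnorm N n y" if "i < n" "j < n" for i j
      using c e that by (intro N_finsum_le N_mult_le mult_nonneg_nonneg matnorm_nonneg) auto
    thus ?thesis by (auto simp: matnorm_le_iff mmul_def matnorm_nonneg)
  qed
next
  fix s :: "nat \<Rightarrow> 'a mat"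
  assume "\<And>k. s k \<in> carrier (matring R n)"
  hence s: "s k \<in> mats R n n" for k by simp
  assume lim: "(\<lambda>k. matnorm N n (s (Suc k) \<ominus>\<^bsub>matring R n\<^esub> s k)) \<longlonglongrightarrow> 0"
  have ex: "\<exists>l\<in>carrier R. (\<lambda>k. N (l \<ominus> s k i j)) \<longlonglongrightarrow> 0" if "i < n" "j < n" for i j
  proof (rule complete)
    show "(\<lambda>k. N (s (Suc k) i j \<ominus> s k i j)) \<longlonglongrightarrow> 0"
    proof (rule tendsto_0_squeeze[OF _ _ lim])
      show "N (s (Suc k) i j \<ominus> s k i j) \<le> matnorm N n (s (Suc k) \<ominus>\<^bsub>matring R n\<^esub> s k)" for k
        using that matnorm_entry[of i n j N "s (Suc k) \<ominus>\<^bsub>matring R n\<^esub> s k"] s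
        by (simp add: matring_minus)
    qed (use matsD[OF s] in \<open>auto intro!: N_nonneg\<close>)
  qed (use matsD[OF s] in auto)
  \<comment> \<open>The default outside the block puts the entrywise limit into
    \<open>mats\<close>.\<close>
  define l where "l i j = (if i < n \<and> j < n then SOME x. x \<in> carrier R \<and> (\<lambda>k. N (x \<ominus> s k i j)) \<longlonglongrightarrow> 0 else \<zero>)" for i j
  have l: "l i j \<in> carrier R \<and> (\<lambda>k. N (l i j \<ominus> s k i j)) \<longlonglongrightarrow> 0" if "i < n" "j < n" for i j
    using someI_ex[OF ex[OF that, unfolded Bex_def]] that by (simp add: l_def)
  have lm: "l \<in> mats R n n" using l by (auto simp: mats_def l_def)
  \<comment> \<open>The sum of the entry norms dominates their maximum, and its convergence follows
    from that of finitely many null sequences.\<close>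
  have "(\<lambda>k. \<Sum>i<n. \<Sum>j<n. N (l i j \<ominus> s k i j)) \<longlonglongrightarrow> (\<Sum>i<n. \<Sum>j<n. 0)"
    using l by (intro tendsto_sum) auto
  hence lim': "(\<lambda>k. \<Sum>i<n. \<Sum>j<n. N (l i j \<ominus> s k i j)) \<longlonglongrightarrow> 0" by simp
  have nn: "0 \<le> N (l i j \<ominus> s k i j)" for i j k using matsD[OF lm] matsD[OF s] by (auto intro!: N_nonneg)
  have "matnorm N n (l \<ominus>\<^bsub>matring R n\<^esub> s k) \<le> (\<Sum>i<n. \<Sum>j<n. N (l i j \<ominus> s k i j))" for k
  proof -
    have "N (l i j \<ominus> s k i j) \<le> (\<Sum>i<n. \<Sum>j<n. N (l i j \<ominus> s k i j))" if "i < n" "j < n" for i j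
    proof -
      have "N (l i j \<ominus> s k i j) \<le> (\<Sum>j<n. N (l i j \<ominus> s k i j))"
        using that nn by (intro member_le_sum) auto
      also have "\<dots> \<le> (\<Sum>i<n. \<Sum>j<n. N (l i j \<ominus> s k i j))"
        using that nn by (intro member_le_sum[of i _ "\<lambda>i. \<Sum>j<n. N (l i j \<ominus> s k i j)"]) (auto intro!: sum_nonneg)
      finally show ?thesis .
    qed
    thus ?thesis using lm s nn by (auto simp: matnorm_le_iff matring_minus intro!: sum_nonneg)
  qed
  hence "(\<lambda>k. matnorm N n (l \<ominus>\<^bsub>matring R n\<^esub> s k)) \<longlonglongrightarrow> 0"
    by (rule tendsto_0_squeeze[OF matnorm_nonneg _ lim'])
  thus "\<exists>l\<in>carrier (matring R n). (\<lambda>k. matnorm N n (l \<ominus>\<^bsub>matring R n\<^esub> s k)) \<longlonglongrightarrow> 0" using lm by auto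
qed

end

section \<open>Algebraic equivalence of idempotents\<close>

text \<open>In contrast to \<open>idm_equiv\<close>, no absorption identities are demanded, so
  exhibiting an equivalence means checking two products; \<open>mvn_normalized\<close> recovers the
  identities when they are needed.\<close>

definition mvn :: "('a, 'b) monoid_scheme \<Rightarrow> 'a \<Rightarrow> 'a \<Rightarrow> bool" where
  "mvn M e f \<longleftrightarrow> (\<exists>x\<in>carrier M. \<exists>y\<in>carrier M. x \<otimes>\<^bsub>M\<^esub> y = e \<and> y \<otimes>\<^bsub>M\<^esub> x = f)"

context monoid begin

text \<open>Both \<open>e \<otimes> x\<close> and \<open>x \<otimes> f\<close> equal
  \<open>x \<otimes> y \<otimes> x\<close>, and similarly for \<open>y\<close>. Hence replacing the
  witnesses by \<open>x \<otimes> f\<close> and \<open>y \<otimes> e\<close> keeps the two products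
  and adds the absorption identities.\<close>

lemma mvn_normalized:
  assumes "e \<otimes> e = e" "f \<otimes> f = f" "mvn G e f"
  obtains x y where "x \<in> carrier G" "y \<in> carrier G" "x \<otimes> y = e" "y \<otimes> x = f"
    "e \<otimes> x = x" "x \<otimes> f = x" "f \<otimes> y = y" "y \<otimes> e = y"
proof -
  obtain x y where c: "x \<in> carrier G" "y \<in> carrier G" and xy: "x \<otimes> y = e" "y \<otimes> x = f"
    using assms(3) by (auto simp: mvn_def)
  have e: "e \<in> carrier G" and f: "f \<in> carrier G" using c xy by auto
  have ex: "e \<otimes> x = x \<otimes> f" using c by (simp add: m_assoc flip: xy)
  have fy: "f \<otimes> y = y \<otimes> e" using c by (simp add: m_assoc flip: xy)
  have "(x \<otimes> f) \<otimes> (y \<otimes> e) = x \<otimes> (f \<otimes> y) \<otimes> e" using c e f by (simp add: m_assoc)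
  also have "\<dots> = (x \<otimes> y) \<otimes> (e \<otimes> e)" unfolding fy using c e f by (simp add: m_assoc)
  finally have 1: "(x \<otimes> f) \<otimes> (y \<otimes> e) = e" by (simp add: xy assms)
  have "(y \<otimes> e) \<otimes> (x \<otimes> f) = y \<otimes> (e \<otimes> x) \<otimes> f" using c e f by (simp add: m_assoc)
  also have "\<dots> = (y \<otimes> x) \<otimes> (f \<otimes> f)" unfolding ex using c e f by (simp add: m_assoc)
  finally have 2: "(y \<otimes> e) \<otimes> (x \<otimes> f) = f" by (simp add: xy assms)
  have 3: "x \<otimes> f \<otimes> f = x \<otimes> f" "y \<otimes> e \<otimes> e = y \<otimes> e" using c e f assms by (simp_all add: m_assoc)
  have 4: "e \<otimes> (x \<otimes> f) = x \<otimes> f"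
  proof -
    have "e \<otimes> (x \<otimes> f) = e \<otimes> (e \<otimes> x)" by (simp add: ex)
    also have "\<dots> = (e \<otimes> e) \<otimes> x" using c e by (simp add: m_assoc)
    finally show ?thesis by (simp add: assms ex)
  qed
  have 5: "f \<otimes> (y \<otimes> e) = y \<otimes> e"
  proof -
    have "f \<otimes> (y \<otimes> e) = f \<otimes> (f \<otimes> y)" by (simp add: fy)
    also have "\<dots> = (f \<otimes> f) \<otimes> y" using c f by (simp add: m_assoc)
    finally show ?thesis by (simp add: assms fy)
  qed
  show ?thesis by (rule that[of "x \<otimes> f" "y \<otimes> e"]) (use c e f 1 2 3 4 5 in auto)
qed

lemma mvn_refl: "e \<in> carrier G \<Longrightarrow> e \<otimes> e = e \<Longrightarrow> mvn G e e"
  by (auto simp: mvn_def)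

lemma mvn_sym: "mvn G e f \<Longrightarrow> mvn G f e"
  by (auto simp: mvn_def)

text \<open>The middle idempotent disappears from the composed products because the normalized
  witnesses absorb it.\<close>

lemma mvn_trans:
  assumes "e \<otimes> e = e" "f \<otimes> f = f" "g \<otimes> g = g" "mvn G e f" "mvn G f g"
  shows "mvn G e g"
proof -
  obtain x y where xy: "x \<in> carrier G" "y \<in> carrier G" "x \<otimes> y = e" "y \<otimes> x = f" "x \<otimes> f = x"
    using mvn_normalized[OF assms(1,2,4)] by metis
  obtain z w where zw: "z \<in> carrier G" "w \<in> carrier G" "z \<otimes> w = f" "w \<otimes> z = g" "f \<otimes> z = z"
    using mvn_normalized[OF assms(2,3,5)] by metis
  have "(x \<otimes> z) \<otimes> (w \<otimes> y) = x \<otimes> (z \<otimes> w) \<otimes> y" using xy(1,2) zw(1,2) by (simp add: m_assoc)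
  hence 1: "(x \<otimes> z) \<otimes> (w \<otimes> y) = e" by (simp add: xy zw)
  have "(w \<otimes> y) \<otimes> (x \<otimes> z) = w \<otimes> ((y \<otimes> x) \<otimes> z)" using xy(1,2) zw(1,2) by (simp add: m_assoc)
  hence 2: "(w \<otimes> y) \<otimes> (x \<otimes> z) = g" by (simp add: xy zw)
  show ?thesis unfolding mvn_def using 1 2 xy(1,2) zw(1,2) by blast
qed

end

text \<open>Normalized witnesses factor through their idempotents, so orthogonality on either side
  kills the mixed terms when the sums of the witnesses are multiplied.\<close>

lemma (in ring) mvn_add:
  assumes idem: "e \<otimes> e = e" "f \<otimes> f = f" "e' \<otimes> e' = e'" "f' \<otimes> f' = f'"
    and orth: "e \<otimes> e' = \<zero>" "e' \<otimes> e = \<zero>" "f \<otimes> f' = \<zero>" "f' \<otimes> f = \<zero>"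
    and "mvn R e f" "mvn R e' f'"
  shows "mvn R (e \<oplus> e') (f \<oplus> f')"
proof -
  obtain x y where xy: "x \<in> carrier R" "y \<in> carrier R" "x \<otimes> y = e" "y \<otimes> x = f"
    "e \<otimes> x = x" "x \<otimes> f = x" "f \<otimes> y = y" "y \<otimes> e = y"
    using mvn_normalized[OF idem(1,2) \<open>mvn R e f\<close>] by metis
  obtain x' y' where xy': "x' \<in> carrier R" "y' \<in> carrier R" "x' \<otimes> y' = e'" "y' \<otimes> x' = f'"
    "e' \<otimes> x' = x'" "x' \<otimes> f' = x'" "f' \<otimes> y' = y'" "y' \<otimes> e' = y'"
    using mvn_normalized[OF idem(3,4) \<open>mvn R e' f'\<close>] by metis
  have c: "e \<in> carrier R" "f \<in> carrier R" "e' \<in> carrier R" "f' \<in> carrier R" using xy xy' by auto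
  have z: "a \<otimes> b = \<zero>" if "a \<otimes> u = a" "v \<otimes> b = b" "u \<otimes> v = \<zero>"
    "a \<in> carrier R" "b \<in> carrier R" "u \<in> carrier R" "v \<in> carrier R" for a b u v
  proof -
    have "a \<otimes> b = (a \<otimes> u) \<otimes> (v \<otimes> b)" using that by simp
    also have "\<dots> = a \<otimes> (u \<otimes> v) \<otimes> b" using that(4-7) by (simp add: m_assoc)
    finally show ?thesis using that by simp
  qed
  have "x \<otimes> y' = \<zero>" "x' \<otimes> y = \<zero>" "y \<otimes> x' = \<zero>" "y' \<otimes> x = \<zero>"
    using z[of x f f' y'] z[of x' f' f y] z[of y e e' x'] z[of y' e' e x] xy xy' c orth by auto
  hence "(x \<oplus> x') \<otimes> (y \<oplus> y') = e \<oplus> e'" "(y \<oplus> y') \<otimes> (x \<oplus> x') = f \<oplus> f'"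
    using xy xy' c by (simp_all add: l_distr r_distr)
  thus ?thesis unfolding mvn_def using xy xy' by blast
qed

section \<open>Block sums as orthogonal sums in one square matrix ring\<close>

definition shift :: "('a, 'b) ring_scheme \<Rightarrow> nat \<Rightarrow> 'a mat \<Rightarrow> 'a mat" where
  "shift R n f = (\<lambda>i j. if n \<le> i \<and> n \<le> j then f (i - n) (j - n) else \<zero>\<^bsub>R\<^esub>)"

context ring begin

lemma mats_row_zero: "A \<in> mats R n m \<Longrightarrow> n \<le> i \<Longrightarrow> A i j = \<zero>"
  by (simp add: mats_def)

lemma mats_col_zero: "A \<in> mats R n m \<Longrightarrow> m \<le> j \<Longrightarrow> A i j = \<zero>"
  by (simp add: mats_def)

lemma matsI:
  assumes "\<And>i j. A i j \<in> carrier R" "\<And>i j. n \<le> i \<Longrightarrow> A i j = \<zero>" "\<And>i j. m \<le> j \<Longrightarrow> A i j = \<zero>"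
  shows "A \<in> mats R n m"
  using assms by (simp add: mats_def) (metis not_less)

lemma shift_mats:
  assumes f: "f \<in> mats R m m" shows "shift R n f \<in> mats R (n + m) (n + m)"
  by (rule matsI) (auto simp: shift_def matsD[OF f] mats_row_zero[OF f] mats_col_zero[OF f])

text \<open>In this form block sums are accessible to \<open>mvn_add\<close>: \<open>e\<close> and
  \<open>shift R n f\<close> are orthogonal in every common square ring.\<close>

lemma dsum_eq:
  assumes "e \<in> mats R n n" "f \<in> mats R m m"
  shows "dsum R (n, e) (m, f) = (n + m, \<lambda>i j. e i j \<oplus> shift R n f i j)"
  using matsD[OF assms(1)] matsD[OF assms(2)]
  by (auto simp: dsum_def shift_def mats_row_zero[OF assms(1)] mats_col_zero[OF assms(1)]
    mats_row_zero[OF assms(2)] mats_col_zero[OF assms(2)] not_less intro!: ext)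

lemma finsum_shift:
  "(\<And>l. l < (m::nat) \<Longrightarrow> g l \<in> carrier R) \<Longrightarrow>
   finsum R (\<lambda>l. if n \<le> l then g (l - n) else \<zero>) {..<n + m} = finsum R g {..<m}"
proof (induction m)
  case 0
  have "finsum R (\<lambda>l. if n \<le> l then g (l - n) else \<zero>) {..<n} = finsum R (\<lambda>l. \<zero>) {..<n}"
    by (rule finsum_lessThan_cong) auto
  thus ?case by simp
next
  case (Suc m)
  thus ?case unfolding add_Suc_right
    by (subst (1 2) finsum_lessThan_Suc) auto
qed

lemma shift_mult:
  assumes f: "f \<in> mats R m m" and g: "g \<in> mats R m m" and K: "n + m \<le> K"
  shows "mmul R K K K (shift R n f) (shift R n g) = shift R n (mmul R m m m f g)"
proof -
  note c = matsD[OF f] matsD[OF g]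
  have "mmul R K K K (shift R n f) (shift R n g)
      = mmul R (n + m) (n + m) (n + m) (shift R n f) (shift R n g)"
    by (intro mmul_extend shift_mats f g K)
  also have "\<dots> = shift R n (mmul R m m m f g)"
  proof (rule mats_eqI[of _ R "n + m" "n + m"])
    fix i j assume ij: "i < n + m" "j < n + m"
    have "finsum R (\<lambda>l. shift R n f i l \<otimes> shift R n g l j) {..<n + m}
        = finsum R (\<lambda>l. if n \<le> l then (if n \<le> i \<and> n \<le> j then f (i - n) (l - n) \<otimes> g (l - n) (j - n) else \<zero>) else \<zero>) {..<n + m}"
      using c by (intro finsum_lessThan_cong) (auto simp: shift_def)
    also have "\<dots> = finsum R (\<lambda>l. if n \<le> i \<and> n \<le> j then f (i - n) l \<otimes> g l (j - n) else \<zero>) {..<m}"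
      using c by (intro finsum_shift) auto
    finally show "mmul R (n + m) (n + m) (n + m) (shift R n f) (shift R n g) i j
        = shift R n (mmul R m m m f g) i j"
      using ij by (auto simp: mmul_def shift_def)
  qed (use f g in \<open>auto intro!: mmul_closed shift_mats\<close>)
  finally show ?thesis .
qed

lemma shift_orthogonal:
  assumes e: "e \<in> mats R n n" and f: "f \<in> mats R m m"
  shows "mmul R K K K e (shift R n f) = (\<lambda>i j. \<zero>)" "mmul R K K K (shift R n f) e = (\<lambda>i j. \<zero>)"
proof -
  note c = matsD[OF e] matsD[OF f]
  have 0: "e i l \<otimes> shift R n f l j = \<zero>" "shift R n f i l \<otimes> e l j = \<zero>" for i l j
    using e c by (cases "n \<le> l"; simp add: shift_def mats_def)+
  show "mmul R K K K e (shift R n f) = (\<lambda>i j. \<zero>)" "mmul R K K K (shift R n f) e = (\<lambda>i j. \<zero>)"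
    unfolding mmul_def 0 by (simp_all cong: if_cong)
qed

text \<open>Translating only the rows of \<open>f\<close> gives \<open>x\<close>, translating only
  its columns gives \<open>y\<close>. One product is then the translate of the square of
  \<open>f\<close>, the other is the square itself.\<close>

lemma mvn_shift:
  assumes f: "f \<in> mats R m m" and ff: "mmul R m m m f f = f" and K: "n + m \<le> K"
  shows "mvn (matring R K) (shift R n f) f"
proof -
  note c = matsD[OF f]
  define x where "x = (\<lambda>i j. if n \<le> i then f (i - n) j else \<zero>)"
  define y where "y = (\<lambda>i j. if n \<le> j then f i (j - n) else \<zero>)"
  have x: "x \<in> mats R (n + m) m" and y: "y \<in> mats R m (n + m)"
    by (auto simp: x_def y_def c mats_row_zero[OF f] mats_col_zero[OF f] intro!: matsI)
  have "mmul R K K K x y = mmul R (n + m) m (n + m) x y"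
    using K by (intro mmul_extend x y) auto
  also have "\<dots> = shift R n f"
  proof (rule mats_eqI[of _ R "n + m" "n + m"])
    fix i j assume ij: "i < n + m" "j < n + m"
    show "mmul R (n + m) m (n + m) x y i j = shift R n f i j"
    proof (cases "n \<le> i \<and> n \<le> j")
      case True
      hence "mmul R (n + m) m (n + m) x y i j = mmul R m m m f f (i - n) (j - n)"
        using ij by (auto simp: mmul_def x_def y_def)
      thus ?thesis using True by (simp add: ff shift_def)
    next
      case False
      hence "x i l \<otimes> y l j = \<zero>" for l using c by (auto simp: x_def y_def)
      thus ?thesis using False by (auto simp: mmul_def shift_def)
    qed
  qed (use x y f in \<open>auto intro!: mmul_closed shift_mats\<close>)
  finally have 1: "mmul R K K K x y = shift R n f" .
  have "mmul R K K K y x = mmul R m (n + m) m y x"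
    using K by (intro mmul_extend x y) auto
  also have "\<dots> = mmul R m m m f f"
  proof (rule mats_eqI[of _ R m m])
    fix i j assume ij: "i < m" "j < m"
    have "finsum R (\<lambda>l. y i l \<otimes> x l j) {..<n + m} = finsum R (\<lambda>l. if n \<le> l then f i (l - n) \<otimes> f (l - n) j else \<zero>) {..<n + m}"
      using c by (intro finsum_lessThan_cong) (auto simp: x_def y_def)
    also have "\<dots> = finsum R (\<lambda>l. f i l \<otimes> f l j) {..<m}"
      using c by (intro finsum_shift) auto
    finally show "mmul R m (n + m) m y x i j = mmul R m m m f f i j"
      using ij by (simp add: mmul_def)
  qed (use x y f in \<open>auto intro!: mmul_closed\<close>)
  finally have 2: "mmul R K K K y x = f" by (simp add: ff)
  have "x \<in> mats R K K" "y \<in> mats R K K" using x y K mats_mono[of "n+m" K m K] mats_mono[of m K "n + m" K] by auto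
  thus ?thesis using 1 2 by (auto simp: mvn_def)
qed

lemma idems_iff: "(n, e) \<in> idems R \<longleftrightarrow> e \<in> mats R n n \<and> mmul R n n n e e = e"
  by (simp add: idems_def)

lemma idems_extend:
  assumes "(n, e) \<in> idems R" "n \<le> K"
  shows "e \<in> mats R K K" "mmul R K K K e e = e"
  using assms mats_mono[of n K n K] mmul_extend[of e n n e n K K K] by (auto simp: idems_iff)

text \<open>Embedding rectangular matrices in a common square matrix ring turns the module isomorphisms
  of \<^const>\<open>idm_equiv\<close> into algebraic equivalences in one ring.\<close>
lemma idm_equiv_iff_mvn:
  assumes E: "(n, e) \<in> idems R" and F: "(m, f) \<in> idems R" and K: "n \<le> K" "m \<le> K"
  shows "idm_equiv R (n, e) (m, f) \<longleftrightarrow> mvn (matring R K) e f"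
proof
  assume "idm_equiv R (n, e) (m, f)"
  then obtain x y where x: "x \<in> mats R n m" and y: "y \<in> mats R m n"
    and xy: "mmul R n m n x y = e" "mmul R m n m y x = f"
    by (auto simp: idm_equiv_def)
  have "mmul R K K K x y = e" "mmul R K K K y x = f"
    using mmul_extend[OF x y K(1,2,1)] mmul_extend[OF y x K(2,1,2)] xy by auto
  moreover have "x \<in> mats R K K" "y \<in> mats R K K"
    using x y mats_mono[OF K] mats_mono[OF K(2,1)] by auto
  ultimately show "mvn (matring R K) e f" by (auto simp: mvn_def)
next
  assume *: "mvn (matring R K) e f"
  interpret M: ring "matring R K" by (rule ring_matring)
  have e: "e \<in> mats R n n" and f: "f \<in> mats R m m" using E F by (auto simp: idems_iff)
  note eK = idems_extend[OF E K(1)] and fK = idems_extend[OF F K(2)]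
  obtain x y where xy: "x \<in> mats R K K" "y \<in> mats R K K" "mmul R K K K x y = e" "mmul R K K K y x = f"
     "mmul R K K K e x = x" "mmul R K K K x f = x" "mmul R K K K f y = y" "mmul R K K K y e = y"
    using M.mvn_normalized[OF _ _ *] eK fK by auto
  \<comment> \<open>A matrix fixed by \<open>g\<close> from the left has no rows outside the block
    of \<open>g\<close>, and one fixed by \<open>h\<close> from the right has no columns outside the
    block of \<open>h\<close>. The normalized square witnesses are therefore rectangular.\<close>
  have rect: "z \<in> mats R a b" if "z \<in> mats R K K" "g \<in> mats R a a" "h \<in> mats R b b" "a \<le> K" "b \<le> K"
    "mmul R K K K g z = z" "mmul R K K K z h = z" for z g h a b
  proof -
    have "mmul R K K K g z = mmul R a K K g z"
      using that by (intro mmul_extend) (auto intro: subsetD[OF mats_mono[of a a a K]])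
    hence "z \<in> mats R a K" using that mmul_closed[of g a K z K] mats_mono[of a a a K] by (metis order_refl subsetD)
    have "mmul R K K K z h = mmul R K K b z h"
      using that by (intro mmul_extend) (auto intro: subsetD[OF mats_mono[of b K b b]])
    hence "z \<in> mats R K b" using that mmul_closed[of z K K h b] mats_mono[of b K b b] by (metis order_refl subsetD)
    with \<open>z \<in> mats R a K\<close> show ?thesis
      by (intro matsI) (auto intro: matsD mats_row_zero mats_col_zero)
  qed
  have x: "x \<in> mats R n m" and y: "y \<in> mats R m n"
    using rect[of x e n f m] rect[of y f m e n] xy e f K by auto
  show "idm_equiv R (n, e) (m, f)"
    unfolding idm_equiv_def prod.case
    using x y xy mmul_extend[OF x y, of K K K] mmul_extend[OF y x, of K K K] mmul_extend[OF e x, of K K K]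
      mmul_extend[OF x f, of K K K] mmul_extend[OF f y, of K K K] mmul_extend[OF y e, of K K K] K by auto
qed

lemma idm_equiv_refl: assumes "E \<in> idems R" shows "idm_equiv R E E"
proof -
  obtain n e where E: "E = (n, e)" by fastforce
  interpret M: ring "matring R n" by (rule ring_matring)
  show ?thesis using idm_equiv_iff_mvn[of n e n e n] M.mvn_refl[of e] assms
    by (simp add: E idems_iff)
qed

lemma idm_equiv_sym: "idm_equiv R E F \<Longrightarrow> idm_equiv R F E"
  by (force simp: idm_equiv_def)

lemma idm_equiv_trans:
  assumes "E \<in> idems R" "F \<in> idems R" "H \<in> idems R" "idm_equiv R E F" "idm_equiv R F H"
  shows "idm_equiv R E H"
proof -
  obtain n e m f k h where EFH: "E = (n, e)" "F = (m, f)" "H = (k, h)" by fastforce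
  define K where "K = n + m + k"
  interpret M: ring "matring R K" by (rule ring_matring)
  have K: "n \<le> K" "m \<le> K" "k \<le> K" by (auto simp: K_def)
  note I = assms(1-3)[unfolded EFH]
  show ?thesis
    using M.mvn_trans[of e f h] idems_extend[OF I(1) K(1)] idems_extend[OF I(2) K(2)] idems_extend[OF I(3) K(3)]
      idm_equiv_iff_mvn[OF I(1,2) K(1,2)] idm_equiv_iff_mvn[OF I(2,3) K(2,3)] idm_equiv_iff_mvn[OF I(1,3) K(1,3)]
      assms(4,5) by (simp add: EFH)
qed

lemma dsum_idems:
  assumes "E \<in> idems R" "F \<in> idems R" shows "dsum R E F \<in> idems R"
proof -
  obtain n e m f where EF: "E = (n, e)" "F = (m, f)" by fastforce
  interpret M: ring "matring R (n + m)" by (rule ring_matring)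
  let ?s = "shift R n f"
  have e: "e \<in> mats R n n" and f: "f \<in> mats R m m" using assms by (auto simp: EF idems_iff)
  have eK: "e \<in> carrier (matring R (n + m))" "e \<otimes>\<^bsub>matring R (n + m)\<^esub> e = e"
    using idems_extend[of n e "n + m"] assms by (auto simp: EF)
  have sK: "?s \<in> carrier (matring R (n + m))" "?s \<otimes>\<^bsub>matring R (n + m)\<^esub> ?s = ?s"
    using shift_mats[OF f] shift_mult[OF f f, of n "n + m"] assms by (auto simp: EF idems_iff)
  have orth: "e \<otimes>\<^bsub>matring R (n + m)\<^esub> ?s = \<zero>\<^bsub>matring R (n + m)\<^esub>" "?s \<otimes>\<^bsub>matring R (n + m)\<^esub> e = \<zero>\<^bsub>matring R (n + m)\<^esub>"
    using shift_orthogonal[OF e f] by auto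
  have "(e \<oplus>\<^bsub>matring R (n + m)\<^esub> ?s) \<otimes>\<^bsub>matring R (n + m)\<^esub> (e \<oplus>\<^bsub>matring R (n + m)\<^esub> ?s) = e \<oplus>\<^bsub>matring R (n + m)\<^esub> ?s"
    by (simp only: M.l_distr M.r_distr eK sK orth M.a_closed M.l_zero M.r_zero M.zero_closed)
  thus ?thesis using M.a_closed[OF eK(1) sK(1)] by (simp add: EF dsum_eq[OF e f] idems_iff)
qed

lemma dsum_mvn:
  assumes E: "(n, e) \<in> idems R" and F: "(m, f) \<in> idems R"
    and E': "(n', e') \<in> idems R" and F': "(m', f') \<in> idems R"
    and K: "n + m \<le> K" "n' + m' \<le> K"
    and "mvn (matring R K) e e'" "mvn (matring R K) (shift R n f) (shift R n' f')"
  shows "idm_equiv R (dsum R (n, e) (m, f)) (dsum R (n', e') (m', f'))"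
proof -
  interpret M: ring "matring R K" by (rule ring_matring)
  have c: "e \<in> mats R n n" "f \<in> mats R m m" "e' \<in> mats R n' n'" "f' \<in> mats R m' m'"
    using E F E' F' by (auto simp: idems_iff)
  have "mvn (matring R K) (e \<oplus>\<^bsub>matring R K\<^esub> shift R n f) (e' \<oplus>\<^bsub>matring R K\<^esub> shift R n' f')"
  proof (rule M.mvn_add)
    show "e \<otimes>\<^bsub>matring R K\<^esub> e = e" "e' \<otimes>\<^bsub>matring R K\<^esub> e' = e'"
      using idems_extend[OF E, of K] idems_extend[OF E', of K] K by auto
    show "shift R n f \<otimes>\<^bsub>matring R K\<^esub> shift R n f = shift R n f"
      "shift R n' f' \<otimes>\<^bsub>matring R K\<^esub> shift R n' f' = shift R n' f'"
      using shift_mult[OF c(2,2) K(1)] shift_mult[OF c(4,4) K(2)] F F' by (auto simp: idems_iff)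
  qed (use shift_orthogonal[OF c(1,2)] shift_orthogonal[OF c(3,4)] assms in auto)
  moreover have "dsum R (n, e) (m, f) \<in> idems R" "dsum R (n', e') (m', f') \<in> idems R"
    using assms by (auto intro: dsum_idems)
  ultimately show ?thesis
    using idm_equiv_iff_mvn[OF _ _ K] c by (simp add: dsum_eq)
qed

text \<open>The sizes \<open>n\<close> and \<open>n'\<close> may differ, so the lower blocks sit at
  different positions; they are compared through the unshifted \<open>f\<close> and
  \<open>f'\<close>.\<close>

lemma dsum_cong:
  assumes "E \<in> idems R" "F \<in> idems R" "E' \<in> idems R" "F' \<in> idems R"
    and "idm_equiv R E E'" "idm_equiv R F F'"
  shows "idm_equiv R (dsum R E F) (dsum R E' F')"
proof -
  obtain n e m f n' e' m' f' where EF: "E = (n, e)" "F = (m, f)" "E' = (n', e')" "F' = (m', f')"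
    by (metis surj_pair)
  define K where "K = n + m + n' + m'"
  have K: "n + m \<le> K" "n' + m' \<le> K" "n \<le> K" "n' \<le> K" "m \<le> K" "m' \<le> K" by (auto simp: K_def)
  interpret M: ring "matring R K" by (rule ring_matring)
  note I = assms(1-4)[unfolded EF]
  have c: "f \<in> mats R m m" "mmul R m m m f f = f" "f' \<in> mats R m' m'" "mmul R m' m' m' f' f' = f'"
    using I by (auto simp: idems_iff)
  have s: "mmul R K K K (shift R n f) (shift R n f) = shift R n f"
    "mmul R K K K (shift R n' f') (shift R n' f') = shift R n' f'"
    using shift_mult[OF c(1,1) K(1)] shift_mult[OF c(3,3) K(2)] c by auto
  have "mvn (matring R K) f f'" using idm_equiv_iff_mvn[OF I(2,4) K(5,6)] assms by (simp add: EF)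
  hence "mvn (matring R K) (shift R n f) f'"
    using M.mvn_trans[of "shift R n f" f f'] s idems_extend[OF I(2) K(5)] idems_extend[OF I(4) K(6)]
      mvn_shift[OF c(1,2) K(1)] by simp
  hence "mvn (matring R K) (shift R n f) (shift R n' f')"
    using M.mvn_trans[of "shift R n f" f' "shift R n' f'"] s idems_extend[OF I(4) K(6)]
      M.mvn_sym[OF mvn_shift[OF c(3,4) K(2)]] by simp
  moreover have "mvn (matring R K) e e'" using idm_equiv_iff_mvn[OF I(1,3) K(3,4)] assms by (simp add: EF)
  ultimately show ?thesis using dsum_mvn[OF I(1,2,3,4) K(1,2)] by (simp add: EF)
qed

text \<open>Each summand is moved separately: \<open>e\<close> to its shift by \<open>m\<close>, and
  the shift of \<open>f\<close> back to \<open>f\<close>.\<close>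

lemma dsum_comm:
  assumes "E \<in> idems R" "F \<in> idems R"
  shows "idm_equiv R (dsum R E F) (dsum R F E)"
proof -
  obtain n e m f where EF: "E = (n, e)" "F = (m, f)" by fastforce
  define K where "K = n + m"
  have K: "n + m \<le> K" "m + n \<le> K" "n \<le> K" "m \<le> K" by (auto simp: K_def)
  interpret M: ring "matring R K" by (rule ring_matring)
  note I = assms[unfolded EF]
  have c: "e \<in> mats R n n" "mmul R n n n e e = e" "f \<in> mats R m m" "mmul R m m m f f = f"
    using I by (auto simp: idems_iff)
  have idem: "e \<otimes>\<^bsub>matring R K\<^esub> e = e" "f \<otimes>\<^bsub>matring R K\<^esub> f = f"
    "shift R n f \<otimes>\<^bsub>matring R K\<^esub> shift R n f = shift R n f" "shift R m e \<otimes>\<^bsub>matring R K\<^esub> shift R m e = shift R m e"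
    using idems_extend[OF I(1) K(3)] idems_extend[OF I(2) K(4)] shift_mult[OF c(3,3) K(1)] shift_mult[OF c(1,1) K(2)] c by auto
  have "mvn (matring R K) (e \<oplus>\<^bsub>matring R K\<^esub> shift R n f) (shift R m e \<oplus>\<^bsub>matring R K\<^esub> f)"
    using idem shift_orthogonal[OF c(1,3)] shift_orthogonal[OF c(3,1)]
      M.mvn_sym[OF mvn_shift[OF c(1,2) K(2)]] mvn_shift[OF c(3,4) K(1)]
    by (intro M.mvn_add) auto
  moreover have "shift R m e \<oplus>\<^bsub>matring R K\<^esub> f = f \<oplus>\<^bsub>matring R K\<^esub> shift R m e"
    using mats_mono[of "m + n" K "m + n" K] shift_mats[OF c(1), of m] idems_extend[OF I(2) K(4)] K
    by (intro M.a_comm) auto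
  moreover have "dsum R E F \<in> idems R" "dsum R F E \<in> idems R" using assms by (auto intro: dsum_idems)
  ultimately show ?thesis
    using idm_equiv_iff_mvn[OF _ _ K(1,2)] c by (simp add: EF dsum_eq)
qed

lemma dsum_assoc: "dsum R (dsum R E F) H = dsum R E (dsum R F H)"
  by (auto simp: dsum_def add.assoc diff_diff_left split: prod.splits intro!: ext)

lemma dsum_zero:
  assumes "E \<in> idems R" shows "dsum R (0, \<lambda>i j. \<zero>) E = E"
  using assms by (auto simp: dsum_def idems_def mats_def split: prod.splits intro!: ext)

lemma zero_idems: "(0, \<lambda>i j. \<zero>) \<in> idems R"
  by (auto simp: idems_def mats_def mmul_def)

end

section \<open>The Grothendieck group of idempotents\<close>

definition idem_cls :: "('a, 'b) ring_scheme \<Rightarrow> 'a idm \<Rightarrow> 'a idm set" where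
  "idem_cls R E = {F \<in> idems R. idm_equiv R E F}"

text \<open>\<open>k0_rel\<close> is equality of formal differences over this commutative monoid.
  Stable equivalences thereby become equations, to which associativity and commutativity apply as
  rewrite rules.\<close>

definition idem_monoid :: "('a, 'b) ring_scheme \<Rightarrow> 'a idm set monoid" where
  "idem_monoid R = \<lparr>carrier = idem_cls R ` idems R,
     monoid.mult = (\<lambda>c d. idem_cls R (dsum R (SOME E. E \<in> c) (SOME F. F \<in> d))),
     monoid.one = idem_cls R (0, \<lambda>i j. \<zero>\<^bsub>R\<^esub>)\<rparr>"

context ring begin

lemma idem_cls_eq_iff:
  "E \<in> idems R \<Longrightarrow> F \<in> idems R \<Longrightarrow> idem_cls R E = idem_cls R F \<longleftrightarrow> idm_equiv R E F"
proof
  assume E: "E \<in> idems R" and F: "F \<in> idems R"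
  { assume "idem_cls R E = idem_cls R F"
    moreover have "F \<in> idem_cls R F" using F idm_equiv_refl by (simp add: idem_cls_def)
    ultimately have "F \<in> idem_cls R E" by simp
    thus "idm_equiv R E F" by (simp add: idem_cls_def) }
  { assume "idm_equiv R E F"
    thus "idem_cls R E = idem_cls R F" unfolding idem_cls_def
      using idm_equiv_trans idm_equiv_sym E F by (intro Collect_cong) metis }
qed

lemma idem_monoid_mult:
  assumes "E \<in> idems R" "F \<in> idems R"
  shows "idem_cls R E \<otimes>\<^bsub>idem_monoid R\<^esub> idem_cls R F = idem_cls R (dsum R E F)"
proof -
  have rep: "(SOME H. H \<in> idem_cls R E) \<in> idems R \<and> idm_equiv R E (SOME H. H \<in> idem_cls R E)"
    if "E \<in> idems R" for E
  proof -
    have "E \<in> idem_cls R E" using that idm_equiv_refl by (simp add: idem_cls_def)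
    hence "(SOME H. H \<in> idem_cls R E) \<in> idem_cls R E" by (rule someI)
    thus ?thesis unfolding idem_cls_def by simp
  qed
  have "idm_equiv R (dsum R E F) (dsum R (SOME H. H \<in> idem_cls R E) (SOME H. H \<in> idem_cls R F))"
    using rep assms by (intro dsum_cong) auto
  thus ?thesis unfolding idem_monoid_def using assms rep
    by (simp add: idem_cls_eq_iff dsum_idems idm_equiv_sym)
qed

lemma idem_monoid_carrier: "E \<in> idems R \<Longrightarrow> idem_cls R E \<in> carrier (idem_monoid R)"
  by (simp add: idem_monoid_def)

lemma comm_monoid_idem_monoid: "comm_monoid (idem_monoid R)"
proof (rule comm_monoidI)
  have one: "\<one>\<^bsub>idem_monoid R\<^esub> = idem_cls R (0, \<lambda>i j. \<zero>)" by (simp add: idem_monoid_def)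
  show "\<one>\<^bsub>idem_monoid R\<^esub> \<in> carrier (idem_monoid R)" using zero_idems by (simp add: one idem_monoid_carrier)
  fix x y z assume "x \<in> carrier (idem_monoid R)" "y \<in> carrier (idem_monoid R)" "z \<in> carrier (idem_monoid R)"
  then obtain E F H where *: "x = idem_cls R E" "y = idem_cls R F" "z = idem_cls R H"
    and I: "E \<in> idems R" "F \<in> idems R" "H \<in> idems R" by (auto simp: idem_monoid_def)
  show "x \<otimes>\<^bsub>idem_monoid R\<^esub> y \<in> carrier (idem_monoid R)"
    using I by (simp add: * idem_monoid_mult idem_monoid_carrier dsum_idems)
  show "x \<otimes>\<^bsub>idem_monoid R\<^esub> y \<otimes>\<^bsub>idem_monoid R\<^esub> z = x \<otimes>\<^bsub>idem_monoid R\<^esub> (y \<otimes>\<^bsub>idem_monoid R\<^esub> z)"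
    using I by (simp add: * idem_monoid_mult dsum_idems dsum_assoc)
  show "\<one>\<^bsub>idem_monoid R\<^esub> \<otimes>\<^bsub>idem_monoid R\<^esub> x = x"
    using I by (simp add: * one idem_monoid_mult zero_idems dsum_zero)
  show "x \<otimes>\<^bsub>idem_monoid R\<^esub> y = y \<otimes>\<^bsub>idem_monoid R\<^esub> x"
    using I by (simp add: * idem_monoid_mult idem_cls_eq_iff dsum_idems dsum_comm)
qed

lemma k0_rel_iff:
  assumes "P \<in> idems R \<times> idems R" "Q \<in> idems R \<times> idems R"
  shows "k0_rel R P Q \<longleftrightarrow> (\<exists>g\<in>carrier (idem_monoid R).
    idem_cls R (fst P) \<otimes>\<^bsub>idem_monoid R\<^esub> idem_cls R (snd Q) \<otimes>\<^bsub>idem_monoid R\<^esub> g =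
    idem_cls R (fst Q) \<otimes>\<^bsub>idem_monoid R\<^esub> idem_cls R (snd P) \<otimes>\<^bsub>idem_monoid R\<^esub> g)"
proof -
  have [simp]: "fst P \<in> idems R" "snd P \<in> idems R" "fst Q \<in> idems R" "snd Q \<in> idems R" using assms by auto
  have "carrier (idem_monoid R) = idem_cls R ` idems R" by (simp add: idem_monoid_def)
  thus ?thesis unfolding k0_rel_def by (simp add: idem_monoid_mult idem_cls_eq_iff dsum_idems)
qed

end

text \<open>The monoid need not be cancellative, so the middle terms \<open>c\<close> and
  \<open>d\<close> cannot be dropped; they join \<open>g\<close> and \<open>h\<close> in the
  stabilizing element.\<close>

lemma (in comm_monoid) formal_difference_trans:
  assumes c: "a \<in> carrier G" "b \<in> carrier G" "c \<in> carrier G" "d \<in> carrier G" "e \<in> carrier G" "f \<in> carrier G"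
    "g \<in> carrier G" "h \<in> carrier G"
    and 1: "a \<otimes> d \<otimes> g = c \<otimes> b \<otimes> g" and 2: "c \<otimes> f \<otimes> h = e \<otimes> d \<otimes> h"
  shows "a \<otimes> f \<otimes> (c \<otimes> d \<otimes> g \<otimes> h) = e \<otimes> b \<otimes> (c \<otimes> d \<otimes> g \<otimes> h)"
proof -
  have "a \<otimes> f \<otimes> (c \<otimes> d \<otimes> g \<otimes> h) = (a \<otimes> d \<otimes> g) \<otimes> (f \<otimes> c \<otimes> h)" using c by (simp add: m_ac)
  also have "\<dots> = b \<otimes> c \<otimes> g \<otimes> (c \<otimes> f \<otimes> h)" unfolding 1 using c by (simp add: m_ac)
  also have "\<dots> = e \<otimes> b \<otimes> (c \<otimes> d \<otimes> g \<otimes> h)" unfolding 2 using c by (simp add: m_ac)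
  finally show ?thesis .
qed

lemma (in comm_monoid) formal_difference_mult:
  assumes c: "a \<in> carrier G" "b \<in> carrier G" "c \<in> carrier G" "d \<in> carrier G"
    "a' \<in> carrier G" "b' \<in> carrier G" "c' \<in> carrier G" "d' \<in> carrier G" "g \<in> carrier G" "h \<in> carrier G"
    and 1: "a \<otimes> b' \<otimes> g = a' \<otimes> b \<otimes> g" and 2: "c \<otimes> d' \<otimes> h = c' \<otimes> d \<otimes> h"
  shows "(a \<otimes> c) \<otimes> (b' \<otimes> d') \<otimes> (g \<otimes> h) = (a' \<otimes> c') \<otimes> (b \<otimes> d) \<otimes> (g \<otimes> h)"
proof -
  have "(a \<otimes> c) \<otimes> (b' \<otimes> d') \<otimes> (g \<otimes> h) = (a \<otimes> b' \<otimes> g) \<otimes> (c \<otimes> d' \<otimes> h)" using c by (simp add: m_ac)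
  also have "\<dots> = (a' \<otimes> c') \<otimes> (b \<otimes> d) \<otimes> (g \<otimes> h)" unfolding 1 2 using c by (simp add: m_ac)
  finally show ?thesis .
qed

abbreviation dsum2 :: "('a, 'b) ring_scheme \<Rightarrow> 'a idm \<times> 'a idm \<Rightarrow> 'a idm \<times> 'a idm \<Rightarrow> 'a idm \<times> 'a idm" where
  "dsum2 R P Q \<equiv> (dsum R (fst P) (fst Q), dsum R (snd P) (snd Q))"

context ring begin

lemma k0_rel_refl: "P \<in> idems R \<times> idems R \<Longrightarrow> k0_rel R P P"
proof -
  interpret V: comm_monoid "idem_monoid R" by (rule comm_monoid_idem_monoid)
  assume "P \<in> idems R \<times> idems R" thus ?thesis using k0_rel_iff V.one_closed by auto
qed

lemma k0_rel_sym: "P \<in> idems R \<times> idems R \<Longrightarrow> Q \<in> idems R \<times> idems R \<Longrightarrow> k0_rel R P Q \<Longrightarrow> k0_rel R Q P"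
  using k0_rel_iff by metis

lemma k0_rel_trans:
  assumes P: "P \<in> idems R \<times> idems R" and Q: "Q \<in> idems R \<times> idems R" and T: "T \<in> idems R \<times> idems R"
    and "k0_rel R P Q" "k0_rel R Q T"
  shows "k0_rel R P T"
proof -
  interpret V: comm_monoid "idem_monoid R" by (rule comm_monoid_idem_monoid)
  let ?c = "idem_cls R"
  have c: "?c (fst P) \<in> carrier (idem_monoid R)" "?c (snd P) \<in> carrier (idem_monoid R)"
    "?c (fst Q) \<in> carrier (idem_monoid R)" "?c (snd Q) \<in> carrier (idem_monoid R)"
    "?c (fst T) \<in> carrier (idem_monoid R)" "?c (snd T) \<in> carrier (idem_monoid R)"
    using P Q T by (auto intro: idem_monoid_carrier)
  from assms(4) k0_rel_iff[OF P Q] obtain g where g: "g \<in> carrier (idem_monoid R)"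
    "?c (fst P) \<otimes>\<^bsub>idem_monoid R\<^esub> ?c (snd Q) \<otimes>\<^bsub>idem_monoid R\<^esub> g = ?c (fst Q) \<otimes>\<^bsub>idem_monoid R\<^esub> ?c (snd P) \<otimes>\<^bsub>idem_monoid R\<^esub> g"
    by auto
  from assms(5) k0_rel_iff[OF Q T] obtain h where h: "h \<in> carrier (idem_monoid R)"
    "?c (fst Q) \<otimes>\<^bsub>idem_monoid R\<^esub> ?c (snd T) \<otimes>\<^bsub>idem_monoid R\<^esub> h = ?c (fst T) \<otimes>\<^bsub>idem_monoid R\<^esub> ?c (snd Q) \<otimes>\<^bsub>idem_monoid R\<^esub> h"
    by auto
  show ?thesis unfolding k0_rel_iff[OF P T]
    by (rule bexI, rule V.formal_difference_trans[OF c g(1) h(1) g(2) h(2)]) (use c g(1) h(1) in auto)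
qed

lemma dsum2_idems: "P \<in> idems R \<times> idems R \<Longrightarrow> Q \<in> idems R \<times> idems R \<Longrightarrow> dsum2 R P Q \<in> idems R \<times> idems R"
  by (auto intro: dsum_idems)

lemma k0_rel_dsum:
  assumes P: "P \<in> idems R \<times> idems R" and Q: "Q \<in> idems R \<times> idems R"
    and P': "P' \<in> idems R \<times> idems R" and Q': "Q' \<in> idems R \<times> idems R"
    and "k0_rel R P P'" "k0_rel R Q Q'"
  shows "k0_rel R (dsum2 R P Q) (dsum2 R P' Q')"
proof -
  interpret V: comm_monoid "idem_monoid R" by (rule comm_monoid_idem_monoid)
  let ?c = "idem_cls R"
  have I: "fst P \<in> idems R" "snd P \<in> idems R" "fst Q \<in> idems R" "snd Q \<in> idems R"
    "fst P' \<in> idems R" "snd P' \<in> idems R" "fst Q' \<in> idems R" "snd Q' \<in> idems R"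
    using P Q P' Q' by auto
  note c = I[THEN idem_monoid_carrier]
  from assms(5) k0_rel_iff[OF P P'] obtain g where g: "g \<in> carrier (idem_monoid R)"
    "?c (fst P) \<otimes>\<^bsub>idem_monoid R\<^esub> ?c (snd P') \<otimes>\<^bsub>idem_monoid R\<^esub> g = ?c (fst P') \<otimes>\<^bsub>idem_monoid R\<^esub> ?c (snd P) \<otimes>\<^bsub>idem_monoid R\<^esub> g"
    by auto
  from assms(6) k0_rel_iff[OF Q Q'] obtain h where h: "h \<in> carrier (idem_monoid R)"
    "?c (fst Q) \<otimes>\<^bsub>idem_monoid R\<^esub> ?c (snd Q') \<otimes>\<^bsub>idem_monoid R\<^esub> h = ?c (fst Q') \<otimes>\<^bsub>idem_monoid R\<^esub> ?c (snd Q) \<otimes>\<^bsub>idem_monoid R\<^esub> h"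
    by auto
  show ?thesis unfolding k0_rel_iff[OF dsum2_idems[OF P Q] dsum2_idems[OF P' Q']] fst_conv snd_conv
    idem_monoid_mult[OF I(1,3), symmetric] idem_monoid_mult[OF I(2,4), symmetric]
    idem_monoid_mult[OF I(5,7), symmetric] idem_monoid_mult[OF I(6,8), symmetric]
    by (rule bexI, rule V.formal_difference_mult[OF _ _ _ _ _ _ _ _ g(1) h(1) g(2) h(2)]) (use c g(1) h(1) in auto)
qed

lemma k0_rel_idm_equiv:
  assumes "E \<in> idems R" "E' \<in> idems R" "F \<in> idems R" "F' \<in> idems R"
    and "idm_equiv R E E'" "idm_equiv R F F'"
  shows "k0_rel R (E, F) (E', F')"
proof -
  interpret V: comm_monoid "idem_monoid R" by (rule comm_monoid_idem_monoid)
  have "idem_cls R E = idem_cls R E'" "idem_cls R F = idem_cls R F'" using assms idem_cls_eq_iff by auto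
  thus ?thesis using assms k0_rel_iff[of "(E, F)" "(E', F')"] V.one_closed by auto
qed

lemma k0_cls_eq_iff:
  assumes P: "P \<in> idems R \<times> idems R" and Q: "Q \<in> idems R \<times> idems R"
  shows "k0_cls R P = k0_cls R Q \<longleftrightarrow> k0_rel R P Q"
proof
  assume "k0_cls R P = k0_cls R Q"
  moreover have "Q \<in> k0_cls R Q" using Q k0_rel_refl by (simp add: k0_cls_def)
  ultimately have "Q \<in> k0_cls R P" by simp
  thus "k0_rel R P Q" by (simp add: k0_cls_def)
next
  assume "k0_rel R P Q"
  thus "k0_cls R P = k0_cls R Q" unfolding k0_cls_def
    using k0_rel_trans k0_rel_sym P Q by (intro Collect_cong) metis
qed

lemma k0_rep_cls:
  assumes "P \<in> idems R \<times> idems R"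
  shows "k0_rep (k0_cls R P) \<in> idems R \<times> idems R" "k0_rel R P (k0_rep (k0_cls R P))"
proof -
  have "P \<in> k0_cls R P" using assms k0_rel_refl by (simp add: k0_cls_def)
  hence "k0_rep (k0_cls R P) \<in> k0_cls R P" unfolding k0_rep_def by (rule someI)
  thus "k0_rep (k0_cls R P) \<in> idems R \<times> idems R" "k0_rel R P (k0_rep (k0_cls R P))"
    unfolding k0_cls_def by auto
qed

lemma K0u_mult:
  assumes P: "P \<in> idems R \<times> idems R" and Q: "Q \<in> idems R \<times> idems R"
  shows "k0_cls R P \<otimes>\<^bsub>K0u R\<^esub> k0_cls R Q = k0_cls R (dsum2 R P Q)"
proof -
  note rP = k0_rep_cls[OF P] and rQ = k0_rep_cls[OF Q]
  have "k0_rel R (dsum2 R P Q) (dsum2 R (k0_rep (k0_cls R P)) (k0_rep (k0_cls R Q)))"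
    by (rule k0_rel_dsum[OF P Q rP(1) rQ(1) rP(2) rQ(2)])
  hence "k0_cls R (dsum2 R P Q) = k0_cls R (dsum2 R (k0_rep (k0_cls R P)) (k0_rep (k0_cls R Q)))"
    using k0_cls_eq_iff[OF dsum2_idems[OF P Q] dsum2_idems[OF rP(1) rQ(1)]] by simp
  thus ?thesis by (simp add: K0u_def)
qed

lemma K0u_one: "\<one>\<^bsub>K0u R\<^esub> = k0_cls R ((0, \<lambda>i j. \<zero>), (0, \<lambda>i j. \<zero>))"
  by (simp add: K0u_def)

lemma K0u_carrier: "carrier (K0u R) = k0_cls R ` (idems R \<times> idems R)"
  by (simp add: K0u_def)

lemma K0u_mult_closed: "c \<in> carrier (K0u R) \<Longrightarrow> d \<in> carrier (K0u R) \<Longrightarrow> c \<otimes>\<^bsub>K0u R\<^esub> d \<in> carrier (K0u R)"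
  using K0u_mult dsum2_idems unfolding K0u_carrier by (auto simp: image_iff) (metis dsum_idems)

lemma K0u_one_mult: "\<one>\<^bsub>K0u R\<^esub> \<otimes>\<^bsub>K0u R\<^esub> \<one>\<^bsub>K0u R\<^esub> = \<one>\<^bsub>K0u R\<^esub>"
  unfolding K0u_one by (subst K0u_mult) (auto simp: zero_idems dsum_zero)

end

section \<open>Functoriality under ring homomorphisms\<close>

definition map_idm :: "('a \<Rightarrow> 'c) \<Rightarrow> 'a idm \<Rightarrow> 'c idm" where
  "map_idm h E = (fst E, \<lambda>i j. h (snd E i j))"

abbreviation map_idm2 :: "('a \<Rightarrow> 'c) \<Rightarrow> 'a idm \<times> 'a idm \<Rightarrow> 'c idm \<times> 'c idm" where
  "map_idm2 h P \<equiv> (map_idm h (fst P), map_idm h (snd P))"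

lemma map_idm_ident: "map_idm (\<lambda>x. x) E = E" "map_idm2 (\<lambda>x. x) P = P"
  by (simp_all add: map_idm_def)

context ring_hom_ring begin

lemma map_mats: "A \<in> mats R n m \<Longrightarrow> (\<lambda>i j. h (A i j)) \<in> mats S n m"
  by (auto simp: mats_def)

lemma hom_finsum_lessThan:
  "(\<And>l. l < (k::nat) \<Longrightarrow> f l \<in> carrier R) \<Longrightarrow> h (finsum R f {..<k}) = finsum S (\<lambda>l. h (f l)) {..<k}"
proof (induction k)
  case (Suc k)
  thus ?case by (simp add: R.finsum_lessThan_Suc S.finsum_lessThan_Suc R.finsum_lessThan_closed)
qed simp

lemma map_mmul:
  assumes A: "A \<in> mats R n k" and B: "B \<in> mats R k m"
  shows "(\<lambda>i j. h (mmul R n k m A B i j)) = mmul S n k m (\<lambda>i j. h (A i j)) (\<lambda>i j. h (B i j))"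
  using R.matsD[OF A] R.matsD[OF B]
  by (auto simp: mmul_def hom_finsum_lessThan intro!: ext S.finsum_lessThan_cong)

lemma map_idems:
  assumes "E \<in> idems R" shows "map_idm h E \<in> idems S"
proof -
  obtain n e where E: "E = (n, e)" by fastforce
  have e: "e \<in> mats R n n" "mmul R n n n e e = e" using assms by (auto simp: E idems_def)
  show ?thesis using map_mmul[OF e(1) e(1)] map_mats[OF e(1)] by (simp add: E idems_def map_idm_def e(2))
qed

lemma map_dsum: "map_idm h (dsum R E F) = dsum S (map_idm h E) (map_idm h F)"
  by (auto simp: dsum_def map_idm_def split: prod.splits intro!: ext)

lemma map_idm_equiv:
  assumes E: "E \<in> idems R" and F: "F \<in> idems R" and "idm_equiv R E F"
  shows "idm_equiv S (map_idm h E) (map_idm h F)"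
proof -
  obtain n e m f where EF: "E = (n, e)" "F = (m, f)" by fastforce
  define K where "K = n + m"
  have K: "n \<le> K" "m \<le> K" by (auto simp: K_def)
  obtain x y where xy: "x \<in> mats R K K" "y \<in> mats R K K" "mmul R K K K x y = e" "mmul R K K K y x = f"
    using assms R.idm_equiv_iff_mvn[of n e m f K] K by (auto simp: EF mvn_def)
  have "mvn (matring S K) (\<lambda>i j. h (e i j)) (\<lambda>i j. h (f i j))"
    unfolding mvn_def using xy map_mats[OF xy(1)] map_mats[OF xy(2)] map_mmul[OF xy(1,2)] map_mmul[OF xy(2,1)]
    by (intro bexI[of _ "\<lambda>i j. h (x i j)"] bexI[of _ "\<lambda>i j. h (y i j)"]) auto
  thus ?thesis using S.idm_equiv_iff_mvn[OF _ _ K] map_idems[OF E] map_idems[OF F]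
    by (simp add: EF map_idm_def)
qed

lemma map_k0_rel:
  assumes P: "P \<in> idems R \<times> idems R" and Q: "Q \<in> idems R \<times> idems R" and "k0_rel R P Q"
  shows "k0_rel S (map_idm2 h P) (map_idm2 h Q)"
proof -
  obtain g where "g \<in> idems R"
    "idm_equiv R (dsum R (dsum R (fst P) (snd Q)) g) (dsum R (dsum R (fst Q) (snd P)) g)"
    using \<open>k0_rel R P Q\<close> by (auto simp: k0_rel_def)
  moreover have "fst P \<in> idems R" "snd P \<in> idems R" "fst Q \<in> idems R" "snd Q \<in> idems R" using P Q by auto
  ultimately show ?thesis unfolding k0_rel_def fst_conv snd_conv map_dsum[symmetric]
    by (intro bexI[of _ "map_idm h g"]) (auto simp: map_dsum[symmetric] intro!: map_idm_equiv map_idems R.dsum_idems)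
qed

text \<open>\<open>k0_map\<close> works on a chosen representative; the choice is harmless because
  homomorphisms preserve \<open>k0_rel\<close>.\<close>

lemma k0_map_cls:
  assumes P: "P \<in> idems R \<times> idems R"
  shows "k0_map h S (k0_cls R P) = k0_cls S (map_idm2 h P)"
proof -
  note r = R.k0_rep_cls[OF P]
  have "k0_rel S (map_idm2 h P) (map_idm2 h (k0_rep (k0_cls R P)))"
    by (rule map_k0_rel[OF P r])
  moreover have "map_idm2 h P \<in> idems S \<times> idems S" "map_idm2 h (k0_rep (k0_cls R P)) \<in> idems S \<times> idems S"
    using P r(1) by (auto intro!: map_idems)
  ultimately have "k0_cls S (map_idm2 h P) = k0_cls S (map_idm2 h (k0_rep (k0_cls R P)))"
    using S.k0_cls_eq_iff by blast
  thus ?thesis by (simp add: k0_map_def map_idm_def Let_def split: prod.splits)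
qed

lemma k0_map_mult:
  assumes "c \<in> carrier (K0u R)" "d \<in> carrier (K0u R)"
  shows "k0_map h S (c \<otimes>\<^bsub>K0u R\<^esub> d) = k0_map h S c \<otimes>\<^bsub>K0u S\<^esub> k0_map h S d"
proof -
  obtain P Q where PQ: "P \<in> idems R \<times> idems R" "Q \<in> idems R \<times> idems R" "c = k0_cls R P" "d = k0_cls R Q"
    using assms by (auto simp: R.K0u_carrier)
  have m: "map_idm2 h P \<in> idems S \<times> idems S" "map_idm2 h Q \<in> idems S \<times> idems S"
    using PQ by (auto intro!: map_idems)
  show ?thesis unfolding PQ(3,4) R.K0u_mult[OF PQ(1,2)] k0_map_cls[OF PQ(1)] k0_map_cls[OF PQ(2)]
      S.K0u_mult[OF m] k0_map_cls[OF R.dsum2_idems[OF PQ(1,2)]]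
    by (simp add: map_dsum)
qed

lemma k0_map_one: "k0_map h S \<one>\<^bsub>K0u R\<^esub> = \<one>\<^bsub>K0u S\<^esub>"
  unfolding R.K0u_one S.K0u_one
  by (subst k0_map_cls) (auto simp: R.zero_idems map_idm_def)

end

section \<open>Direct limits\<close>

text \<open>A class of the direct limit is the same thing as a fibre of the joint map
  \<open>\<Psi>\<close>. So the isomorphism goes from \<open>H\<close> to the limit and sends
  \<open>z\<close> to its fibre \<open>h z\<close>, which needs no choice of
  representatives.\<close>

lemma dirlim_iso:
  fixes G :: "nat \<Rightarrow> 'g monoid" and H :: "'h monoid"
  assumes mult_closed: "\<And>n x y. x \<in> carrier (G n) \<Longrightarrow> y \<in> carrier (G n) \<Longrightarrow> x \<otimes>\<^bsub>G n\<^esub> y \<in> carrier (G n)"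
    and one_closed: "\<one>\<^bsub>G 0\<^esub> \<in> carrier (G 0)"
    and phi_closed: "\<And>n m x. n \<le> m \<Longrightarrow> x \<in> carrier (G n) \<Longrightarrow> \<phi> n m x \<in> carrier (G m)"
    and psi_closed: "\<And>n x. x \<in> carrier (G n) \<Longrightarrow> \<psi> n x \<in> carrier H"
    and psi_mult: "\<And>n x y. x \<in> carrier (G n) \<Longrightarrow> y \<in> carrier (G n) \<Longrightarrow>
      \<psi> n (x \<otimes>\<^bsub>G n\<^esub> y) = \<psi> n x \<otimes>\<^bsub>H\<^esub> \<psi> n y"
    and phi_phi: "\<And>n m k x. n \<le> m \<Longrightarrow> m \<le> k \<Longrightarrow> x \<in> carrier (G n) \<Longrightarrow> \<phi> m k (\<phi> n m x) = \<phi> n k x"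
    and psi_phi: "\<And>n m x. n \<le> m \<Longrightarrow> x \<in> carrier (G n) \<Longrightarrow> \<psi> m (\<phi> n m x) = \<psi> n x"
    and eventually_inj: "\<And>n x y. x \<in> carrier (G n) \<Longrightarrow> y \<in> carrier (G n) \<Longrightarrow> \<psi> n x = \<psi> n y \<Longrightarrow>
      \<exists>k\<ge>n. \<phi> n k x = \<phi> n k y"
    and jointly_surj: "\<And>z. z \<in> carrier H \<Longrightarrow> \<exists>n. \<exists>x\<in>carrier (G n). \<psi> n x = z"
  shows "H \<cong> dirlim G \<phi>"
proof -
  define valid where "valid b \<longleftrightarrow> snd b \<in> carrier (G (fst b))" for b
  define \<Psi> where "\<Psi> b = \<psi> (fst b) (snd b)" for b
  have rel: "dl_rel \<phi> a b \<longleftrightarrow> \<Psi> a = \<Psi> b" if "valid a" "valid b" for a b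
  proof
    assume "dl_rel \<phi> a b"
    then obtain k where "fst a \<le> k" "fst b \<le> k" "\<phi> (fst a) k (snd a) = \<phi> (fst b) k (snd b)"
      by (auto simp: dl_rel_def)
    thus "\<Psi> a = \<Psi> b" using psi_phi that unfolding valid_def \<Psi>_def by metis
  next
    assume eq: "\<Psi> a = \<Psi> b"
    define m where "m = max (fst a) (fst b)"
    have m: "fst a \<le> m" "fst b \<le> m" by (auto simp: m_def)
    have c: "snd a \<in> carrier (G (fst a))" "snd b \<in> carrier (G (fst b))" using that by (auto simp: valid_def)
    \<comment> \<open>Moved to a common stage, both elements still have the same image in
      \<open>H\<close>, so \<open>eventually_inj\<close> identifies them at a later stage.\<close>
    have "\<psi> m (\<phi> (fst a) m (snd a)) = \<psi> m (\<phi> (fst b) m (snd b))"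
      using psi_phi[OF m(1) c(1)] psi_phi[OF m(2) c(2)] eq unfolding \<Psi>_def by simp
    then obtain k where k: "k \<ge> m" "\<phi> m k (\<phi> (fst a) m (snd a)) = \<phi> m k (\<phi> (fst b) m (snd b))"
      using eventually_inj[OF phi_closed[OF m(1) c(1)] phi_closed[OF m(2) c(2)]] by blast
    hence "\<phi> (fst a) k (snd a) = \<phi> (fst b) k (snd b)"
      using phi_phi[OF m(1) k(1) c(1)] phi_phi[OF m(2) k(1) c(2)] by simp
    thus "dl_rel \<phi> a b" using m k(1) unfolding dl_rel_def by (meson le_trans)
  qed
  define h where "h z = {b. valid b \<and> \<Psi> b = z}" for z
  have cls: "dl_cls G \<phi> a = h (\<Psi> a)" if "valid a" for a
    unfolding dl_cls_def h_def valid_def[symmetric] by (intro Collect_cong) (use rel[OF that] in metis)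
  have ex: "\<exists>b. b \<in> h z" if "z \<in> carrier H" for z
  proof -
    obtain n x where "x \<in> carrier (G n)" "\<psi> n x = z" using jointly_surj \<open>z \<in> carrier H\<close> by blast
    hence "(n, x) \<in> h z" by (simp add: h_def valid_def \<Psi>_def)
    thus ?thesis ..
  qed
  have carr: "carrier (dirlim G \<phi>) = h ` carrier H"
  proof
    show "carrier (dirlim G \<phi>) \<subseteq> h ` carrier H"
    proof
      fix c assume "c \<in> carrier (dirlim G \<phi>)"
      then obtain n x where "c = dl_cls G \<phi> (n, x)" "x \<in> carrier (G n)" by (auto simp: dirlim_def)
      thus "c \<in> h ` carrier H" using cls[of "(n, x)"] psi_closed[of x n] by (simp add: valid_def \<Psi>_def)
    qed
    show "h ` carrier H \<subseteq> carrier (dirlim G \<phi>)"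
    proof
      fix c assume "c \<in> h ` carrier H"
      then obtain z n x where "c = h z" "x \<in> carrier (G n)" "\<psi> n x = z"
        using jointly_surj by blast
      thus "c \<in> carrier (dirlim G \<phi>)" using cls[of "(n, x)"]
        by (auto simp: dirlim_def valid_def \<Psi>_def intro!: exI[of _ n] exI[of _ x])
    qed
  qed
  have "h (y \<otimes>\<^bsub>H\<^esub> z) = h y \<otimes>\<^bsub>dirlim G \<phi>\<^esub> h z" if "y \<in> carrier H" "z \<in> carrier H" for y z
  proof -
    \<comment> \<open>\<open>dirlim\<close> multiplies arbitrarily chosen members of the two
      classes; all that is known of them is that they lie in the right fibres.\<close>
    define a where "a = (SOME a. a \<in> h y)"
    define b where "b = (SOME a. a \<in> h z)"
    have a: "valid a" "\<Psi> a = y" and b: "valid b" "\<Psi> b = z"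
      using someI_ex[OF ex[OF that(1)]] someI_ex[OF ex[OF that(2)]] by (auto simp: a_def b_def h_def)
    obtain n u m v where ab: "a = (n, u)" "b = (m, v)" by fastforce
    define k where "k = max n m"
    have k: "n \<le> k" "m \<le> k" by (auto simp: k_def)
    define w where "w = \<phi> n k u \<otimes>\<^bsub>G k\<^esub> \<phi> m k v"
    have u: "u \<in> carrier (G n)" "\<psi> n u = y" and v: "v \<in> carrier (G m)" "\<psi> m v = z"
      using a b by (auto simp: ab valid_def \<Psi>_def)
    have "valid (k, w)" "\<Psi> (k, w) = y \<otimes>\<^bsub>H\<^esub> z"
      using u v k by (auto simp: valid_def \<Psi>_def w_def mult_closed phi_closed psi_mult psi_phi)
    hence "dl_cls G \<phi> (k, w) = h (y \<otimes>\<^bsub>H\<^esub> z)" using cls by simp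
    thus ?thesis using ab unfolding dirlim_def w_def k_def a_def b_def by (simp add: Let_def)
  qed
  moreover have "inj_on h (carrier H)"
  proof (rule inj_onI)
    fix y z assume y: "y \<in> carrier H" and "h y = h z"
    then obtain b where "b \<in> h y" "b \<in> h z" using ex[OF y] by blast
    thus "y = z" by (simp add: h_def)
  qed
  ultimately have "h \<in> iso H (dirlim G \<phi>)"
    by (auto simp: iso_def hom_def bij_betw_def carr)
  thus ?thesis by (auto simp: is_iso_def)
qed

section \<open>The limit theorem for a dense chain of complete ultrametric rings\<close>

definition kerK0 :: "('a \<Rightarrow> int) \<Rightarrow> ('a, 'b) ring_scheme \<Rightarrow> ('a idm \<times> 'a idm) set monoid" where
  "kerK0 \<pi> R = \<lparr>carrier = {c \<in> carrier (K0u R). k0_map \<pi> \<Z> c = \<one>\<^bsub>K0u \<Z>\<^esub>},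
     monoid.mult = monoid.mult (K0u R), monoid.one = monoid.one (K0u R)\<rparr>"

text \<open>Of the ring, only the zero enters a block sum, and it is common to all rings of a chain;
  so block sums carry no index for the stage.\<close>

lemma dsum_carrier_update [simp]: "dsum (T\<lparr>carrier := Y\<rparr>) = dsum T"
  by (simp add: dsum_def fun_eq_iff)

text \<open>All rings are carrier updates of one record \<open>T\<close>, which makes the inclusions
  identity maps. \<open>dense\<close> uses a sum instead of a difference because subtraction depends
  on the carrier, and \<open>T\<close> with its own carrier need not be a ring.\<close>

locale dense_ultrametric_chain =
  fixes T :: "('a, 'b) ring_scheme" and C :: "nat \<Rightarrow> 'a set" and D :: "'a set" and N :: "'a \<Rightarrow> real"
    and \<pi> :: "'a \<Rightarrow> int"
  assumes ultra_C: "\<And>k. ultrametric_ring (T\<lparr>carrier := C k\<rparr>) N"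
    and ultra_D: "ultrametric_ring (T\<lparr>carrier := D\<rparr>) N"
    and C_Suc: "\<And>k. C k \<subseteq> C (Suc k)" and C_D: "\<And>k. C k \<subseteq> D"
    and dense: "\<And>x \<epsilon>. x \<in> D \<Longrightarrow> \<epsilon> > 0 \<Longrightarrow> \<exists>k. \<exists>y\<in>C k. \<exists>d\<in>D. x = y \<oplus>\<^bsub>T\<^esub> d \<and> N d < \<epsilon>"
    and hom_\<pi>: "ring_hom_ring (T\<lparr>carrier := D\<rparr>) \<Z> \<pi>"
begin

abbreviation "RC k \<equiv> T\<lparr>carrier := C k\<rparr>"
abbreviation "RD \<equiv> T\<lparr>carrier := D\<rparr>"

lemma C_mono: "k \<le> l \<Longrightarrow> C k \<subseteq> C l"
  using lift_Suc_mono_le[of C] C_Suc by blast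

lemma ring_C: "ring (RC k)" and ring_D: "ring RD"
  using ultra_C ultra_D by (auto intro: ultrametric_ring.axioms)

lemma hom_C: "k \<le> l \<Longrightarrow> ring_hom_ring (RC k) (RC l) (\<lambda>x. x)"
  using C_mono by (intro ring_hom_ringI ring_C) auto

lemma hom_D: "ring_hom_ring (RC k) RD (\<lambda>x. x)"
  using C_D by (intro ring_hom_ringI ring_C ring_D) auto

text \<open>Negation is defined by a description over the carrier, so its agreement in a subring and
  in the larger ring is not definitional; it follows from uniqueness of additive inverses.\<close>

lemma minus_D:
  assumes "x \<in> C k" "y \<in> C k" shows "x \<ominus>\<^bsub>RC k\<^esub> y = x \<ominus>\<^bsub>RD\<^esub> y"
proof -
  interpret C: ring "RC k" by (rule ring_C)
  interpret D: ring RD by (rule ring_D)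
  have "\<ominus>\<^bsub>RD\<^esub> y = \<ominus>\<^bsub>RC k\<^esub> y"
    using C.l_neg[of y] C.a_inv_closed[of y] assms C_D by (intro D.minus_equality) auto
  thus ?thesis by (simp add: a_minus_def)
qed

lemma mats_C: "k \<le> l \<Longrightarrow> mats (RC k) n m \<subseteq> mats (RC l) n m" and mats_D: "mats (RC k) n m \<subseteq> mats RD n m"
  using C_mono C_D by (fastforce simp: mats_def)+

lemma mmul_D: "A \<in> mats (RC k) n m \<Longrightarrow> B \<in> mats (RC k) m l \<Longrightarrow> mmul (RC k) n m l A B = mmul RD n m l A B"
  using ring_hom_ring.map_mmul[OF hom_D] by metis

lemma matring_minus_D:
  assumes x: "x \<in> mats (RC k) n n" and y: "y \<in> mats (RC k) n n"
  shows "x \<ominus>\<^bsub>matring (RC k) n\<^esub> y = x \<ominus>\<^bsub>matring RD n\<^esub> y"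
proof -
  have c: "x i j \<in> C k" "y i j \<in> C k" for i j
    using ring.matsD[OF ring_C x] ring.matsD[OF ring_C y] by auto
  have xD: "x \<in> mats RD n n" "y \<in> mats RD n n" using x y mats_D by auto
  show ?thesis unfolding ring.matring_minus[OF ring_C x y] ring.matring_minus[OF ring_D xD] minus_D[OF c] ..
qed

lemma idems_C: "k \<le> l \<Longrightarrow> idems (RC k) \<subseteq> idems (RC l)"
  using ring_hom_ring.map_idems[OF hom_C] by (auto simp: map_idm_ident)

lemma idems_D: "idems (RC k) \<subseteq> idems RD"
  using ring_hom_ring.map_idems[OF hom_D] by (auto simp: map_idm_ident)

text \<open>The finitely many entries are approximated separately, and some stage contains all
  approximations. The parameter \<open>k0\<close> allows a second matrix to be approximated at a
  stage beyond that of a first one.\<close>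

lemma dense_mats:
  assumes x: "x \<in> mats RD n n" and "\<epsilon> > 0"
  obtains k y where "k \<ge> k0" "y \<in> mats (RC k) n n" "matnorm N n (y \<ominus>\<^bsub>matring RD n\<^esub> x) < \<epsilon>"
proof -
  interpret D: ultrametric_ring RD N by (rule ultra_D)
  have xD: "x i j \<in> D" for i j using D.matsD[OF x] by simp
  have "\<forall>i j. \<exists>k y. y \<in> C k \<and> y \<in> D \<and> N (y \<ominus>\<^bsub>RD\<^esub> x i j) < \<epsilon> / 2"
  proof (intro allI)
    fix i j
    obtain k y d where *: "y \<in> C k" "d \<in> D" "x i j = y \<oplus>\<^bsub>T\<^esub> d" "N d < \<epsilon> / 2"
      using dense[OF xD, of "\<epsilon> / 2" i j] \<open>\<epsilon> > 0\<close> by auto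
    have y: "y \<in> D" using * C_D by auto
    have "y \<ominus>\<^bsub>RD\<^esub> (y \<oplus>\<^bsub>RD\<^esub> d) = \<ominus>\<^bsub>RD\<^esub> d"
      using y *(2) by (intro D.minus_add_self) auto
    thus "\<exists>k y. y \<in> C k \<and> y \<in> D \<and> N (y \<ominus>\<^bsub>RD\<^esub> x i j) < \<epsilon> / 2"
      using * y D.N_uminus[of d] by (intro exI[of _ k] exI[of _ y]) auto
  qed
  then obtain K Y where KY: "\<And>i j. Y i j \<in> C (K i j)" "\<And>i j. Y i j \<in> D" "\<And>i j. N (Y i j \<ominus>\<^bsub>RD\<^esub> x i j) < \<epsilon> / 2"
    by metis
  \<comment> \<open>The sum of the individual stages is an upper bound for each of them.\<close>
  define k where "k = k0 + (\<Sum>i<n. \<Sum>j<n. K i j)"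
  define y where "y i j = (if i < n \<and> j < n then Y i j else \<zero>\<^bsub>T\<^esub>)" for i j
  have Kk: "K i j \<le> k" if "i < n" "j < n" for i j
  proof -
    have "K i j \<le> (\<Sum>j<n. K i j)" using that by (intro member_le_sum) auto
    also have "\<dots> \<le> (\<Sum>i<n. \<Sum>j<n. K i j)" using that by (intro member_le_sum[of i _ "\<lambda>i. \<Sum>j<n. K i j"]) auto
    finally show ?thesis by (simp add: k_def)
  qed
  have "Y i j \<in> C k" if "i < n" "j < n" for i j using KY(1) C_mono[OF Kk[OF that]] by blast
  hence yk: "y \<in> mats (RC k) n n" by (simp add: mats_def y_def)
  hence yD: "y \<in> mats RD n n" using mats_D by auto
  have "matnorm N n (y \<ominus>\<^bsub>matring RD n\<^esub> x) \<le> \<epsilon> / 2"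
    unfolding D.matring_minus[OF yD x] matnorm_le_iff using KY(3) \<open>\<epsilon> > 0\<close> by (auto simp: y_def less_imp_le)
  thus ?thesis using that[of k y] yk \<open>\<epsilon> > 0\<close> by (auto simp: k_def)
qed

text \<open>The approximation \<open>f\<close> is corrected inside the matrices over
  \<open>RC k\<close>, which form a complete ring themselves, so the resulting idempotent
  \<open>g\<close> belongs to stage \<open>k\<close>. Only the comparison with \<open>e\<close>
  takes place over \<open>RD\<close>.\<close>

lemma lift_idem:
  assumes E: "E \<in> idems RD"
  obtains k F where "F \<in> idems (RC k)" "idm_equiv RD E F"
proof -
  obtain n e where En: "E = (n, e)" by fastforce
  let ?M = "matring RD n"
  interpret D: ultrametric_ring RD N by (rule ultra_D)
  interpret M: ultrametric_ring ?M "matnorm N n" by (rule D.ultrametric_matring)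
  let ?N = "matnorm N n"
  have e: "e \<in> carrier ?M" "e \<otimes>\<^bsub>?M\<^esub> e = e" using E by (auto simp: En idems_def)
  define B where "B = max 1 (?N e)"
  have B: "1 \<le> B" "?N e \<le> B" by (auto simp: B_def)
  \<comment> \<open>The defect of \<open>f\<close> is at most \<open>B * \<delta>\<close>, so
    \<open>g\<close> is within \<open>B ^ 2 * \<delta>\<close> of \<open>f\<close> and of
    \<open>e\<close>; \<open>close_idempotents_equivalent\<close> asks for a further factor
    \<open>B ^ 6\<close>. Altogether \<open>B ^ 8 * \<delta>\<close> has to be below 1.\<close>
  define \<delta> where "\<delta> = 1 / (2 * B ^ 8)"
  have \<delta>: "\<delta> > 0" using B by (simp add: \<delta>_def)
  have B8: "B ^ 8 * \<delta> = 1 / 2" using B by (simp add: \<delta>_def)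
  have Bpow: "B ^ i * \<delta> \<le> 1 / 2" if "i \<le> 8" for i
  proof -
    have "B ^ i * \<delta> \<le> B ^ 8 * \<delta>" using that B(1) \<delta> by (intro mult_right_mono power_increasing) auto
    thus ?thesis using B8 by linarith
  qed
  obtain k f where f: "f \<in> mats (RC k) n n" and fe: "?N (f \<ominus>\<^bsub>?M\<^esub> e) < \<delta>"
    using dense_mats[of e n \<delta> 0] e(1) \<delta> unfolding matring_simps by metis
  let ?L = "matring (RC k) n"
  interpret C: ultrametric_ring "RC k" N by (rule ultra_C)
  interpret L: ultrametric_ring ?L "matnorm N n" by (rule C.ultrametric_matring)
  have fD: "f \<in> carrier ?M" using f mats_D by auto
  have \<delta>1: "\<delta> \<le> 1 / 2" using Bpow[of 0] by simp
  have Nf: "?N f \<le> B"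
  proof -
    have "f = (f \<ominus>\<^bsub>?M\<^esub> e) \<oplus>\<^bsub>?M\<^esub> e"
      by (rule M.minus_plus[OF fD e(1)])
    thus ?thesis using M.N_add_le[of "f \<ominus>\<^bsub>?M\<^esub> e" e B] fD e(1) fe \<delta>1 B M.minus_closed by simp
  qed
  have u: "?N (f \<otimes>\<^bsub>?M\<^esub> f \<ominus>\<^bsub>?M\<^esub> f) \<le> B * \<delta>"
  proof -
    let ?d = "f \<ominus>\<^bsub>?M\<^esub> e"
    have d: "?d \<in> carrier ?M" using fD e(1) by (rule M.minus_closed)
    have eq: "f \<otimes>\<^bsub>?M\<^esub> f \<ominus>\<^bsub>?M\<^esub> f
      = ?d \<otimes>\<^bsub>?M\<^esub> f \<oplus>\<^bsub>?M\<^esub> e \<otimes>\<^bsub>?M\<^esub> ?d \<ominus>\<^bsub>?M\<^esub> ?d"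
      by (rule M.defect_near_idempotent[OF fD e])
    have 1: "?N (?d \<otimes>\<^bsub>?M\<^esub> f) \<le> B * \<delta>"
      using M.N_mult_le[OF d fD, of \<delta> B] fe Nf by (simp add: mult.commute)
    have 2: "?N (e \<otimes>\<^bsub>?M\<^esub> ?d) \<le> B * \<delta>"
      using M.N_mult_le[OF e(1) d, of B \<delta>] fe B by simp
    have 3: "?N ?d \<le> B * \<delta>" using fe mult_right_mono[OF B(1) less_imp_le[OF \<delta>]] by linarith
    show ?thesis unfolding eq
      by (intro M.N_minus_le M.N_add_le 1 2 3 M.m_closed M.a_closed d e(1) fD)
  qed
  \<comment> \<open>The estimate was made over \<open>RD\<close>, but Newton's iteration runs over
    \<open>RC k\<close> and needs it there.\<close>
  have eqC: "f \<otimes>\<^bsub>?L\<^esub> f \<ominus>\<^bsub>?L\<^esub> f = f \<otimes>\<^bsub>?M\<^esub> f \<ominus>\<^bsub>?M\<^esub> f"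
    using matring_minus_D[OF C.mmul_closed[OF f f] f] mmul_D[OF f f] by simp
  have uC: "?N (f \<otimes>\<^bsub>?L\<^esub> f \<ominus>\<^bsub>?L\<^esub> f) \<le> B * \<delta>" unfolding eqC by (rule u)
  have uC1: "?N (f \<otimes>\<^bsub>?L\<^esub> f \<ominus>\<^bsub>?L\<^esub> f) < 1"
    using uC Bpow[of 1] by simp
  obtain g where g: "g \<in> mats (RC k) n n" "mmul (RC k) n n n g g = g"
    and gf: "?N (g \<ominus>\<^bsub>?L\<^esub> f) \<le> B * ?N (f \<otimes>\<^bsub>?L\<^esub> f \<ominus>\<^bsub>?L\<^esub> f)"
    using L.almost_idempotent_lift[OF _ Nf B(1) uC1] f by auto
  have gD: "g \<in> carrier ?M" "g \<otimes>\<^bsub>?M\<^esub> g = g"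
    using g mats_D mmul_D[OF g(1) g(1)] by auto
  have "B * ?N (f \<otimes>\<^bsub>?L\<^esub> f \<ominus>\<^bsub>?L\<^esub> f) \<le> B * (B * \<delta>)"
    using uC B by (intro mult_left_mono) auto
  hence gf': "?N (g \<ominus>\<^bsub>?M\<^esub> f) \<le> B ^ 2 * \<delta>"
    using gf unfolding matring_minus_D[OF g(1) f] by (simp add: power2_eq_square mult_ac)
  have ge: "?N (g \<ominus>\<^bsub>?M\<^esub> e) \<le> B ^ 2 * \<delta>"
  proof -
    have "g \<ominus>\<^bsub>?M\<^esub> e = (g \<ominus>\<^bsub>?M\<^esub> f) \<oplus>\<^bsub>?M\<^esub> (f \<ominus>\<^bsub>?M\<^esub> e)"
      by (rule M.minus_telescope[OF gD(1) fD e(1)])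
    moreover have "\<delta> \<le> B ^ 2 * \<delta>" using mult_right_mono[OF one_le_power[OF B(1), of 2] less_imp_le[OF \<delta>]] by linarith
    ultimately show ?thesis
      using M.N_add_le[OF M.minus_closed[OF gD(1) fD] M.minus_closed[OF fD e(1)] gf'] fe by simp
  qed
  have Ng: "?N g \<le> B"
  proof -
    have "g = (g \<ominus>\<^bsub>?M\<^esub> e) \<oplus>\<^bsub>?M\<^esub> e"
      by (rule M.minus_plus[OF gD(1) e(1)])
    thus ?thesis using M.N_add_le[OF M.minus_closed[OF gD(1) e(1)] e(1), of B] ge Bpow[of 2] B by simp
  qed
  have "?N (g \<ominus>\<^bsub>?M\<^esub> e) * B ^ 6 \<le> B ^ 2 * \<delta> * B ^ 6" using ge B by (intro mult_right_mono) auto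
  also have "\<dots> = B ^ 8 * \<delta>" by (simp add: numeral_eq_Suc mult_ac)
  finally have "?N (g \<ominus>\<^bsub>?M\<^esub> e) * B ^ 6 < 1" using B8 by simp
  from M.close_idempotents_equivalent[OF e(1) gD(1) e(2) gD(2) B(2) Ng B(1) this]
  have "mvn ?M e g" by (auto simp: mvn_def)
  moreover have "(n, g) \<in> idems (RC k)" using g by (simp add: idems_def)
  ultimately show ?thesis
    using that[of "(n, g)" k] D.idm_equiv_iff_mvn[of n e n g n] E idems_D by (auto simp: En)
qed

text \<open>The idempotents stay as they are. Their witnesses are approximated at a finite stage,
  compressed between \<open>e\<close> and \<open>f\<close>, and corrected by
  \<open>perturb_equivalence\<close> inside the ring of that stage.\<close>

lemma lift_equiv:
  assumes E: "E \<in> idems (RC k)" and F: "F \<in> idems (RC k)" and equiv: "idm_equiv RD E F"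
  obtains l where "l \<ge> k" "idm_equiv (RC l) E F"
proof -
  obtain n e m f where EF: "E = (n, e)" "F = (m, f)" by fastforce
  define K where "K = n + m"
  have K: "n \<le> K" "m \<le> K" by (auto simp: K_def)
  interpret D: ultrametric_ring RD N by (rule ultra_D)
  define M where "M = matring RD K"
  interpret M: ultrametric_ring M "matnorm N K" unfolding M_def by (rule D.ultrametric_matring)
  let ?N = "matnorm N K"
  have IE: "(n, e) \<in> idems RD" and IF: "(m, f) \<in> idems RD" using E F idems_D by (auto simp: EF)
  have eC: "e \<in> mats (RC k) K K" and fC: "f \<in> mats (RC k) K K"
    using ring.idems_extend(1)[OF ring_C _ K(1)] ring.idems_extend(1)[OF ring_C _ K(2)] E F by (auto simp: EF)
  have ef: "e \<in> carrier M" "f \<in> carrier M" "e \<otimes>\<^bsub>M\<^esub> e = e" "f \<otimes>\<^bsub>M\<^esub> f = f"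
    using D.idems_extend[OF IE K(1)] D.idems_extend[OF IF K(2)] by (auto simp: M_def)
  have "mvn M e f" using D.idm_equiv_iff_mvn[OF IE IF K] equiv by (simp add: EF M_def)
  from M.mvn_normalized[OF ef(3,4) this] obtain x y where x: "x \<in> carrier M" and y: "y \<in> carrier M"
    and xy: "x \<otimes>\<^bsub>M\<^esub> y = e" "y \<otimes>\<^bsub>M\<^esub> x = f" "e \<otimes>\<^bsub>M\<^esub> x = x" "x \<otimes>\<^bsub>M\<^esub> f = x" "f \<otimes>\<^bsub>M\<^esub> y = y" "y \<otimes>\<^bsub>M\<^esub> e = y"
    by metis
  define B where "B = Max {1, ?N e, ?N f, ?N x, ?N y}"
  have B: "1 \<le> B" "?N e \<le> B" "?N f \<le> B" "?N x \<le> B" "?N y \<le> B" by (auto simp: B_def)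
  \<comment> \<open>Compressed witnesses are off by \<open>B ^ 2 * \<delta>\<close> and their
    products by \<open>B ^ 3 * \<delta>\<close>; the mixed condition of
    \<open>perturb_equivalence\<close> contributes the norms of both witnesses, which leads to
    \<open>B ^ 5 * \<delta>\<close>.\<close>
  define \<delta> where "\<delta> = 1 / (2 * B ^ 5)"
  have \<delta>: "\<delta> > 0" using B by (simp add: \<delta>_def)
  have B5: "B ^ 5 * \<delta> = 1 / 2" using B by (simp add: \<delta>_def)
  have Bpow: "B ^ i * \<delta> \<le> 1 / 2" if "i \<le> 5" for i
  proof -
    have "B ^ i * \<delta> \<le> B ^ 5 * \<delta>" using that B(1) \<delta> by (intro mult_right_mono power_increasing) auto
    thus ?thesis using B5 by linarith
  qed
  obtain l1 x0 where x0: "l1 \<ge> k" "x0 \<in> mats (RC l1) K K" "?N (x0 \<ominus>\<^bsub>M\<^esub> x) < \<delta>"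
    using dense_mats[of x K \<delta> k] x \<delta> by (auto simp: M_def)
  \<comment> \<open>Asking for a stage beyond \<open>l1\<close> brings both approximations into the
    same ring.\<close>
  obtain l y0 where y0: "l \<ge> l1" "y0 \<in> mats (RC l) K K" "?N (y0 \<ominus>\<^bsub>M\<^esub> y) < \<delta>"
    using dense_mats[of y K \<delta> l1] y \<delta> by (auto simp: M_def)
  have l: "l \<ge> k" using x0 y0 by simp
  interpret C: ultrametric_ring "RC l" N by (rule ultra_C)
  define L where "L = matring (RC l) K"
  interpret L: ultrametric_ring L "matnorm N K" unfolding L_def by (rule C.ultrametric_matring)
  have LM: "carrier L \<subseteq> carrier M" using mats_D by (auto simp: L_def M_def)
  have Lm: "a \<otimes>\<^bsub>L\<^esub> b = a \<otimes>\<^bsub>M\<^esub> b" "a \<ominus>\<^bsub>L\<^esub> b = a \<ominus>\<^bsub>M\<^esub> b" if "a \<in> carrier L" "b \<in> carrier L" for a b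
    using that mmul_D matring_minus_D by (auto simp: L_def M_def)
  have c: "e \<in> carrier L" "f \<in> carrier L" "x0 \<in> carrier L" "y0 \<in> carrier L"
    using subsetD[OF mats_C[OF l] eC] subsetD[OF mats_C[OF l] fC] subsetD[OF mats_C[OF y0(1)] x0(2)] y0(2)
    by (simp_all add: L_def)
  note cM = c[THEN subsetD[OF LM]]
  have conj: "?N (a \<otimes>\<^bsub>M\<^esub> z \<otimes>\<^bsub>M\<^esub> b) \<le> B ^ 2 * \<delta>"
    if "a \<in> carrier M" "b \<in> carrier M" "z \<in> carrier M" "?N a \<le> B" "?N b \<le> B" "?N z \<le> \<delta>" for a b z
    using M.N_mult_le[OF M.m_closed[OF that(1,3)] that(2) M.N_mult_le[OF that(1,3) that(4,6)] that(5)]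
    by (simp add: power2_eq_square mult_ac)
  \<comment> \<open>Compression makes the absorption identities hold exactly, as
    \<open>perturb_equivalence\<close> requires; only the two products remain approximate.\<close>
  define x1 where "x1 = e \<otimes>\<^bsub>L\<^esub> x0 \<otimes>\<^bsub>L\<^esub> f"
  define y1 where "y1 = f \<otimes>\<^bsub>L\<^esub> y0 \<otimes>\<^bsub>L\<^esub> e"
  have c1: "x1 \<in> carrier L" "y1 \<in> carrier L" using c by (auto simp: x1_def y1_def)
  note c1M = c1[THEN subsetD[OF LM]]
  have x1M: "x1 = e \<otimes>\<^bsub>M\<^esub> x0 \<otimes>\<^bsub>M\<^esub> f" and y1M: "y1 = f \<otimes>\<^bsub>M\<^esub> y0 \<otimes>\<^bsub>M\<^esub> e"
    using Lm L.m_closed c by (auto simp: x1_def y1_def)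
  have near: "?N (a \<otimes>\<^bsub>M\<^esub> z0 \<otimes>\<^bsub>M\<^esub> b \<ominus>\<^bsub>M\<^esub> z) \<le> B ^ 2 * \<delta>"
    if "a \<in> carrier M" "b \<in> carrier M" "z0 \<in> carrier M" "z \<in> carrier M" "?N a \<le> B" "?N b \<le> B"
      "?N (z0 \<ominus>\<^bsub>M\<^esub> z) < \<delta>" "a \<otimes>\<^bsub>M\<^esub> z = z" "z \<otimes>\<^bsub>M\<^esub> b = z" for a b z0 z
  proof -
    have "a \<otimes>\<^bsub>M\<^esub> z0 \<otimes>\<^bsub>M\<^esub> b \<ominus>\<^bsub>M\<^esub> a \<otimes>\<^bsub>M\<^esub> z \<otimes>\<^bsub>M\<^esub> b = a \<otimes>\<^bsub>M\<^esub> (z0 \<ominus>\<^bsub>M\<^esub> z) \<otimes>\<^bsub>M\<^esub> b"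
      using that(1-4) by algebra
    hence "a \<otimes>\<^bsub>M\<^esub> z0 \<otimes>\<^bsub>M\<^esub> b \<ominus>\<^bsub>M\<^esub> z = a \<otimes>\<^bsub>M\<^esub> (z0 \<ominus>\<^bsub>M\<^esub> z) \<otimes>\<^bsub>M\<^esub> b" by (simp add: that(8,9))
    thus ?thesis using conj[OF that(1,2) M.minus_closed[OF that(3,4)] that(5,6)] that(7) by simp
  qed
  have nx: "?N (x1 \<ominus>\<^bsub>M\<^esub> x) \<le> B ^ 2 * \<delta>" unfolding x1M using near[of e f x0 x] cM x B x0 xy by auto
  have ny: "?N (y1 \<ominus>\<^bsub>M\<^esub> y) \<le> B ^ 2 * \<delta>" unfolding y1M using near[of f e y0 y] cM y B y0 xy by auto
  have bound: "?N z1 \<le> B" if "z1 \<in> carrier M" "z \<in> carrier M" "?N z \<le> B" "?N (z1 \<ominus>\<^bsub>M\<^esub> z) \<le> B ^ 2 * \<delta>" for z1 z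
  proof -
    have "z1 = (z1 \<ominus>\<^bsub>M\<^esub> z) \<oplus>\<^bsub>M\<^esub> z" by (rule M.minus_plus[OF that(1,2)])
    thus ?thesis using M.N_add_le[OF M.minus_closed[OF that(1,2)] that(2), of B] that Bpow[of 2] B by simp
  qed
  have bx: "?N x1 \<le> B" and by1: "?N y1 \<le> B"
    using bound[OF c1M(1) x B(4) nx] bound[OF c1M(2) y B(5) ny] by auto
  \<comment> \<open>The two factors are exchanged one at a time, and each exchange costs one more
    factor \<open>B\<close>.\<close>
  have prod: "?N (a \<otimes>\<^bsub>M\<^esub> b \<ominus>\<^bsub>M\<^esub> a1 \<otimes>\<^bsub>M\<^esub> b1) \<le> B ^ 3 * \<delta>"
    if c: "a \<in> carrier M" "b \<in> carrier M" "a1 \<in> carrier M" "b1 \<in> carrier M"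
      and N: "?N (a1 \<ominus>\<^bsub>M\<^esub> a) \<le> B ^ 2 * \<delta>" "?N (b1 \<ominus>\<^bsub>M\<^esub> b) \<le> B ^ 2 * \<delta>" "?N b \<le> B" "?N a1 \<le> B" for a b a1 b1
  proof -
    have "a \<otimes>\<^bsub>M\<^esub> b \<ominus>\<^bsub>M\<^esub> a1 \<otimes>\<^bsub>M\<^esub> b1 = \<ominus>\<^bsub>M\<^esub> ((a1 \<ominus>\<^bsub>M\<^esub> a) \<otimes>\<^bsub>M\<^esub> b) \<ominus>\<^bsub>M\<^esub> a1 \<otimes>\<^bsub>M\<^esub> (b1 \<ominus>\<^bsub>M\<^esub> b)"
      using c by algebra
    moreover have "?N ((a1 \<ominus>\<^bsub>M\<^esub> a) \<otimes>\<^bsub>M\<^esub> b) \<le> B ^ 3 * \<delta>"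
      using M.N_mult_le[OF M.minus_closed[OF c(3,1)] c(2) N(1,3)] by (simp add: numeral_eq_Suc mult_ac)
    moreover have "?N (a1 \<otimes>\<^bsub>M\<^esub> (b1 \<ominus>\<^bsub>M\<^esub> b)) \<le> B ^ 3 * \<delta>"
      using M.N_mult_le[OF c(3) M.minus_closed[OF c(4,2)] N(4,2)] by (simp add: numeral_eq_Suc mult_ac)
    ultimately show ?thesis using c by (auto intro!: M.N_minus_le simp: M.N_uminus)
  qed
  have d1: "?N (e \<ominus>\<^bsub>L\<^esub> x1 \<otimes>\<^bsub>L\<^esub> y1) \<le> B ^ 3 * \<delta>"
    using prod[OF x y c1M nx ny B(5) bx] Lm c c1 L.m_closed by (simp add: xy)
  have d2: "?N (f \<ominus>\<^bsub>L\<^esub> y1 \<otimes>\<^bsub>L\<^esub> x1) \<le> B ^ 3 * \<delta>"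
    using prod[OF y x c1M(2,1) ny nx B(4) by1] Lm c c1 L.m_closed by (simp add: xy)
  have idem: "e \<otimes>\<^bsub>L\<^esub> e = e" "f \<otimes>\<^bsub>L\<^esub> f = f" using ef c Lm by auto
  have abs: "e \<otimes>\<^bsub>L\<^esub> x1 = x1" "x1 \<otimes>\<^bsub>L\<^esub> f = x1" "f \<otimes>\<^bsub>L\<^esub> y1 = y1" "y1 \<otimes>\<^bsub>L\<^esub> e = y1"
    unfolding x1_def y1_def using c idem by (simp_all add: L.m_assoc idem(1) idem(2) flip: L.m_assoc[of e e] L.m_assoc[of f f])
  have "?N y1 * ?N (e \<ominus>\<^bsub>L\<^esub> x1 \<otimes>\<^bsub>L\<^esub> y1) * ?N x1 \<le> B * (B ^ 3 * \<delta>) * B"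
    using by1 bx d1 B \<delta> by (intro mult_mono) (auto simp: matnorm_nonneg)
  also have "\<dots> = B ^ 5 * \<delta>" by (simp add: numeral_eq_Suc mult_ac)
  finally have small: "?N y1 * ?N (e \<ominus>\<^bsub>L\<^esub> x1 \<otimes>\<^bsub>L\<^esub> y1) * ?N x1 < 1" using B5 by simp
  have "mvn L e f" unfolding mvn_def
    by (rule L.perturb_equivalence[OF c(1,2) c1 idem abs _ small]) (use d1 d2 Bpow[of 3] in auto)
  moreover have "(n, e) \<in> idems (RC l)" "(m, f) \<in> idems (RC l)" using E F idems_C[OF l] by (auto simp: EF)
  ultimately show ?thesis using that[OF l] C.idm_equiv_iff_mvn[OF _ _ K] by (simp add: EF L_def)
qed

lemma hom_\<pi>_C: "ring_hom_ring (RC k) \<Z> \<pi>"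
proof -
  interpret D: ring_hom_ring RD \<Z> \<pi> by (rule hom_\<pi>)
  show ?thesis
  proof (rule ring_hom_ringI[OF ring_C ring_hom_ring.axioms(2)[OF hom_\<pi>]])
    fix x y assume "x \<in> carrier (RC k)" "y \<in> carrier (RC k)"
    hence "x \<in> carrier RD" "y \<in> carrier RD" using C_D by auto
    thus "\<pi> x \<in> carrier \<Z>" "\<pi> (x \<otimes>\<^bsub>RC k\<^esub> y) = \<pi> x \<otimes>\<^bsub>\<Z>\<^esub> \<pi> y" "\<pi> (x \<oplus>\<^bsub>RC k\<^esub> y) = \<pi> x \<oplus>\<^bsub>\<Z>\<^esub> \<pi> y"
      using D.hom_mult[of x y] D.hom_add[of x y] by auto
  qed (use D.hom_one in auto)
qed

lemma cls_C:
  assumes "k \<le> l" and P: "P \<in> idems (RC k) \<times> idems (RC k)"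
  shows "k0_map (\<lambda>x. x) (RC l) (k0_cls (RC k) P) = k0_cls (RC l) P"
  using ring_hom_ring.k0_map_cls[OF hom_C[OF assms(1)] P] by (simp add: map_idm_ident)

lemma cls_D:
  assumes P: "P \<in> idems (RC k) \<times> idems (RC k)"
  shows "k0_map (\<lambda>x. x) RD (k0_cls (RC k) P) = k0_cls RD P"
  using ring_hom_ring.k0_map_cls[OF hom_D P] by (simp add: map_idm_ident)

lemma cls_\<pi>_C:
  "P \<in> idems (RC k) \<times> idems (RC k) \<Longrightarrow> k0_map \<pi> \<Z> (k0_cls (RC k) P) = k0_cls \<Z> (map_idm2 \<pi> P)"
  by (rule ring_hom_ring.k0_map_cls[OF hom_\<pi>_C])

lemma cls_\<pi>_D:
  "P \<in> idems RD \<times> idems RD \<Longrightarrow> k0_map \<pi> \<Z> (k0_cls RD P) = k0_cls \<Z> (map_idm2 \<pi> P)"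
  by (rule ring_hom_ring.k0_map_cls[OF hom_\<pi>])

lemma kerK0_C_E:
  assumes "c \<in> carrier (kerK0 \<pi> (RC k))"
  obtains P where "P \<in> idems (RC k) \<times> idems (RC k)" "c = k0_cls (RC k) P"
    "k0_cls \<Z> (map_idm2 \<pi> P) = \<one>\<^bsub>K0u \<Z>\<^esub>"
  using assms cls_\<pi>_C by (auto simp: kerK0_def ring.K0u_carrier[OF ring_C])

lemma kerK0_C_I:
  assumes "P \<in> idems (RC k) \<times> idems (RC k)" "k0_cls \<Z> (map_idm2 \<pi> P) = \<one>\<^bsub>K0u \<Z>\<^esub>"
  shows "k0_cls (RC k) P \<in> carrier (kerK0 \<pi> (RC k))"
  using assms cls_\<pi>_C[OF assms(1)] by (auto simp: kerK0_def ring.K0u_carrier[OF ring_C])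

lemma kerK0_D_I:
  assumes "P \<in> idems RD \<times> idems RD" "k0_cls \<Z> (map_idm2 \<pi> P) = \<one>\<^bsub>K0u \<Z>\<^esub>"
  shows "k0_cls RD P \<in> carrier (kerK0 \<pi> RD)"
  using assms cls_\<pi>_D[OF assms(1)] by (auto simp: kerK0_def ring.K0u_carrier[OF ring_D])

text \<open>The stabilizing idempotent \<open>g\<close> of the relation over \<open>RD\<close> need
  not come from a finite stage. It is first replaced by an equivalent \<open>g'\<close> that does,
  and only then is the equivalence of the two block sums pulled back.\<close>

lemma eventually_equal:
  assumes P: "P \<in> idems (RC n) \<times> idems (RC n)" and Q: "Q \<in> idems (RC n) \<times> idems (RC n)"
    and eq: "k0_cls RD P = k0_cls RD Q"
  shows "\<exists>k\<ge>n. k0_cls (RC k) P = k0_cls (RC k) Q"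
proof -
  interpret D: ring RD by (rule ring_D)
  have I: "fst P \<in> idems (RC n)" "snd P \<in> idems (RC n)" "fst Q \<in> idems (RC n)" "snd Q \<in> idems (RC n)"
    using P Q by auto
  have PD: "P \<in> idems RD \<times> idems RD" and QD: "Q \<in> idems RD \<times> idems RD" using P Q idems_D by auto
  have ID: "fst P \<in> idems RD" "snd P \<in> idems RD" "fst Q \<in> idems RD" "snd Q \<in> idems RD" using PD QD by auto
  define a where "a = dsum T (fst P) (snd Q)"
  define b where "b = dsum T (fst Q) (snd P)"
  have aD: "a \<in> idems RD" and bD: "b \<in> idems RD"
    using D.dsum_idems[OF ID(1,4)] D.dsum_idems[OF ID(3,2)] by (simp_all add: a_def b_def)
  obtain g where g: "g \<in> idems RD" "idm_equiv RD (dsum T a g) (dsum T b g)"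
    using eq D.k0_cls_eq_iff[OF PD QD] by (auto simp: k0_rel_def a_def b_def)
  obtain k0 g' where g': "g' \<in> idems (RC k0)" "idm_equiv RD g g'" using lift_idem[OF g(1)] .
  have g'D: "g' \<in> idems RD" using g' idems_D by auto
  define k where "k = max n k0"
  have k: "n \<le> k" "k0 \<le> k" by (auto simp: k_def)
  note Ik = I[THEN subsetD[OF idems_C[OF k(1)]]]
  have g'k: "g' \<in> idems (RC k)" using g' idems_C[OF k(2)] by auto
  have ak: "a \<in> idems (RC k)" and bk: "b \<in> idems (RC k)"
    using ring.dsum_idems[OF ring_C Ik(1,4)] ring.dsum_idems[OF ring_C Ik(3,2)] by (simp_all add: a_def b_def)
  have e1: "idm_equiv RD (dsum T a g') (dsum T a g)"
    using D.dsum_cong[OF aD g'D aD g(1) D.idm_equiv_refl[OF aD] D.idm_equiv_sym[OF g'(2)]] by simp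
  have e2: "idm_equiv RD (dsum T b g) (dsum T b g')"
    using D.dsum_cong[OF bD g(1) bD g'D D.idm_equiv_refl[OF bD] g'(2)] by simp
  have sD: "dsum T a g' \<in> idems RD" "dsum T a g \<in> idems RD" "dsum T b g \<in> idems RD" "dsum T b g' \<in> idems RD"
    using D.dsum_idems aD bD g(1) g'D by simp_all
  have "idm_equiv RD (dsum T a g') (dsum T b g')"
    using D.idm_equiv_trans[OF sD(1,3,4) D.idm_equiv_trans[OF sD(1,2,3) e1 g(2)] e2] .
  moreover have "dsum T a g' \<in> idems (RC k)" "dsum T b g' \<in> idems (RC k)"
    using ring.dsum_idems[OF ring_C ak g'k] ring.dsum_idems[OF ring_C bk g'k] by simp_all
  ultimately obtain l where l: "l \<ge> k" "idm_equiv (RC l) (dsum T a g') (dsum T b g')"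
    using lift_equiv by metis
  have nl: "n \<le> l" using k l by simp
  have Pl: "P \<in> idems (RC l) \<times> idems (RC l)" and Ql: "Q \<in> idems (RC l) \<times> idems (RC l)"
    using P Q idems_C[OF nl] by auto
  have "k0_rel (RC l) P Q" unfolding k0_rel_def
    by (rule bexI[of _ g']) (use l(2) g'k idems_C[OF l(1)] in \<open>auto simp: a_def b_def\<close>)
  thus ?thesis using ring.k0_cls_eq_iff[OF ring_C Pl Ql] nl by blast
qed

lemma kerK0_mult:
  "monoid.mult (kerK0 \<pi> R) = monoid.mult (K0u R)" "monoid.one (kerK0 \<pi> R) = monoid.one (K0u R)"
  by (simp_all add: kerK0_def)

text \<open>An arbitrary homomorphism \<open>\<pi>\<close> to the integers takes the place of the
  projection from a unitization. Since it is the same function on all stages and on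
  \<open>RD\<close>, passing between them does not affect membership in the kernel.\<close>

theorem kerK0_iso_dirlim:
  "kerK0 \<pi> RD \<cong> dirlim (\<lambda>k. kerK0 \<pi> (RC k)) (\<lambda>n m. k0_map (\<lambda>x. x) (RC m))"
proof (rule dirlim_iso[where \<psi> = "\<lambda>n. k0_map (\<lambda>x. x) RD"])
  fix n x y assume x: "x \<in> carrier (kerK0 \<pi> (RC n))" and y: "y \<in> carrier (kerK0 \<pi> (RC n))"
  have xy: "x \<in> carrier (K0u (RC n))" "y \<in> carrier (K0u (RC n))" using x y by (auto simp: kerK0_def)
  \<comment> \<open>The kernel is closed under products because the trivial class over the integers
    is idempotent.\<close>
  show "x \<otimes>\<^bsub>kerK0 \<pi> (RC n)\<^esub> y \<in> carrier (kerK0 \<pi> (RC n))"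
    using x y ring_hom_ring.k0_map_mult[OF hom_\<pi>_C xy] ring.K0u_mult_closed[OF ring_C xy]
      ring.K0u_one_mult[OF ring_hom_ring.axioms(2)[OF hom_\<pi>]] by (simp add: kerK0_def)
  show "k0_map (\<lambda>x. x) RD (x \<otimes>\<^bsub>kerK0 \<pi> (RC n)\<^esub> y)
      = k0_map (\<lambda>x. x) RD x \<otimes>\<^bsub>kerK0 \<pi> RD\<^esub> k0_map (\<lambda>x. x) RD y"
    unfolding kerK0_mult by (rule ring_hom_ring.k0_map_mult[OF hom_D xy])
  assume eq: "k0_map (\<lambda>x. x) RD x = k0_map (\<lambda>x. x) RD y"
  obtain P where P: "P \<in> idems (RC n) \<times> idems (RC n)" "x = k0_cls (RC n) P" by (rule kerK0_C_E[OF x])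
  obtain Q where Q: "Q \<in> idems (RC n) \<times> idems (RC n)" "y = k0_cls (RC n) Q" by (rule kerK0_C_E[OF y])
  have "k0_cls RD P = k0_cls RD Q" using eq cls_D[OF P(1)] cls_D[OF Q(1)] P(2) Q(2) by simp
  from eventually_equal[OF P(1) Q(1) this]
  show "\<exists>k\<ge>n. k0_map (\<lambda>x. x) (RC k) x = k0_map (\<lambda>x. x) (RC k) y"
    using cls_C[OF _ P(1)] cls_C[OF _ Q(1)] P(2) Q(2) by metis
next
  show "\<one>\<^bsub>kerK0 \<pi> (RC 0)\<^esub> \<in> carrier (kerK0 \<pi> (RC 0))"
    using ring_hom_ring.k0_map_one[OF hom_\<pi>_C] ring.zero_idems[OF ring_C]
    by (auto simp: kerK0_def ring.K0u_carrier[OF ring_C] ring.K0u_one[OF ring_C])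
next
  fix n m x assume nm: "n \<le> m" and "x \<in> carrier (kerK0 \<pi> (RC n))"
  then obtain P where P: "P \<in> idems (RC n) \<times> idems (RC n)" "x = k0_cls (RC n) P"
    "k0_cls \<Z> (map_idm2 \<pi> P) = \<one>\<^bsub>K0u \<Z>\<^esub>" by (elim kerK0_C_E)
  have Pm: "P \<in> idems (RC m) \<times> idems (RC m)" using P idems_C[OF nm] by auto
  show "k0_map (\<lambda>x. x) (RC m) x \<in> carrier (kerK0 \<pi> (RC m))"
    using kerK0_C_I[OF Pm P(3)] cls_C[OF nm P(1)] P(2) by simp
  show "k0_map (\<lambda>x. x) RD (k0_map (\<lambda>x. x) (RC m) x) = k0_map (\<lambda>x. x) RD x"
    unfolding P(2) cls_C[OF nm P(1)] cls_D[OF P(1)] cls_D[OF Pm] ..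
  fix k assume mk: "m \<le> k"
  show "k0_map (\<lambda>x. x) (RC k) (k0_map (\<lambda>x. x) (RC m) x) = k0_map (\<lambda>x. x) (RC k) x"
    unfolding P(2) cls_C[OF nm P(1)] cls_C[OF order.trans[OF nm mk] P(1)] cls_C[OF mk Pm] ..
next
  fix n x assume "x \<in> carrier (kerK0 \<pi> (RC n))"
  then obtain P where P: "P \<in> idems (RC n) \<times> idems (RC n)" "x = k0_cls (RC n) P"
    "k0_cls \<Z> (map_idm2 \<pi> P) = \<one>\<^bsub>K0u \<Z>\<^esub>" by (elim kerK0_C_E)
  have PD: "P \<in> idems RD \<times> idems RD" using P idems_D by auto
  show "k0_map (\<lambda>x. x) RD x \<in> carrier (kerK0 \<pi> RD)"
    using kerK0_D_I[OF PD P(3)] cls_D[OF P(1)] P(2) by simp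
next
  interpret D: ring RD by (rule ring_D)
  fix z assume "z \<in> carrier (kerK0 \<pi> RD)"
  then obtain P where P: "P \<in> idems RD \<times> idems RD" "z = k0_cls RD P"
    and ker: "k0_cls \<Z> (map_idm2 \<pi> P) = \<one>\<^bsub>K0u \<Z>\<^esub>"
    using cls_\<pi>_D by (auto simp: kerK0_def D.K0u_carrier)
  have I: "fst P \<in> idems RD" "snd P \<in> idems RD" using P by auto
  obtain k1 E where E: "E \<in> idems (RC k1)" "idm_equiv RD (fst P) E" using lift_idem[OF I(1)] .
  obtain k2 F where F: "F \<in> idems (RC k2)" "idm_equiv RD (snd P) F" using lift_idem[OF I(2)] .
  define k where "k = max k1 k2"
  have EF: "(E, F) \<in> idems (RC k) \<times> idems (RC k)"
    using E F idems_C[of k1 k] idems_C[of k2 k] by (auto simp: k_def)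
  have EFD: "(E, F) \<in> idems RD \<times> idems RD" using EF idems_D by auto
  have "k0_rel RD P (E, F)"
    using D.k0_rel_idm_equiv[OF I(1) _ I(2) _ E(2) F(2)] EFD by simp
  hence z: "z = k0_cls RD (E, F)" using D.k0_cls_eq_iff[OF P(1) EFD] P(2) by simp
  \<comment> \<open>The lifted pair represents the same class over \<open>RD\<close>, so its image
    over the integers is still trivial.\<close>
  have "k0_cls \<Z> (map_idm2 \<pi> (E, F)) = \<one>\<^bsub>K0u \<Z>\<^esub>"
    using ker cls_\<pi>_D[OF EFD] cls_\<pi>_D[OF P(1)] z P(2) by simp
  hence "k0_cls (RC k) (E, F) \<in> carrier (kerK0 \<pi> (RC k))" by (rule kerK0_C_I[OF EF])
  thus "\<exists>n. \<exists>x\<in>carrier (kerK0 \<pi> (RC n)). k0_map (\<lambda>x. x) RD x = z"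
    using cls_D[OF EF] z by metis
qed

end

section \<open>Unitization\<close>

definition unorm :: "('a \<Rightarrow> real) \<Rightarrow> int \<times> 'a \<Rightarrow> real" where
  "unorm N x = max (if fst x = 0 then 0 else 1) (N (snd x))"

lemma unorm_nonneg: "0 \<le> unorm N x"
  by (simp add: unorm_def le_max_iff_disj)

lemma unitz_simps [simp]:
  "carrier (unitz R H) = UNIV \<times> H" "\<one>\<^bsub>unitz R H\<^esub> = (1, \<zero>\<^bsub>R\<^esub>)" "\<zero>\<^bsub>unitz R H\<^esub> = (0, \<zero>\<^bsub>R\<^esub>)"
  "x \<oplus>\<^bsub>unitz R H\<^esub> y = (fst x + fst y, snd x \<oplus>\<^bsub>R\<^esub> snd y)"
  "x \<otimes>\<^bsub>unitz R H\<^esub> y = (fst x * fst y,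
     add_pow R (fst x) (snd y) \<oplus>\<^bsub>R\<^esub> add_pow R (fst y) (snd x) \<oplus>\<^bsub>R\<^esub> (snd x \<otimes>\<^bsub>R\<^esub> snd y))"
  by (simp_all add: unitz_def case_prod_unfold)

locale nonunital_subring = ring R for R (structure) + fixes H :: "'a set"
  assumes H_sub: "H \<subseteq> carrier R" and H_zero: "\<zero> \<in> H"
    and H_minus: "a \<in> H \<Longrightarrow> b \<in> H \<Longrightarrow> a \<ominus> b \<in> H" and H_mult: "a \<in> H \<Longrightarrow> b \<in> H \<Longrightarrow> a \<otimes> b \<in> H"
begin

lemma H_carrier: "a \<in> H \<Longrightarrow> a \<in> carrier R"
  using H_sub by auto

lemma H_uminus: "a \<in> H \<Longrightarrow> \<ominus> a \<in> H"
  using H_minus[OF H_zero, of a] H_carrier[of a] by (simp add: a_minus_def)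

lemma H_add: "a \<in> H \<Longrightarrow> b \<in> H \<Longrightarrow> a \<oplus> b \<in> H"
  using H_minus[of a "\<ominus> b"] H_uminus[of b] H_carrier by (simp add: a_minus_def)

lemma H_add_pow_nat: "a \<in> H \<Longrightarrow> add_pow R (k::nat) a \<in> H"
  by (induction k) (auto simp: H_zero H_add)

lemma H_add_pow: "a \<in> H \<Longrightarrow> add_pow R (k::int) a \<in> H"
  using H_add_pow_nat[of a "nat k"] H_uminus[OF H_add_pow_nat[of a "nat (-k)"]]
    add_pow_int_ge[of k R a] add_pow_int_lt[of k R a] by (cases "k \<ge> 0") auto

lemma ring_unitz: "ring (unitz R H)"
proof (rule ringI)
  show "abelian_group (unitz R H)"
  proof (rule abelian_groupI)
    fix x assume "x \<in> carrier (unitz R H)"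
    thus "\<exists>y\<in>carrier (unitz R H). y \<oplus>\<^bsub>unitz R H\<^esub> x = \<zero>\<^bsub>unitz R H\<^esub>"
      by (intro bexI[of _ "(- fst x, \<ominus> snd x)"]) (auto simp: H_uminus H_carrier l_neg)
  qed (auto simp: H_zero H_add H_carrier a_ac)
  show "monoid (unitz R H)"
  proof (rule monoidI)
    fix x y z assume "x \<in> carrier (unitz R H)" "y \<in> carrier (unitz R H)" "z \<in> carrier (unitz R H)"
    then obtain k a l b m c where xyz: "x = (k, a)" "y = (l, b)" "z = (m, c)" and H: "a \<in> H" "b \<in> H" "c \<in> H"
      by auto
    note car = H[THEN H_carrier]
    show "x \<otimes>\<^bsub>unitz R H\<^esub> y \<in> carrier (unitz R H)"
      using H by (simp add: xyz H_add H_mult H_add_pow)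
    show "x \<otimes>\<^bsub>unitz R H\<^esub> y \<otimes>\<^bsub>unitz R H\<^esub> z = x \<otimes>\<^bsub>unitz R H\<^esub> (y \<otimes>\<^bsub>unitz R H\<^esub> z)"
      using car by (simp add: xyz l_distr r_distr add_pow_ldistr_int add_pow_rdistr_int add.int_pow_distrib
        add.int_pow_pow m_assoc a_ac mult_ac)
  next
    show "\<one>\<^bsub>unitz R H\<^esub> \<in> carrier (unitz R H)" by (simp add: H_zero)
    fix x assume "x \<in> carrier (unitz R H)"
    then obtain k a where x: "x = (k, a)" "a \<in> H" by auto
    show "\<one>\<^bsub>unitz R H\<^esub> \<otimes>\<^bsub>unitz R H\<^esub> x = x" "x \<otimes>\<^bsub>unitz R H\<^esub> \<one>\<^bsub>unitz R H\<^esub> = x"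
      using H_carrier[OF x(2)] by (simp_all add: x)
  qed
next
  fix x y z assume "x \<in> carrier (unitz R H)" "y \<in> carrier (unitz R H)" "z \<in> carrier (unitz R H)"
  then obtain k a l b m c where xyz: "x = (k, a)" "y = (l, b)" "z = (m, c)" and H: "a \<in> H" "b \<in> H" "c \<in> H"
    by auto
  note car = H[THEN H_carrier]
  show "(x \<oplus>\<^bsub>unitz R H\<^esub> y) \<otimes>\<^bsub>unitz R H\<^esub> z = x \<otimes>\<^bsub>unitz R H\<^esub> z \<oplus>\<^bsub>unitz R H\<^esub> y \<otimes>\<^bsub>unitz R H\<^esub> z"
    using car by (simp add: xyz l_distr add.int_pow_distrib add.int_pow_mult a_ac distrib_right)
  show "z \<otimes>\<^bsub>unitz R H\<^esub> (x \<oplus>\<^bsub>unitz R H\<^esub> y) = z \<otimes>\<^bsub>unitz R H\<^esub> x \<oplus>\<^bsub>unitz R H\<^esub> z \<otimes>\<^bsub>unitz R H\<^esub> y"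
    using car by (simp add: xyz r_distr add.int_pow_distrib add.int_pow_mult a_ac distrib_left)
qed

lemma unitz_minus:
  assumes "x \<in> carrier (unitz R H)" "y \<in> carrier (unitz R H)"
  shows "x \<ominus>\<^bsub>unitz R H\<^esub> y = (fst x - fst y, snd x \<ominus> snd y)"
proof -
  interpret U: ring "unitz R H" by (rule ring_unitz)
  have "\<ominus>\<^bsub>unitz R H\<^esub> y = (- fst y, \<ominus> snd y)"
    using assms by (intro U.minus_equality) (auto simp: H_uminus H_carrier l_neg)
  thus ?thesis by (simp add: a_minus_def)
qed

lemma ring_hom_fst_unitz: "ring_hom_ring (unitz R H) \<Z> fst"
  by (rule ring_hom_ringI[OF ring_unitz]) (auto intro: cring.axioms int_is_cring)

end

locale closed_nonunital_subring = ultrametric_ring R N + nonunital_subring R H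
  for R (structure) and N H +
  assumes H_closed: "(\<And>n. s n \<in> H) \<Longrightarrow> l \<in> carrier R \<Longrightarrow> (\<lambda>n. N (l \<ominus> s n)) \<longlonglongrightarrow> 0 \<Longrightarrow> l \<in> H"
begin

text \<open>An integer multiple is a repeated sum or the negative of one, and ultrametric sums do
  not grow. This makes the action of the integers compatible with their trivial absolute
  value.\<close>

lemma N_add_pow: assumes a: "a \<in> carrier R" shows "N (add_pow R (k::int) a) \<le> N a"
proof -
  have nat: "N (add_pow R n a) \<le> N a" for n :: nat
    using a by (induction n) (auto simp: N_zero N_nonneg intro!: N_add_le)
  show ?thesis
    using nat[of "nat k"] nat[of "nat (-k)"] add_pow_int_ge[of k R a] add_pow_int_lt[of k R a] a
    by (cases "k \<ge> 0") (auto simp: N_uminus)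
qed

text \<open>In a product, a nonzero integral part makes \<open>unorm\<close> at least 1, which pays
  for the integer multiple of the other component; a zero one makes that multiple vanish. For
  completeness, the integral parts of a sequence with null differences are eventually constant,
  while the second components converge in \<open>R\<close>, and closedness keeps their limit in
  \<open>H\<close>.\<close>

lemma ultrametric_unitz: "ultrametric_ring (unitz R H) (unorm N)"
proof (intro ultrametric_ring.intro ultrametric_ring_axioms.intro)
  show "ring (unitz R H)" by (rule ring_unitz)
  show "unorm N \<zero>\<^bsub>unitz R H\<^esub> = 0" "unorm N \<one>\<^bsub>unitz R H\<^esub> \<le> 1"
    by (simp_all add: unorm_def N_zero)
  show "0 \<le> unorm N x" for x by (rule unorm_nonneg)
next
  fix x assume "x \<in> carrier (unitz R H)" "unorm N x = 0"
  thus "x = \<zero>\<^bsub>unitz R H\<^esub>"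
  proof -
    obtain k a where x: "x = (k, a)" "a \<in> H" using \<open>x \<in> carrier (unitz R H)\<close> by auto
    have le: "(if k = 0 then 0 else 1) \<le> (0::real)" "N a \<le> 0"
      using \<open>unorm N x = 0\<close> unfolding unorm_def x by (metis fst_conv max.cobounded1, metis snd_conv max.cobounded2)
    have "a = \<zero>" using le(2) N_nonneg[of a] N_eq_0[of a] H_carrier[OF x(2)] by simp
    moreover have "k = 0" using le(1) by (simp split: if_splits)
    ultimately show ?thesis by (simp add: x)
  qed
next
  fix x y assume xy: "x \<in> carrier (unitz R H)" "y \<in> carrier (unitz R H)"
  then obtain k a l b where [simp]: "x = (k, a)" "y = (l, b)" and H: "a \<in> H" "b \<in> H" by auto
  note car = H[THEN H_carrier]
  show "unorm N (x \<ominus>\<^bsub>unitz R H\<^esub> y) \<le> max (unorm N x) (unorm N y)"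
    unfolding unitz_minus[OF xy] using N_minus[OF car] by (auto simp: unorm_def)
  have nn: "0 \<le> N a" "0 \<le> N b" using car N_nonneg by auto
  have pos: "0 \<le> unorm N x * unorm N y" by (intro mult_nonneg_nonneg unorm_nonneg)
  have pow0: "add_pow R (0::int) c = \<zero>" for c by (simp add: add_pow_def)
  have "N (a \<otimes> b) \<le> unorm N x * unorm N y"
    using car nn by (intro order.trans[OF N_mult] mult_mono) (auto simp: unorm_def)
  moreover have "N (add_pow R k b) \<le> unorm N x * unorm N y"
  proof (cases "k = 0")
    case False
    have "N (add_pow R k b) \<le> 1 * N b" using N_add_pow[OF car(2)] by simp
    also have "\<dots> \<le> unorm N x * unorm N y" using False nn by (intro mult_mono) (auto simp: unorm_def)
    finally show ?thesis .
  qed (use pos in \<open>simp add: N_zero pow0\<close>)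
  moreover have "N (add_pow R l a) \<le> unorm N x * unorm N y"
  proof (cases "l = 0")
    case False
    have "N (add_pow R l a) \<le> N a * 1" using N_add_pow[OF car(1)] by simp
    also have "\<dots> \<le> unorm N x * unorm N y" using False nn by (intro mult_mono) (auto simp: unorm_def)
    finally show ?thesis .
  qed (use pos in \<open>simp add: N_zero pow0\<close>)
  ultimately have "N (snd (x \<otimes>\<^bsub>unitz R H\<^esub> y)) \<le> unorm N x * unorm N y"
    using car by (auto intro!: N_add_le)
  moreover have "(if fst (x \<otimes>\<^bsub>unitz R H\<^esub> y) = 0 then 0 else 1) \<le> unorm N x * unorm N y"
  proof (cases "k = 0 \<or> l = 0")
    case False
    have "1 * 1 \<le> unorm N x * unorm N y" using False by (intro mult_mono) (auto simp: unorm_def)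
    thus ?thesis using False by simp
  qed (use pos in auto)
  ultimately show "unorm N (x \<otimes>\<^bsub>unitz R H\<^esub> y) \<le> unorm N x * unorm N y"
    unfolding unorm_def[of N "x \<otimes>\<^bsub>unitz R H\<^esub> y"] by (intro max.boundedI)
next
  fix s :: "nat \<Rightarrow> int \<times> 'a"
  assume s: "\<And>n. s n \<in> carrier (unitz R H)"
    and lim: "(\<lambda>n. unorm N (s (Suc n) \<ominus>\<^bsub>unitz R H\<^esub> s n)) \<longlonglongrightarrow> 0"
  define k where "k n = fst (s n)" for n
  define a where "a n = snd (s n)" for n
  have aH: "a n \<in> H" for n using s[of n] by (auto simp: a_def)
  note ac = aH[THEN H_carrier]
  have d: "unorm N (s (Suc n) \<ominus>\<^bsub>unitz R H\<^esub> s n) = max (if k (Suc n) = k n then 0 else 1) (N (a (Suc n) \<ominus> a n))" for n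
    unfolding unitz_minus[OF s s] by (simp add: unorm_def k_def a_def)
  have "(\<lambda>n. N (a (Suc n) \<ominus> a n)) \<longlonglongrightarrow> 0"
    by (rule tendsto_0_squeeze[OF _ _ lim]) (use ac in \<open>auto simp: d N_nonneg\<close>)
  then obtain l where l: "l \<in> carrier R" "(\<lambda>n. N (l \<ominus> a n)) \<longlonglongrightarrow> 0"
    using complete[of a] ac by blast
  have lH: "l \<in> H" using H_closed[OF aH l] .
  obtain n0 where n0: "\<And>n. n \<ge> n0 \<Longrightarrow> unorm N (s (Suc n) \<ominus>\<^bsub>unitz R H\<^esub> s n) < 1"
    using LIMSEQ_D[OF lim, of 1] by (force simp: abs_less_iff)
  have k_const: "k n = k n0" if "n \<ge> n0" for n
    using that
  proof (induction n rule: dec_induct)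
    case (step m)
    have "k (Suc m) = k m" using n0[OF step(1)] by (auto simp: d split: if_splits)
    thus ?case using step by simp
  qed simp
  have "eventually (\<lambda>n. unorm N ((k n0, l) \<ominus>\<^bsub>unitz R H\<^esub> s n) = N (l \<ominus> a n)) sequentially"
    unfolding eventually_sequentially
  proof (intro exI[of _ n0] allI impI)
    fix n assume n: "n \<ge> n0"
    have "(k n0, l) \<ominus>\<^bsub>unitz R H\<^esub> s n = (k n0 - k n, l \<ominus> a n)"
      by (subst unitz_minus) (use lH s in \<open>auto simp: k_def a_def\<close>)
    thus "unorm N ((k n0, l) \<ominus>\<^bsub>unitz R H\<^esub> s n) = N (l \<ominus> a n)"
      using k_const[OF n] N_nonneg[of "l \<ominus> a n"] l(1) ac by (simp add: unorm_def)
  qed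
  hence "(\<lambda>n. unorm N ((k n0, l) \<ominus>\<^bsub>unitz R H\<^esub> s n)) \<longlonglongrightarrow> 0"
    using l(2) by (simp add: filterlim_cong)
  thus "\<exists>l\<in>carrier (unitz R H). (\<lambda>n. unorm N (l \<ominus>\<^bsub>unitz R H\<^esub> s n)) \<longlonglongrightarrow> 0"
    using lH by (intro bexI[of _ "(k n0, l)"]) auto
qed

end

section \<open>The field of p-adic numbers\<close>

definition Qp_ring :: "nat \<Rightarrow> qp ring" where
  "Qp_ring p = \<lparr>carrier = Qp p, monoid.mult = qp_mul p, monoid.one = qp_class p (\<lambda>_. 1),
     ring.zero = qp_zero p, ring.add = qp_add p\<rparr>"

lemma Qp_ring_simps [simp]:
  "carrier (Qp_ring p) = Qp p" "monoid.mult (Qp_ring p) = qp_mul p" "monoid.one (Qp_ring p) = qp_class p (\<lambda>_. 1)"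
  "ring.zero (Qp_ring p) = qp_zero p" "ring.add (Qp_ring p) = qp_add p"
  by (simp_all add: Qp_ring_def)

locale padic =
  fixes p :: nat
  assumes prime: "Factorial_Ring.prime p"
begin

section \<open>The p-adic absolute value on the rationals\<close>

lemma prime_int: "Factorial_Ring.prime (int p)"
  using prime by simp

lemma p_gt_1: "1 < real p"
  using prime_gt_1_nat[OF prime] by simp

lemma rat_pabs_zero [simp]: "rat_pabs p 0 = 0"
  by (simp add: rat_pabs_def)

text \<open>\<open>rat_pval\<close> refers to lowest terms; cross-multiplication and additivity of
  the multiplicity remove this restriction, so that fractions may be written with a convenient
  denominator.\<close>

lemma rat_pabs_frac:
  assumes "a \<noteq> 0" "b \<noteq> 0"
  shows "rat_pabs p (of_int a / of_int b) =
    real p powr (real (multiplicity (int p) b) - real (multiplicity (int p) a))"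
proof -
  let ?m = "multiplicity (int p)"
  obtain c d where q: "quotient_of (of_int a / of_int b) = (c, d)" by fastforce
  have d: "d > 0" using quotient_of_denom_pos[OF q] .
  have eq: "(of_int a / of_int b :: rat) = of_int c / of_int d" using quotient_of_div[OF q] .
  have "c \<noteq> 0" using eq assms d by auto
  have "(of_int (a * d) :: rat) = of_int (c * b)" using eq assms d by (simp add: field_simps)
  hence "a * d = c * b" by (simp only: of_int_eq_iff)
  moreover have "?m (a * d) = ?m a + ?m d" "?m (c * b) = ?m c + ?m b"
    using assms d \<open>c \<noteq> 0\<close> prime_int by (auto intro!: prime_elem_multiplicity_mult_distrib)
  ultimately have "?m a + ?m d = ?m c + ?m b" by simp
  hence "real (?m d) - real (?m c) = real (?m b) - real (?m a)" by linarith
  thus ?thesis using assms by (simp add: rat_pabs_def rat_pval_def q)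
qed

lemma rat_frac: fixes q :: rat obtains a b :: int where "q = of_int a / of_int b" "b \<noteq> 0"
  using quotient_of_div[of q] quotient_of_denom_pos[of q] by (cases "quotient_of q") fastforce

lemma rat_common_denominator:
  fixes q r :: rat
  obtains a c d :: int where "q = of_int a / of_int d" "r = of_int c / of_int d" "d \<noteq> 0"
proof -
  obtain a b where q: "q = of_int a / of_int b" "b \<noteq> 0" by (rule rat_frac)
  obtain c d where r: "r = of_int c / of_int d" "d \<noteq> 0" by (rule rat_frac)
  show ?thesis by (rule that[of "a * d" "b * d" "c * b"]) (use q r in \<open>auto simp: field_simps\<close>)
qed

lemma rat_pabs_nonneg: "0 \<le> rat_pabs p q"
  by (simp add: rat_pabs_def)

lemma rat_pabs_eq_0_iff: "rat_pabs p q = 0 \<longleftrightarrow> q = 0"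
  using p_gt_1 by (simp add: rat_pabs_def)

lemma rat_pabs_mult: "rat_pabs p (q * r) = rat_pabs p q * rat_pabs p r"
proof (cases "q = 0 \<or> r = 0")
  case False
  obtain a b where q: "q = of_int a / of_int b" "b \<noteq> 0" by (rule rat_frac)
  obtain c d where r: "r = of_int c / of_int d" "d \<noteq> 0" by (rule rat_frac)
  have nz: "a \<noteq> 0" "c \<noteq> 0" using False q r by auto
  have m: "multiplicity (int p) (x * y) = multiplicity (int p) x + multiplicity (int p) y"
    if "x \<noteq> 0" "y \<noteq> 0" for x y using that prime_int by (auto intro!: prime_elem_multiplicity_mult_distrib)
  have "q * r = of_int (a * c) / of_int (b * d)" by (simp add: q r)
  hence "rat_pabs p (q * r) = real p powr (real (multiplicity (int p) (b * d)) - real (multiplicity (int p) (a * c)))"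
    using nz q r by (simp only: rat_pabs_frac mult_eq_0_iff simp_thms)
  also have "\<dots> = rat_pabs p q * rat_pabs p r"
    unfolding q(1) r(1) using nz q(2) r(2) by (simp add: rat_pabs_frac m powr_add[symmetric] algebra_simps)
  finally show ?thesis .
qed auto

lemma rat_pabs_one [simp]: "rat_pabs p 1 = 1"
  using rat_pabs_mult[of 1 1] rat_pabs_eq_0_iff[of 1] by simp

lemma rat_pabs_minus [simp]: "rat_pabs p (- q) = rat_pabs p q"
proof -
  have "rat_pabs p (- 1) * rat_pabs p (- 1) = 1" using rat_pabs_mult[of "- 1" "- 1"] by simp
  hence "rat_pabs p (- 1) = 1" using rat_pabs_nonneg[of "- 1"] by (metis abs_of_nonneg abs_square_eq_1 power2_eq_square)
  thus ?thesis using rat_pabs_mult[of "- 1" q] by simp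
qed

text \<open>Over a common denominator only the numerators matter, and the smaller of their powers of
  \<open>p\<close> divides the sum. The cases involving 0 are separate because its absolute value is
  not given by an exponent.\<close>

lemma rat_pabs_add: "rat_pabs p (q + r) \<le> max (rat_pabs p q) (rat_pabs p r)"
proof (cases "q = 0 \<or> r = 0 \<or> q + r = 0")
  case False
  obtain a c d where qr: "q = of_int a / of_int d" "r = of_int c / of_int d" "d \<noteq> 0"
    by (rule rat_common_denominator)
  have s: "q + r = of_int (a + c) / of_int d" by (simp add: qr add_divide_distrib)
  have nz: "a \<noteq> 0" "c \<noteq> 0" "a + c \<noteq> 0" using False s by (auto simp: qr)
  define k where "k = min (multiplicity (int p) a) (multiplicity (int p) c)"
  have "int p ^ k dvd a + c" by (intro dvd_add multiplicity_dvd') (auto simp: k_def)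
  hence k: "k \<le> multiplicity (int p) (a + c)"
    using nz prime_int by (intro multiplicity_geI) auto
  show ?thesis unfolding s rat_pabs_frac[OF nz(3) qr(3)] unfolding qr rat_pabs_frac[OF nz(1) qr(3)] rat_pabs_frac[OF nz(2) qr(3)]
    using k p_gt_1 by (auto simp: k_def le_max_iff_disj min_def split: if_splits)
qed (auto simp: rat_pabs_nonneg le_max_iff_disj)

lemma rat_pabs_diff: "rat_pabs p (q - r) \<le> max (rat_pabs p q) (rat_pabs p r)"
  using rat_pabs_add[of q "- r"] by simp

lemma rat_pabs_p: "rat_pabs p (of_nat p) = 1 / real p"
proof -
  have "rat_pabs p (of_int (int p) / of_int 1) = real p powr (0 - 1)"
    using p_gt_1 prime_int by (subst rat_pabs_frac) (auto simp: multiplicity_self)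
  thus ?thesis using p_gt_1 by (simp add: powr_minus field_simps)
qed

text \<open>This value set is discrete away from 0. Suprema therefore stay in it, and a nonzero norm
  is the absolute value of a scalar by which one can rescale.\<close>

definition pvals :: "real set" where "pvals = insert 0 (range (\<lambda>k::int. real p powr real_of_int k))"

lemma rat_pabs_in_pvals: "rat_pabs p q \<in> pvals"
  by (simp add: rat_pabs_def pvals_def del: of_int_minus) (metis of_int_minus rangeI)

lemma rat_pabs_abs_diff: "\<bar>rat_pabs p q - rat_pabs p r\<bar> \<le> rat_pabs p (q - r)"
  using rat_pabs_add[of "q - r" r] rat_pabs_add[of "r - q" q] rat_pabs_minus[of "q - r"]
    rat_pabs_nonneg[of "q - r"] rat_pabs_nonneg[of q] rat_pabs_nonneg[of r] by auto

text \<open>Ultrametric triangles are isosceles; applied to a Cauchy sequence that does not tend to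
  0, this makes the absolute values of its terms eventually constant.\<close>

lemma rat_pabs_isosceles: "rat_pabs p (q - r) < rat_pabs p q \<Longrightarrow> rat_pabs p q = rat_pabs p r"
  using rat_pabs_add[of "q - r" r] rat_pabs_diff[of q "q - r"] by auto

section \<open>Cauchy sequences of rationals and their classes\<close>

lemma qcauchy_const: "qcauchy p (\<lambda>_. q)"
  by (simp add: qcauchy_def)

lemma qcauchyD: "qcauchy p s \<Longrightarrow> e > 0 \<Longrightarrow> \<exists>N. \<forall>m\<ge>N. \<forall>n\<ge>N. rat_pabs p (s m - s n) < e"
  by (simp add: qcauchy_def)

lemma qcauchy_bounded: assumes "qcauchy p s" obtains C where "C > 0" "\<And>n. rat_pabs p (s n) \<le> C"
proof -
  obtain M where M: "\<And>m n. m \<ge> M \<Longrightarrow> n \<ge> M \<Longrightarrow> rat_pabs p (s m - s n) < 1"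
    using qcauchyD[OF assms, of 1] by auto
  define C where "C = 1 + (\<Sum>n\<le>M. rat_pabs p (s n))"
  have le: "rat_pabs p (s n) \<le> (\<Sum>n\<le>M. rat_pabs p (s n))" if "n \<le> M" for n
    using that by (intro member_le_sum) (auto simp: rat_pabs_nonneg)
  have "rat_pabs p (s n) \<le> C" for n
  proof (cases "n \<le> M")
    case False
    have "rat_pabs p (s n) \<le> max (rat_pabs p (s n - s M)) (rat_pabs p (s M))"
      using rat_pabs_add[of "s n - s M" "s M"] by simp
    thus ?thesis using M[of n M] False le[of M] rat_pabs_nonneg[of "s M"] by (auto simp: C_def)
  qed (use le in \<open>force simp: C_def\<close>)
  moreover have "C > 0" unfolding C_def by (intro add_pos_nonneg sum_nonneg) (auto simp: rat_pabs_nonneg)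
  ultimately show ?thesis using that by blast
qed

text \<open>One criterion serves both operations: sums with constant 1, products with a common bound
  of the two factors as constant.\<close>

lemma qcauchyI2:
  assumes s: "qcauchy p s" and t: "qcauchy p t" and "C > 0"
    and le: "\<And>m n. rat_pabs p (u m - u n) \<le> C * max (rat_pabs p (s m - s n)) (rat_pabs p (t m - t n))"
  shows "qcauchy p u"
  unfolding qcauchy_def
proof (intro allI impI)
  fix e :: real assume "e > 0"
  hence "e / C > 0" using \<open>C > 0\<close> by simp
  then obtain M1 M2 where "\<forall>m\<ge>M1. \<forall>n\<ge>M1. rat_pabs p (s m - s n) < e / C"
    "\<forall>m\<ge>M2. \<forall>n\<ge>M2. rat_pabs p (t m - t n) < e / C"
    using qcauchyD[OF s] qcauchyD[OF t] by meson
  hence "max (rat_pabs p (s m - s n)) (rat_pabs p (t m - t n)) < e / C" if "m \<ge> max M1 M2" "n \<ge> max M1 M2" for m n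
    using that by auto
  hence "rat_pabs p (u m - u n) < e" if "m \<ge> max M1 M2" "n \<ge> max M1 M2" for m n
    using that le[of m n] \<open>C > 0\<close> by (metis pos_less_divide_eq mult.commute order_le_less_trans)
  thus "\<exists>N. \<forall>m\<ge>N. \<forall>n\<ge>N. rat_pabs p (u m - u n) < e" by blast
qed

lemma qcauchy_add: "qcauchy p s \<Longrightarrow> qcauchy p t \<Longrightarrow> qcauchy p (\<lambda>n. s n + t n)"
proof (erule qcauchyI2[of _ _ 1])
  show "rat_pabs p (s m + t m - (s n + t n)) \<le> 1 * max (rat_pabs p (s m - s n)) (rat_pabs p (t m - t n))" for m n
    using rat_pabs_add[of "s m - s n" "t m - t n"] by (simp add: algebra_simps)
qed auto

lemma qcauchy_minus: "qcauchy p s \<Longrightarrow> qcauchy p (\<lambda>n. - s n)"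
  using rat_pabs_minus[of "s _ - s _"] by (simp add: qcauchy_def)

lemma qcauchy_mult:
  assumes s: "qcauchy p s" and t: "qcauchy p t" shows "qcauchy p (\<lambda>n. s n * t n)"
proof -
  obtain C D where C: "C > 0" "\<And>n. rat_pabs p (s n) \<le> C" and D: "D > 0" "\<And>n. rat_pabs p (t n) \<le> D"
    using qcauchy_bounded[OF s] qcauchy_bounded[OF t] by metis
  show ?thesis
  proof (rule qcauchyI2[OF s t])
    show "max C D > 0" using C by simp
    fix m n
    let ?M = "max C D * max (rat_pabs p (s m - s n)) (rat_pabs p (t m - t n))"
    have "s m * t m - s n * t n = (s m - s n) * t m + s n * (t m - t n)" by (simp add: algebra_simps)
    hence "rat_pabs p (s m * t m - s n * t n) \<le> max (rat_pabs p ((s m - s n) * t m)) (rat_pabs p (s n * (t m - t n)))"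
      using rat_pabs_add by simp
    moreover have "rat_pabs p ((s m - s n) * t m) \<le> ?M" unfolding rat_pabs_mult mult.commute[of "rat_pabs p (s m - s n)"]
      using C D rat_pabs_nonneg by (intro mult_mono) (auto simp: le_max_iff_disj)
    moreover have "rat_pabs p (s n * (t m - t n)) \<le> ?M" unfolding rat_pabs_mult
      using C D rat_pabs_nonneg by (intro mult_mono) (auto simp: le_max_iff_disj)
    ultimately show "rat_pabs p (s m * t m - s n * t n) \<le> ?M" by simp
  qed
qed

lemma qequiv_refl: "qequiv p s s"
  by (simp add: qequiv_def)

lemma qequiv_sym: "qequiv p s t \<Longrightarrow> qequiv p t s"
  unfolding qequiv_def using rat_pabs_minus[of "s _ - t _"] by (metis (no_types, lifting) ext minus_diff_eq rat_pabs_minus)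

lemma qequiv_squeeze2:
  assumes "qequiv p s s'" "qequiv p t t'"
    and "\<And>n. rat_pabs p (u n - u' n) \<le> C * max (rat_pabs p (s n - s' n)) (rat_pabs p (t n - t' n))"
  shows "qequiv p u u'"
proof -
  have "(\<lambda>n. C * max (rat_pabs p (s n - s' n)) (rat_pabs p (t n - t' n))) \<longlonglongrightarrow> C * max 0 0"
    using assms(1,2) unfolding qequiv_def by (intro tendsto_mult_left tendsto_max)
  hence "(\<lambda>n. C * max (rat_pabs p (s n - s' n)) (rat_pabs p (t n - t' n))) \<longlonglongrightarrow> 0" by simp
  thus ?thesis unfolding qequiv_def by (rule tendsto_0_squeeze[OF rat_pabs_nonneg assms(3)])
qed

lemma qequiv_trans: "qequiv p s t \<Longrightarrow> qequiv p t u \<Longrightarrow> qequiv p s u"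
proof (erule qequiv_squeeze2[of _ _ _ _ _ _ 1])
  show "rat_pabs p (s n - u n) \<le> 1 * max (rat_pabs p (s n - t n)) (rat_pabs p (t n - u n))" for n
    using rat_pabs_add[of "s n - t n" "t n - u n"] by simp
qed auto

lemma qequiv_add: "qequiv p s s' \<Longrightarrow> qequiv p t t' \<Longrightarrow> qequiv p (\<lambda>n. s n + t n) (\<lambda>n. s' n + t' n)"
proof (erule qequiv_squeeze2[of _ _ _ _ _ _ 1])
  show "rat_pabs p (s n + t n - (s' n + t' n)) \<le> 1 * max (rat_pabs p (s n - s' n)) (rat_pabs p (t n - t' n))" for n
    using rat_pabs_add[of "s n - s' n" "t n - t' n"] by (simp add: algebra_simps)
qed auto

lemma qequiv_minus: "qequiv p s t \<Longrightarrow> qequiv p (\<lambda>n. - s n) (\<lambda>n. - t n)"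
  unfolding qequiv_def using rat_pabs_minus[of "s _ - t _"] by (simp add: minus_diff_commute)

lemma qequiv_mult:
  assumes "qcauchy p s" "qcauchy p t'" "qequiv p s s'" "qequiv p t t'"
  shows "qequiv p (\<lambda>n. s n * t n) (\<lambda>n. s' n * t' n)"
proof -
  obtain C D where C: "C > 0" "\<And>n. rat_pabs p (s n) \<le> C" and D: "D > 0" "\<And>n. rat_pabs p (t' n) \<le> D"
    using qcauchy_bounded[OF assms(1)] qcauchy_bounded[OF assms(2)] by metis
  show ?thesis
  proof (rule qequiv_squeeze2[OF assms(3,4)])
    fix n
    let ?M = "max C D * max (rat_pabs p (s n - s' n)) (rat_pabs p (t n - t' n))"
    have "s n * t n - s' n * t' n = s n * (t n - t' n) + (s n - s' n) * t' n" by (simp add: algebra_simps)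
    hence "rat_pabs p (s n * t n - s' n * t' n) \<le> max (rat_pabs p (s n * (t n - t' n))) (rat_pabs p ((s n - s' n) * t' n))"
      using rat_pabs_add by simp
    moreover have "rat_pabs p ((s n - s' n) * t' n) \<le> ?M" unfolding rat_pabs_mult mult.commute[of "rat_pabs p (s n - s' n)"]
      using C D rat_pabs_nonneg by (intro mult_mono) (auto simp: le_max_iff_disj)
    moreover have "rat_pabs p (s n * (t n - t' n)) \<le> ?M" unfolding rat_pabs_mult
      using C D rat_pabs_nonneg by (intro mult_mono) (auto simp: le_max_iff_disj)
    ultimately show "rat_pabs p (s n * t n - s' n * t' n) \<le> ?M" by simp
  qed
qed

lemma qp_class_eq_iff:
  assumes "qcauchy p s" "qcauchy p t" shows "qp_class p s = qp_class p t \<longleftrightarrow> qequiv p s t"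
proof
  assume "qp_class p s = qp_class p t"
  moreover have "t \<in> qp_class p t" using assms qequiv_refl by (simp add: qp_class_def)
  ultimately have "t \<in> qp_class p s" by simp
  thus "qequiv p s t" by (simp add: qp_class_def)
next
  assume "qequiv p s t"
  thus "qp_class p s = qp_class p t"
    unfolding qp_class_def using qequiv_trans qequiv_sym by blast
qed

lemma qp_rep_class:
  assumes "qcauchy p s" shows "qcauchy p (qp_rep (qp_class p s))" "qequiv p s (qp_rep (qp_class p s))"
proof -
  have "s \<in> qp_class p s" using assms qequiv_refl by (simp add: qp_class_def)
  hence "qp_rep (qp_class p s) \<in> qp_class p s" unfolding qp_rep_def by (rule someI[of "\<lambda>t. t \<in> qp_class p s"])
  thus "qcauchy p (qp_rep (qp_class p s))" "qequiv p s (qp_rep (qp_class p s))" by (auto simp: qp_class_def)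
qed

lemma Qp_class: "qcauchy p s \<Longrightarrow> qp_class p s \<in> Qp p"
  by (auto simp: Qp_def)

lemma Qp_iff: "x \<in> Qp p \<longleftrightarrow> (\<exists>s. qcauchy p s \<and> x = qp_class p s)"
  by (auto simp: Qp_def)

lemma QpE: assumes "x \<in> Qp p" obtains s where "qcauchy p s" "x = qp_class p s"
  using assms by (auto simp: Qp_def)

lemma qp_add_class:
  assumes s: "qcauchy p s" and t: "qcauchy p t"
  shows "qp_add p (qp_class p s) (qp_class p t) = qp_class p (\<lambda>n. s n + t n)"
  unfolding qp_add_def
  by (subst qp_class_eq_iff) (intro qcauchy_add qequiv_add qp_rep_class[OF s] qp_rep_class[OF t]
    qequiv_sym[OF qp_rep_class(2)[OF s]] qequiv_sym[OF qp_rep_class(2)[OF t]] s t)+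

lemma qp_mul_class:
  assumes s: "qcauchy p s" and t: "qcauchy p t"
  shows "qp_mul p (qp_class p s) (qp_class p t) = qp_class p (\<lambda>n. s n * t n)"
  unfolding qp_mul_def
  by (subst qp_class_eq_iff) (intro qcauchy_mult qequiv_mult qp_rep_class[OF s] qp_rep_class[OF t]
    qequiv_sym[OF qp_rep_class(2)[OF s]] qequiv_sym[OF qp_rep_class(2)[OF t]] s t)+

lemma qp_sub_class:
  assumes s: "qcauchy p s" and t: "qcauchy p t"
  shows "qp_sub p (qp_class p s) (qp_class p t) = qp_class p (\<lambda>n. s n - t n)"
  unfolding qp_sub_def diff_conv_add_uminus
  by (subst qp_class_eq_iff) (intro qcauchy_add qcauchy_minus qequiv_add qequiv_minus
    qp_rep_class[OF s] qp_rep_class[OF t]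
    qequiv_sym[OF qp_rep_class(2)[OF s]] qequiv_sym[OF qp_rep_class(2)[OF t]] s t)+

text \<open>\<open>qp_abs\<close> takes \<open>lim\<close> along a chosen representative. The
  reverse triangle inequality shows that this limit exists and that equivalent sequences share it,
  so every representative computes it.\<close>

lemma rat_pabs_lim:
  assumes s: "qcauchy p s" shows "(\<lambda>n. rat_pabs p (s n)) \<longlonglongrightarrow> qp_abs p (qp_class p s)"
proof -
  let ?r = "qp_rep (qp_class p s)"
  have r: "qcauchy p ?r" "qequiv p s ?r" using qp_rep_class[OF s] by auto
  have "Cauchy (\<lambda>n. rat_pabs p (?r n))"
  proof (rule metric_CauchyI)
    fix e :: real assume "e > 0"
    then obtain M where "\<forall>m\<ge>M. \<forall>n\<ge>M. rat_pabs p (?r m - ?r n) < e" using qcauchyD[OF r(1)] by blast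
    thus "\<exists>M. \<forall>m\<ge>M. \<forall>n\<ge>M. dist (rat_pabs p (?r m)) (rat_pabs p (?r n)) < e"
      unfolding dist_real_def using rat_pabs_abs_diff by (meson order_le_less_trans)
  qed
  hence "(\<lambda>n. rat_pabs p (?r n)) \<longlonglongrightarrow> qp_abs p (qp_class p s)"
    unfolding qp_abs_def using Cauchy_convergent convergent_LIMSEQ_iff by blast
  moreover have "(\<lambda>n. rat_pabs p (s n) - rat_pabs p (?r n)) \<longlonglongrightarrow> 0"
    by (rule tendsto_rabs_zero_cancel, rule tendsto_0_squeeze[where g = "\<lambda>n. rat_pabs p (s n - ?r n)"])
       (use r(2) rat_pabs_abs_diff in \<open>auto simp: qequiv_def\<close>)
  ultimately have "(\<lambda>n. (rat_pabs p (s n) - rat_pabs p (?r n)) + rat_pabs p (?r n)) \<longlonglongrightarrow> 0 + qp_abs p (qp_class p s)"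
    by (intro tendsto_add)
  thus ?thesis by simp
qed

lemma qp_abs_const: "qp_abs p (qp_class p (\<lambda>_. q)) = rat_pabs p q"
  using rat_pabs_lim[OF qcauchy_const[of q]] by (simp add: LIMSEQ_const_iff)

lemma qp_abs_nonneg: "x \<in> Qp p \<Longrightarrow> 0 \<le> qp_abs p x"
proof (erule QpE)
  fix s assume s: "qcauchy p s" "x = qp_class p s"
  show "0 \<le> qp_abs p x" unfolding s(2)
    by (rule LIMSEQ_le_const[OF rat_pabs_lim[OF s(1)]]) (simp add: rat_pabs_nonneg)
qed

lemma qp_abs_mul: assumes "x \<in> Qp p" "y \<in> Qp p" shows "qp_abs p (qp_mul p x y) = qp_abs p x * qp_abs p y"
proof -
  obtain s t where st: "qcauchy p s" "x = qp_class p s" "qcauchy p t" "y = qp_class p t"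
    using assms unfolding Qp_iff by blast
  have 1: "(\<lambda>n. rat_pabs p (s n) * rat_pabs p (t n)) \<longlonglongrightarrow> qp_abs p x * qp_abs p y"
    unfolding st(2,4) by (rule tendsto_mult[OF rat_pabs_lim[OF st(1)] rat_pabs_lim[OF st(3)]])
  have 2: "(\<lambda>n. rat_pabs p (s n) * rat_pabs p (t n)) \<longlonglongrightarrow> qp_abs p (qp_mul p x y)"
    unfolding st(2,4) qp_mul_class[OF st(1,3)] rat_pabs_mult[symmetric]
    by (rule rat_pabs_lim[OF qcauchy_mult[OF st(1,3)]])
  show ?thesis by (rule LIMSEQ_unique[OF 2 1])
qed

lemma qp_abs_sub: assumes "x \<in> Qp p" "y \<in> Qp p" shows "qp_abs p (qp_sub p x y) \<le> max (qp_abs p x) (qp_abs p y)"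
proof -
  obtain s t where st: "qcauchy p s" "x = qp_class p s" "qcauchy p t" "y = qp_class p t"
    using assms unfolding Qp_iff by blast
  have d: "qcauchy p (\<lambda>n. s n - t n)" using qcauchy_add[OF st(1) qcauchy_minus[OF st(3)]] by simp
  show ?thesis unfolding st(2,4) qp_sub_class[OF st(1,3)]
    by (rule LIMSEQ_le[OF rat_pabs_lim[OF d] tendsto_max[OF rat_pabs_lim[OF st(1)] rat_pabs_lim[OF st(3)]]])
       (auto simp: rat_pabs_diff)
qed

text \<open>If the absolute value \<open>L\<close> is not 0, then far out the terms have absolute
  value above \<open>L / 2\<close> and their differences stay below \<open>L / 2\<close>. By the
  isosceles property the absolute values become constant, so \<open>L\<close> is attained by a
  rational number.\<close>

lemma qp_abs_in_pvals: assumes "x \<in> Qp p" shows "qp_abs p x \<in> pvals"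
proof (cases "qp_abs p x = 0")
  case False
  obtain s where s: "qcauchy p s" "x = qp_class p s" using assms unfolding Qp_iff by blast
  define L where "L = qp_abs p x"
  have L: "L > 0" using False qp_abs_nonneg[OF assms] by (simp add: L_def)
  have lim: "(\<lambda>n. rat_pabs p (s n)) \<longlonglongrightarrow> L" using rat_pabs_lim[OF s(1)] by (simp add: L_def s)
  obtain M where M: "\<And>n. n \<ge> M \<Longrightarrow> rat_pabs p (s n) > L / 2"
    using order_tendstoD(1)[OF lim, of "L / 2"] L by (auto simp: eventually_sequentially)
  obtain K where K: "\<And>m n. m \<ge> K \<Longrightarrow> n \<ge> K \<Longrightarrow> rat_pabs p (s m - s n) < L / 2"
    using qcauchyD[OF s(1), of "L / 2"] L by auto
  define m where "m = max M K"
  have const: "rat_pabs p (s n) = rat_pabs p (s m)" if "n \<ge> m" for n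
    using rat_pabs_isosceles[of "s n" "s m"] M[of n] K[of n m] that by (simp add: m_def)
  have "(\<lambda>n. rat_pabs p (s n)) \<longlonglongrightarrow> rat_pabs p (s m)"
    by (rule tendsto_eventually) (use const in \<open>unfold eventually_sequentially, blast\<close>)
  hence "L = rat_pabs p (s m)" by (rule LIMSEQ_unique[OF lim])
  thus ?thesis using rat_pabs_in_pvals by (simp add: L_def)
qed (simp add: pvals_def)

lemma qp_zero_class: "qp_zero p = qp_class p (\<lambda>_. 0)"
  by (simp add: qp_zero_def)

lemma qp_abs_eq_0: assumes "x \<in> Qp p" "qp_abs p x = 0" shows "x = qp_zero p"
proof -
  obtain s where s: "qcauchy p s" "x = qp_class p s" using assms unfolding Qp_iff by blast
  have "(\<lambda>n. rat_pabs p (s n)) \<longlonglongrightarrow> 0" using rat_pabs_lim[OF s(1)] assms s by simp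
  thus ?thesis unfolding s(2) qp_zero_class using s(1)
    by (subst qp_class_eq_iff) (auto simp: qcauchy_const qequiv_def)
qed

section \<open>Q_p as a complete ultrametric ring\<close>

lemma cring_Qp: "cring (Qp_ring p)"
proof (rule cringI)
  have c: "qcauchy p (\<lambda>_. q)" for q by (rule qcauchy_const)
  note cl = qcauchy_add qcauchy_mult qcauchy_minus c
  show "abelian_group (Qp_ring p)"
  proof (rule abelian_groupI)
    fix x y z assume "x \<in> carrier (Qp_ring p)" "y \<in> carrier (Qp_ring p)" "z \<in> carrier (Qp_ring p)"
    then obtain s t u where *: "qcauchy p s" "qcauchy p t" "qcauchy p u"
      and xyz: "x = qp_class p s" "y = qp_class p t" "z = qp_class p u" unfolding Qp_ring_simps Qp_iff by blast
    show "x \<oplus>\<^bsub>Qp_ring p\<^esub> y \<in> carrier (Qp_ring p)"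
      using * by (simp add: xyz qp_add_class Qp_class cl)
    show "x \<oplus>\<^bsub>Qp_ring p\<^esub> y \<oplus>\<^bsub>Qp_ring p\<^esub> z = x \<oplus>\<^bsub>Qp_ring p\<^esub> (y \<oplus>\<^bsub>Qp_ring p\<^esub> z)"
      using * by (simp add: xyz qp_add_class cl add.assoc)
    show "x \<oplus>\<^bsub>Qp_ring p\<^esub> y = y \<oplus>\<^bsub>Qp_ring p\<^esub> x"
      using * by (simp add: xyz qp_add_class cl add.commute)
    show "\<zero>\<^bsub>Qp_ring p\<^esub> \<oplus>\<^bsub>Qp_ring p\<^esub> x = x"
      using * by (simp add: xyz qp_zero_class qp_add_class cl)
    show "\<exists>y\<in>carrier (Qp_ring p). y \<oplus>\<^bsub>Qp_ring p\<^esub> x = \<zero>\<^bsub>Qp_ring p\<^esub>"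
      using * by (intro bexI[of _ "qp_class p (\<lambda>n. - s n)"]) (simp_all add: xyz qp_zero_class qp_add_class cl Qp_class)
  next
    show "\<zero>\<^bsub>Qp_ring p\<^esub> \<in> carrier (Qp_ring p)" by (simp add: qp_zero_class Qp_class cl)
  qed
  show "comm_monoid (Qp_ring p)"
  proof (rule comm_monoidI)
    fix x y z assume "x \<in> carrier (Qp_ring p)" "y \<in> carrier (Qp_ring p)" "z \<in> carrier (Qp_ring p)"
    then obtain s t u where *: "qcauchy p s" "qcauchy p t" "qcauchy p u"
      and xyz: "x = qp_class p s" "y = qp_class p t" "z = qp_class p u" unfolding Qp_ring_simps Qp_iff by blast
    show "x \<otimes>\<^bsub>Qp_ring p\<^esub> y \<in> carrier (Qp_ring p)"
      using * by (simp add: xyz qp_mul_class Qp_class cl)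
    show "x \<otimes>\<^bsub>Qp_ring p\<^esub> y \<otimes>\<^bsub>Qp_ring p\<^esub> z = x \<otimes>\<^bsub>Qp_ring p\<^esub> (y \<otimes>\<^bsub>Qp_ring p\<^esub> z)"
      using * by (simp add: xyz qp_mul_class cl mult.assoc)
    show "x \<otimes>\<^bsub>Qp_ring p\<^esub> y = y \<otimes>\<^bsub>Qp_ring p\<^esub> x"
      using * by (simp add: xyz qp_mul_class cl mult.commute)
    show "\<one>\<^bsub>Qp_ring p\<^esub> \<otimes>\<^bsub>Qp_ring p\<^esub> x = x"
      using * by (simp add: xyz qp_mul_class cl)
  next
    show "\<one>\<^bsub>Qp_ring p\<^esub> \<in> carrier (Qp_ring p)" by (simp add: Qp_class cl)
  qed
  fix x y z assume "x \<in> carrier (Qp_ring p)" "y \<in> carrier (Qp_ring p)" "z \<in> carrier (Qp_ring p)"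
  then obtain s t u where *: "qcauchy p s" "qcauchy p t" "qcauchy p u"
    and xyz: "x = qp_class p s" "y = qp_class p t" "z = qp_class p u" unfolding Qp_ring_simps Qp_iff by blast
  show "(x \<oplus>\<^bsub>Qp_ring p\<^esub> y) \<otimes>\<^bsub>Qp_ring p\<^esub> z = x \<otimes>\<^bsub>Qp_ring p\<^esub> z \<oplus>\<^bsub>Qp_ring p\<^esub> y \<otimes>\<^bsub>Qp_ring p\<^esub> z"
    using * by (simp add: xyz qp_mul_class qp_add_class cl distrib_right)
qed

lemma qp_sub_eq: assumes "x \<in> Qp p" "y \<in> Qp p" shows "qp_sub p x y = x \<ominus>\<^bsub>Qp_ring p\<^esub> y"
proof -
  interpret cring "Qp_ring p" by (rule cring_Qp)
  obtain s t where st: "qcauchy p s" "x = qp_class p s" "qcauchy p t" "y = qp_class p t"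
    using assms unfolding Qp_iff by blast
  have "\<ominus>\<^bsub>Qp_ring p\<^esub> y = qp_class p (\<lambda>n. - t n)"
    using st by (intro minus_equality) (simp_all add: qp_add_class qcauchy_minus Qp_class qp_zero_class)
  thus ?thesis unfolding a_minus_def using st by (simp add: qp_sub_class qp_add_class qcauchy_minus)
qed

lemma rat_dense: assumes "x \<in> Qp p" "e > 0" obtains q where "qp_abs p (qp_sub p x (qp_class p (\<lambda>_. q))) \<le> e"
proof -
  obtain s where s: "qcauchy p s" "x = qp_class p s" using assms unfolding Qp_iff by blast
  obtain M where M: "\<And>m n. m \<ge> M \<Longrightarrow> n \<ge> M \<Longrightarrow> rat_pabs p (s m - s n) < e"
    using qcauchyD[OF s(1) \<open>e > 0\<close>] by auto
  have d: "qcauchy p (\<lambda>n. s n - s M)" using qcauchy_add[OF s(1) qcauchy_const[of "- s M"]] by simp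
  have "qp_abs p (qp_class p (\<lambda>n. s n - s M)) \<le> e"
    by (rule LIMSEQ_le_const2[OF rat_pabs_lim[OF d]]) (use M in \<open>auto intro!: exI[of _ M] less_imp_le\<close>)
  thus ?thesis using that[of "s M"] by (simp add: s(2) qp_sub_class[OF s(1) qcauchy_const])
qed

text \<open>Completeness is a diagonal argument: each \<open>s n\<close> is replaced by a rational
  at distance at most 1/(n+1), these rationals form a Cauchy sequence, and the class of that
  sequence is the limit.\<close>

lemma ultrametric_Qp: "ultrametric_ring (Qp_ring p) (qp_abs p)"
proof (intro ultrametric_ring.intro ultrametric_ring_axioms.intro)
  interpret cring "Qp_ring p" by (rule cring_Qp)
  show "ring (Qp_ring p)" by (rule ring_axioms)
  show "qp_abs p \<zero>\<^bsub>Qp_ring p\<^esub> = 0" by (simp add: qp_zero_class qp_abs_const)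
  show "qp_abs p \<one>\<^bsub>Qp_ring p\<^esub> \<le> 1" by (simp add: qp_abs_const)
  fix s :: "nat \<Rightarrow> qp" assume s: "\<And>n. s n \<in> carrier (Qp_ring p)"
    and lim: "(\<lambda>n. qp_abs p (s (Suc n) \<ominus>\<^bsub>Qp_ring p\<^esub> s n)) \<longlonglongrightarrow> 0"
  have sQ: "s n \<in> Qp p" for n using s by simp
  have subm: "x \<ominus>\<^bsub>Qp_ring p\<^esub> y \<in> Qp p" if "x \<in> Qp p" "y \<in> Qp p" for x y using minus_closed that by simp
  have tri: "qp_abs p (x \<ominus>\<^bsub>Qp_ring p\<^esub> z) \<le> max (qp_abs p (x \<ominus>\<^bsub>Qp_ring p\<^esub> y)) (qp_abs p (z \<ominus>\<^bsub>Qp_ring p\<^esub> y))"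
    if "x \<in> Qp p" "y \<in> Qp p" "z \<in> Qp p" for x y z
  proof -
    have "x \<ominus>\<^bsub>Qp_ring p\<^esub> z = (x \<ominus>\<^bsub>Qp_ring p\<^esub> y) \<ominus>\<^bsub>Qp_ring p\<^esub> (z \<ominus>\<^bsub>Qp_ring p\<^esub> y)"
      using that[folded Qp_ring_simps(1)] by algebra
    thus ?thesis using qp_abs_sub[OF subm[OF that(1,2)] subm[OF that(3,2)]] qp_sub_eq subm that by simp
  qed
  have sym: "qp_abs p (x \<ominus>\<^bsub>Qp_ring p\<^esub> y) \<le> qp_abs p (y \<ominus>\<^bsub>Qp_ring p\<^esub> x)" if "x \<in> Qp p" "y \<in> Qp p" for x y
  proof -
    have "x \<ominus>\<^bsub>Qp_ring p\<^esub> x = qp_zero p" using that r_right_minus_eq[of x x] by simp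
    thus ?thesis using tri[of x x y] that qp_abs_nonneg[OF subm[OF that(2,1)]] by (simp add: qp_zero_class qp_abs_const)
  qed
  have "\<forall>n. \<exists>q. qp_abs p (s n \<ominus>\<^bsub>Qp_ring p\<^esub> qp_class p (\<lambda>_. q)) \<le> inverse (real (Suc n))"
  proof
    fix n
    obtain q where "qp_abs p (qp_sub p (s n) (qp_class p (\<lambda>_. q))) \<le> inverse (real (Suc n))"
      by (rule rat_dense[OF sQ[of n], of "inverse (real (Suc n))"]) auto
    thus "\<exists>q. qp_abs p (s n \<ominus>\<^bsub>Qp_ring p\<^esub> qp_class p (\<lambda>_. q)) \<le> inverse (real (Suc n))"
      by (auto simp: qp_sub_eq[OF sQ Qp_class[OF qcauchy_const]])
  qed
  then obtain r where r: "\<And>n. qp_abs p (s n \<ominus>\<^bsub>Qp_ring p\<^esub> qp_class p (\<lambda>_. r n)) \<le> inverse (real (Suc n))"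
    by metis
  define c where "c n = qp_class p (\<lambda>_. r n)" for n
  have cQ: "c n \<in> Qp p" for n by (simp add: c_def Qp_class qcauchy_const)
  have c_abs: "qp_abs p (c m \<ominus>\<^bsub>Qp_ring p\<^esub> c n) = rat_pabs p (r m - r n)" for m n
    unfolding qp_sub_eq[OF cQ cQ, symmetric] unfolding c_def qp_sub_class[OF qcauchy_const qcauchy_const]
    by (rule qp_abs_const)
  have close: "\<exists>M. \<forall>m\<ge>M. \<forall>n\<ge>M. qp_abs p (s m \<ominus>\<^bsub>Qp_ring p\<^esub> s n) < e \<and> qp_abs p (s m \<ominus>\<^bsub>Qp_ring p\<^esub> c m) < e"
    if "e > 0" for e :: real
  proof -
    obtain M1 where M1: "\<And>n. n \<ge> M1 \<Longrightarrow> qp_abs p (s (Suc n) \<ominus>\<^bsub>Qp_ring p\<^esub> s n) < e"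
      using order_tendstoD(2)[OF lim \<open>e > 0\<close>] by (auto simp: eventually_sequentially)
    obtain M2 where M2: "inverse (real (Suc M2)) < e" using reals_Archimedean[OF \<open>e > 0\<close>] by auto
    have step: "qp_abs p (s n \<ominus>\<^bsub>Qp_ring p\<^esub> s M1) < e" if "n \<ge> M1" for n
      using that
    proof (induction n rule: dec_induct)
      case base
      have "s M1 \<ominus>\<^bsub>Qp_ring p\<^esub> s M1 = qp_zero p" using sQ r_right_minus_eq[of "s M1" "s M1"] by simp
      thus ?case using \<open>e > 0\<close> by (simp add: qp_zero_class qp_abs_const)
    next
      case (step n)
      thus ?case using tri[OF sQ[of "Suc n"] sQ[of n] sQ[of M1]] sym[OF sQ[of M1] sQ[of n]] M1[of n] by simp
    qed
    have c1: "qp_abs p (s m \<ominus>\<^bsub>Qp_ring p\<^esub> c m) < e" if "m \<ge> M2" for m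
    proof -
      have "inverse (real (Suc m)) \<le> inverse (real (Suc M2))" using that by (intro le_imp_inverse_le) auto
      thus ?thesis using r[of m] M2 unfolding c_def by linarith
    qed
    have s1: "qp_abs p (s m \<ominus>\<^bsub>Qp_ring p\<^esub> s n) < e" if "m \<ge> M1" "n \<ge> M1" for m n
      using tri[OF sQ[of m] sQ[of M1] sQ[of n]] step[OF that(1)] step[OF that(2)] by simp
    show ?thesis by (intro exI[of _ "max M1 M2"]) (use s1 c1 in auto)
  qed
  have rc: "qcauchy p r" unfolding qcauchy_def
  proof (intro allI impI)
    fix e :: real assume "e > 0"
    then obtain M where M: "\<And>m n. m \<ge> M \<Longrightarrow> n \<ge> M \<Longrightarrow> qp_abs p (s m \<ominus>\<^bsub>Qp_ring p\<^esub> s n) < e"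
       "\<And>m. m \<ge> M \<Longrightarrow> qp_abs p (s m \<ominus>\<^bsub>Qp_ring p\<^esub> c m) < e" using close by blast
    have "rat_pabs p (r m - r n) < e" if "m \<ge> M" "n \<ge> M" for m n
    proof -
      have "qp_abs p (c m \<ominus>\<^bsub>Qp_ring p\<^esub> s n) < e"
        using tri[OF cQ[of m] sQ[of m] sQ[of n]] sym[OF cQ[of m] sQ[of m]] M(1)[OF that(2,1)] M(2)[OF that(1)] by simp
      thus ?thesis using tri[OF cQ[of m] sQ[of n] cQ[of n]] sym[OF cQ[of n] sQ[of n]] M(2)[OF that(2)]
        unfolding c_abs by simp
    qed
    thus "\<exists>N. \<forall>m\<ge>N. \<forall>n\<ge>N. rat_pabs p (r m - r n) < e" by blast
  qed
  define l where "l = qp_class p r"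
  have lQ: "l \<in> Qp p" by (simp add: l_def Qp_class rc)
  have "(\<lambda>n. qp_abs p (l \<ominus>\<^bsub>Qp_ring p\<^esub> s n)) \<longlonglongrightarrow> 0"
  proof (rule LIMSEQ_I)
    fix e :: real assume "e > 0"
    then obtain M where M: "\<And>m. m \<ge> M \<Longrightarrow> qp_abs p (s m \<ominus>\<^bsub>Qp_ring p\<^esub> c m) < e" using close by blast
    \<comment> \<open>Letting the first index tend to infinity loses strictness of the inequality,
      hence half of \<open>e\<close>.\<close>
    obtain K where K: "\<And>m n. m \<ge> K \<Longrightarrow> n \<ge> K \<Longrightarrow> rat_pabs p (r m - r n) < e / 2"
      using qcauchyD[OF rc, of "e / 2"] \<open>e > 0\<close> by auto
    have "qp_abs p (l \<ominus>\<^bsub>Qp_ring p\<^esub> s n) < e" if n: "n \<ge> max M K" for n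
    proof -
      have d: "qcauchy p (\<lambda>m. r m - r n)" using qcauchy_add[OF rc qcauchy_const[of "- r n"]] by simp
      have "qp_abs p (qp_class p (\<lambda>m. r m - r n)) \<le> e / 2"
        by (rule LIMSEQ_le_const2[OF rat_pabs_lim[OF d]]) (use K n in \<open>auto intro!: exI[of _ K] less_imp_le\<close>)
      hence "qp_abs p (l \<ominus>\<^bsub>Qp_ring p\<^esub> c n) \<le> e / 2"
        unfolding qp_sub_eq[OF lQ cQ, symmetric] unfolding l_def c_def qp_sub_class[OF rc qcauchy_const] .
      thus ?thesis using tri[OF lQ cQ[of n] sQ[of n]] M[of n] n \<open>e > 0\<close> by simp
    qed
    thus "\<exists>no. \<forall>n\<ge>no. norm (qp_abs p (l \<ominus>\<^bsub>Qp_ring p\<^esub> s n) - 0) < e"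
      using qp_abs_nonneg[OF subm[OF lQ sQ]] by (intro exI[of _ "max M K"]) auto
  qed
  thus "\<exists>l\<in>carrier (Qp_ring p). (\<lambda>n. qp_abs p (l \<ominus>\<^bsub>Qp_ring p\<^esub> s n)) \<longlonglongrightarrow> 0" using lQ by auto
qed (auto simp: qp_abs_nonneg qp_abs_eq_0 qp_abs_mul qp_abs_sub qp_sub_eq[symmetric])

end

section \<open>The restricted product and its topology\<close>

lemma (in padic) zero_pvals: "0 \<in> pvals"
  by (simp add: pvals_def)

text \<open>Let \<open>k\<close> be the integer part of the logarithm of the supremum. Were the
  supremum above the \<open>k\<close>-th power of \<open>p\<close>, some element of \<open>Y\<close>
  would lie strictly between this power and the next one, where there are no values.\<close>

lemma (in padic) pvals_Sup:
  assumes Y: "Y \<subseteq> pvals" "Y \<noteq> {}" "bdd_above Y" shows "Sup Y \<in> pvals"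
proof (cases "Sup Y = 0")
  case False
  obtain y0 where y0: "y0 \<in> Y" using Y by auto
  have nn: "0 \<le> y" if "y \<in> Y" for y using that Y(1) by (auto simp: pvals_def)
  have "0 \<le> Sup Y" using cSup_upper[OF y0 Y(3)] nn[OF y0] by simp
  hence s: "Sup Y > 0" using False by simp
  define k where "k = \<lfloor>log (real p) (Sup Y)\<rfloor>"
  have k: "real p powr k \<le> Sup Y" "Sup Y < real p powr (real_of_int k + 1)"
    using p_gt_1 s le_log_iff[of p "Sup Y" "real_of_int k"] log_less_iff[of p "Sup Y" "real_of_int k + 1"]
    unfolding k_def by (auto simp: floor_le_iff le_floor_iff)
  have "Sup Y = real p powr k"
  proof (rule ccontr)
    assume "Sup Y \<noteq> real p powr k"
    hence "real p powr k < Sup Y" using k by simp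
    then obtain y where y: "y \<in> Y" "real p powr k < y" using less_cSup_iff[OF Y(2,3)] by blast
    have "y \<noteq> 0" using y(2) powr_ge_zero[of "real p" "real_of_int k"] by linarith
    then obtain j :: int where j: "y = real p powr j" using y(1) Y(1) by (auto simp: pvals_def)
    have "k < j" using y(2) j p_gt_1 by simp
    moreover have "real p powr j < real p powr (real_of_int k + 1)"
      using cSup_upper[OF y(1) Y(3)] k(2) j by simp
    hence "real_of_int j < real_of_int (k + 1)" using p_gt_1 by simp
    hence "j < k + 1" by (simp only: of_int_less_iff)
    ultimately show False by simp
  qed
  thus ?thesis by (auto simp: pvals_def)
qed (simp add: pvals_def)

locale padic_space = padic p for p +
  fixes Ix :: "'x set"

sublocale padic_space \<subseteq> Q: ultrametric_ring "Qp_ring p" "qp_abs p"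
  by (rule ultrametric_Qp)

sublocale padic_space \<subseteq> Q: cring "Qp_ring p"
  by (rule cring_Qp)

context padic_space begin

lemmas Qadd = Q.a_closed[unfolded Qp_ring_simps]
lemmas Qmul = Q.m_closed[unfolded Qp_ring_simps]
lemmas Qzero = Q.zero_closed[unfolded Qp_ring_simps]
lemmas Qabs_zero = Q.N_zero[unfolded Qp_ring_simps]
lemmas Qabs_add = Q.N_add[unfolded Qp_ring_simps]
lemmas Qabs_nonneg = qp_abs_nonneg

lemma Qsub: "x \<in> Qp p \<Longrightarrow> y \<in> Qp p \<Longrightarrow> qp_sub p x y \<in> Qp p"
  using Q.minus_closed[unfolded Qp_ring_simps] by (simp add: qp_sub_eq)

lemma Qsub_add: "x \<in> Qp p \<Longrightarrow> y \<in> Qp p \<Longrightarrow> qp_add p (qp_sub p x y) y = x"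
  using Q.minus_plus[of x y] by (simp add: qp_sub_eq)

lemma Qadd_eq_iff:
  assumes "x \<in> Qp p" "y \<in> Qp p" "z \<in> Qp p" shows "x = qp_add p z y \<longleftrightarrow> z = qp_sub p x y"
proof -
  have "qp_add p z y \<ominus>\<^bsub>Qp_ring p\<^esub> y = z"
    using assms Q.minus_eq Q.a_assoc Q.r_neg Q.r_zero Q.a_inv_closed by (metis Qp_ring_simps(1,5))
  thus ?thesis using assms Qsub_add[of x y] Qadd[of z y] by (auto simp: qp_sub_eq)
qed

lemma Zp_iff: "a \<in> Zp p \<longleftrightarrow> a \<in> Qp p \<and> qp_abs p a \<le> 1"
  by (simp add: Zp_def)

definition ppow :: "nat \<Rightarrow> qp" where "ppow k = qp_class p (\<lambda>_. of_nat p ^ k)"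
definition pinv :: "nat \<Rightarrow> qp" where "pinv k = qp_class p (\<lambda>_. 1 / of_nat p ^ k)"

lemma rat_pabs_ppow: "rat_pabs p (of_nat p ^ k) = 1 / real p ^ k"
  by (induction k) (auto simp: rat_pabs_mult rat_pabs_p)

lemma ppow: "ppow k \<in> Qp p" "qp_abs p (ppow k) = 1 / real p ^ k"
  by (simp_all add: ppow_def Qp_class qcauchy_const qp_abs_const rat_pabs_ppow)

lemma pinv: "pinv k \<in> Qp p" "qp_abs p (pinv k) = real p ^ k"
proof -
  have "(of_nat p :: rat) \<noteq> 0" using p_gt_1 by simp
  hence "rat_pabs p (1 / of_nat p ^ k) * rat_pabs p (of_nat p ^ k) = 1"
    by (simp add: rat_pabs_mult[symmetric])
  hence "rat_pabs p (1 / of_nat p ^ k) * (1 / real p ^ k) = 1" by (simp only: rat_pabs_ppow)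
  thus "qp_abs p (pinv k) = real p ^ k" using p_gt_1 by (simp add: pinv_def qp_abs_const field_simps)
qed (simp add: pinv_def Qp_class qcauchy_const)

lemma ppow_pinv: "x \<in> Qp p \<Longrightarrow> qp_mul p (ppow k) (qp_mul p (pinv k) x) = x"
proof -
  assume x: "x \<in> Qp p"
  have "qp_mul p (ppow k) (pinv k) = qp_class p (\<lambda>_. 1)"
    using p_gt_1 by (simp add: ppow_def pinv_def qp_mul_class qcauchy_const)
  thus ?thesis using Q.m_assoc[of "ppow k" "pinv k" x] Q.l_one[of x] x ppow(1) pinv(1) by simp
qed

lemma ppow_Zp: "ppow k \<in> Zp p"
  using ppow p_gt_1 by (simp add: Zp_iff)

section \<open>Vectors of the restricted product and their sup norm\<close>

abbreviation "V \<equiv> QpX p Ix"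

lemma V_coord: "\<xi> \<in> V \<Longrightarrow> \<xi> i \<in> Qp p"
  using Qzero by (cases "i \<in> Ix") (auto simp: QpX_def)

lemma V_outside: "\<xi> \<in> V \<Longrightarrow> i \<notin> Ix \<Longrightarrow> \<xi> i = qp_zero p"
  by (simp add: QpX_def)

lemma V_support: "\<xi> \<in> V \<Longrightarrow> 1 < qp_abs p (\<xi> i) \<Longrightarrow> i \<in> Ix"
  using V_outside[of \<xi> i] Qabs_zero by (cases "i \<in> Ix") auto

lemma V_finite: "\<xi> \<in> V \<Longrightarrow> finite {i. qp_abs p (\<xi> i) > 1}"
proof -
  assume "\<xi> \<in> V"
  hence "finite {i \<in> Ix. qp_abs p (\<xi> i) > 1}" "{i. qp_abs p (\<xi> i) > 1} \<subseteq> {i \<in> Ix. qp_abs p (\<xi> i) > 1}"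
    using Qabs_zero by (auto simp: QpX_def)
  thus ?thesis using finite_subset by blast
qed

lemma VI:
  "(\<And>i. \<xi> i \<in> Qp p) \<Longrightarrow> (\<And>i. i \<notin> Ix \<Longrightarrow> \<xi> i = qp_zero p) \<Longrightarrow> finite {i. qp_abs p (\<xi> i) > 1} \<Longrightarrow> \<xi> \<in> V"
  by (auto simp: QpX_def elim: rev_finite_subset)

lemma VI_ball:
  "(\<And>i. \<xi> i \<in> Qp p) \<Longrightarrow> (\<And>i. i \<notin> Ix \<Longrightarrow> \<xi> i = qp_zero p) \<Longrightarrow> (\<And>i. qp_abs p (\<xi> i) \<le> 1) \<Longrightarrow> \<xi> \<in> V"
  by (rule VI) (auto simp: not_less[symmetric])

lemma vzero_V: "vzero p Ix \<in> V"
  by (rule VI_ball) (auto simp: vzero_def Qzero Qabs_zero)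

lemma vadd_eq: "\<xi> \<in> V \<Longrightarrow> \<eta> \<in> V \<Longrightarrow> vadd p Ix \<xi> \<eta> = (\<lambda>i. qp_add p (\<xi> i) (\<eta> i))"
  using Q.l_zero[OF Q.zero_closed] by (intro ext[of "vadd p Ix \<xi> \<eta>"]) (auto simp: vadd_def V_outside)

lemma vsub_eq: "\<xi> \<in> V \<Longrightarrow> \<eta> \<in> V \<Longrightarrow> vsub p Ix \<xi> \<eta> = (\<lambda>i. qp_sub p (\<xi> i) (\<eta> i))"
  using Q.r_right_minus_eq[of "qp_zero p" "qp_zero p"] Qzero by (intro ext[of "vsub p Ix \<xi> \<eta>"]) (auto simp: vsub_def V_outside qp_sub_eq)

lemma vsmul_eq: "a \<in> Qp p \<Longrightarrow> \<xi> \<in> V \<Longrightarrow> vsmul p Ix a \<xi> = (\<lambda>i. qp_mul p a (\<xi> i))"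
  using Q.r_null[of a] by (intro ext[of "vsmul p Ix a \<xi>"]) (auto simp: vsmul_def V_outside)

lemma vadd_V: assumes "\<xi> \<in> V" "\<eta> \<in> V" shows "vadd p Ix \<xi> \<eta> \<in> V"
proof (rule VI)
  show "finite {i. 1 < qp_abs p (vadd p Ix \<xi> \<eta> i)}"
  proof (rule finite_subset)
    show "{i. 1 < qp_abs p (vadd p Ix \<xi> \<eta> i)} \<subseteq> {i. qp_abs p (\<xi> i) > 1} \<union> {i. qp_abs p (\<eta> i) > 1}"
      using Qabs_add[OF V_coord[OF assms(1)] V_coord[OF assms(2)]]
      by (auto simp: vadd_eq assms not_less) (meson dual_order.strict_trans1 less_max_iff_disj not_less)
  qed (use V_finite assms in auto)
qed (use assms in \<open>auto simp: vadd_def V_coord Qadd Qzero\<close>)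

lemma vsub_V: assumes "\<xi> \<in> V" "\<eta> \<in> V" shows "vsub p Ix \<xi> \<eta> \<in> V"
proof (rule VI)
  show "finite {i. 1 < qp_abs p (vsub p Ix \<xi> \<eta> i)}"
  proof (rule finite_subset)
    show "{i. 1 < qp_abs p (vsub p Ix \<xi> \<eta> i)} \<subseteq> {i. qp_abs p (\<xi> i) > 1} \<union> {i. qp_abs p (\<eta> i) > 1}"
      using qp_abs_sub[OF V_coord[OF assms(1)] V_coord[OF assms(2)]]
      by (auto simp: vsub_eq assms not_less) (meson dual_order.strict_trans1 less_max_iff_disj not_less)
  qed (use V_finite assms in auto)
qed (use assms in \<open>auto simp: vsub_def V_coord Qsub Qzero\<close>)

lemma vsmul_V: assumes a: "a \<in> Zp p" and x: "\<xi> \<in> V" shows "vsmul p Ix a \<xi> \<in> V"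
proof (rule VI)
  have aQ: "a \<in> Qp p" "qp_abs p a \<le> 1" using a by (auto simp: Zp_iff)
  show "finite {i. 1 < qp_abs p (vsmul p Ix a \<xi> i)}"
  proof (rule finite_subset[OF _ V_finite[OF x]])
    have "qp_abs p (qp_mul p a (\<xi> i)) \<le> qp_abs p (\<xi> i)" for i
      unfolding qp_abs_mul[OF aQ(1) V_coord[OF x]]
      using mult_right_mono[OF aQ(2) Qabs_nonneg[OF V_coord[OF x]]] by simp
    thus "{i. 1 < qp_abs p (vsmul p Ix a \<xi> i)} \<subseteq> {i. 1 < qp_abs p (\<xi> i)}"
      unfolding vsmul_eq[OF aQ(1) x] by (auto intro: order.strict_trans2)
  qed
  show "vsmul p Ix a \<xi> i \<in> Qp p" for i using aQ x by (auto simp: vsmul_def V_coord Qmul Qzero)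
qed (auto simp: vsmul_def)

text \<open>Only finitely many coordinates fail to be integral. The bound is a power of
  \<open>p\<close> because scalars of this kind are used to move vectors into the unit ball.\<close>

lemma V_bounded: assumes "\<xi> \<in> V" obtains k where "\<And>i. qp_abs p (\<xi> i) \<le> real p ^ k"
proof -
  let ?S = "{i. qp_abs p (\<xi> i) > 1}"
  obtain C where C: "\<And>i. i \<in> ?S \<Longrightarrow> qp_abs p (\<xi> i) \<le> C"
  proof
    show "qp_abs p (\<xi> i) \<le> Max ((\<lambda>i. qp_abs p (\<xi> i)) ` ?S)" if "i \<in> ?S" for i
      using that V_finite[OF assms] by (intro Max_ge) auto
  qed
  obtain k where k: "C < real p ^ k" using real_arch_pow[OF p_gt_1] by blast
  have "qp_abs p (\<xi> i) \<le> real p ^ k" for i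
  proof (cases "i \<in> ?S")
    case False
    moreover have "1 \<le> real p ^ k" using p_gt_1 by (intro one_le_power) simp
    ultimately show ?thesis by (simp add: not_less)
  qed (use C k in fastforce)
  thus ?thesis using that by blast
qed

lemma vnorm_bdd: assumes "\<xi> \<in> V" shows "bdd_above (insert 0 ((\<lambda>i. qp_abs p (\<xi> i)) ` Ix))"
proof -
  obtain k where "\<And>i. qp_abs p (\<xi> i) \<le> real p ^ k" using V_bounded[OF assms] by blast
  thus ?thesis by (intro bdd_aboveI[of _ "real p ^ k"]) auto
qed

lemma vnorm_le_iff:
  assumes "\<xi> \<in> V" "0 \<le> r" shows "vnorm p Ix \<xi> \<le> r \<longleftrightarrow> (\<forall>i. qp_abs p (\<xi> i) \<le> r)"
proof -
  have "vnorm p Ix \<xi> \<le> r \<longleftrightarrow> (\<forall>y\<in>insert 0 ((\<lambda>i. qp_abs p (\<xi> i)) ` Ix). y \<le> r)"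
    unfolding vnorm_def by (rule cSup_le_iff) (use vnorm_bdd[OF assms(1)] in auto)
  also have "\<dots> \<longleftrightarrow> (\<forall>i. qp_abs p (\<xi> i) \<le> r)"
  proof -
    have "qp_abs p (\<xi> i) \<le> r" if "i \<notin> Ix" for i using V_outside[OF assms(1) that] assms(2) Qabs_zero by simp
    thus ?thesis using assms(2) by auto
  qed
  finally show ?thesis .
qed

lemma vnorm_nonneg: "\<xi> \<in> V \<Longrightarrow> 0 \<le> vnorm p Ix \<xi>"
  unfolding vnorm_def by (rule cSup_upper[OF insertI1 vnorm_bdd])

lemma vnorm_pvals: assumes "\<xi> \<in> V" shows "vnorm p Ix \<xi> \<in> pvals"
  unfolding vnorm_def by (rule pvals_Sup[OF _ _ vnorm_bdd[OF assms]])
    (use qp_abs_in_pvals[OF V_coord[OF assms]] zero_pvals in auto)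

section \<open>Neighbourhoods of zero and continuity of additive maps\<close>

definition nbhd :: "'x set \<Rightarrow> real \<Rightarrow> ('x \<Rightarrow> qp) set" where
  "nbhd F e = {\<zeta> \<in> V. (\<forall>i. qp_abs p (\<zeta> i) \<le> 1) \<and> (\<forall>i\<in>F. qp_abs p (\<zeta> i) < e)}"

text \<open>Every finite set of coordinates may be enlarged, so the sets \<open>\<xi> + nbhd F e\<close> form a base of
  neighbourhoods although a \<open>\<tau>\<close>-open set is only tested on the boxes.\<close>
lemma tau_open_iff:
  "tau_open p Ix U \<longleftrightarrow> U \<subseteq> V \<and> (\<forall>\<xi>\<in>U. \<exists>F e. finite F \<and> F \<subseteq> Ix \<and> e > 0 \<and>
     (\<forall>\<eta>\<in>V. vsub p Ix \<eta> \<xi> \<in> nbhd F e \<longrightarrow> \<eta> \<in> U))" (is "_ \<longleftrightarrow> ?R")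
proof
  assume op: "tau_open p Ix U"
  show ?R
  proof (intro conjI ballI)
    show U: "U \<subseteq> V" using op by (simp add: tau_open_def)
    fix \<xi> assume xi: "\<xi> \<in> U"
    hence xiV: "\<xi> \<in> V" using U by auto
    \<comment> \<open>Outside \<open>P\<close> the vector \<open>\<xi>\<close> is integral, so it
      lies in the box of \<open>P\<close>; vectors that differ from it by an element of
      \<open>nbhd F e\<close> lie in the same box.\<close>
    define P where "P = {i. qp_abs p (\<xi> i) > 1}"
    have P: "finite P" "P \<subseteq> Ix" using V_finite[OF xiV] V_support[OF xiV] by (auto simp: P_def)
    have "\<xi> \<in> box p Ix P" using xiV V_coord[OF xiV] by (auto simp: box_def P_def Zp_iff not_less)
    hence "\<xi> \<in> U \<inter> box p Ix P" using xi by simp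
    moreover have "prod_rel_open p Ix (box p Ix P) (U \<inter> box p Ix P)" using op P by (simp add: tau_open_def)
    ultimately obtain F e where F: "finite F" "F \<subseteq> Ix" "e > 0"
      and sub: "{eta \<in> box p Ix P. \<forall>i\<in>F. qp_abs p (qp_sub p (eta i) (\<xi> i)) < e} \<subseteq> U \<inter> box p Ix P"
      unfolding prod_rel_open_def by blast
    have "\<eta> \<in> U" if eta: "\<eta> \<in> V" and n: "vsub p Ix \<eta> \<xi> \<in> nbhd F e" for \<eta>
    proof -
      have d: "qp_abs p (qp_sub p (\<eta> i) (\<xi> i)) \<le> 1" "i \<in> F \<Longrightarrow> qp_abs p (qp_sub p (\<eta> i) (\<xi> i)) < e" for i
        using n by (auto simp: nbhd_def vsub_eq eta xiV)
      have "qp_abs p (\<eta> i) \<le> 1" if "i \<notin> P" for i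
        using Qabs_add[OF Qsub[OF V_coord[OF eta] V_coord[OF xiV]] V_coord[OF xiV], of i i i] d(1)[of i] that
        by (simp add: Qsub_add V_coord eta xiV P_def)
      hence "\<eta> \<in> box p Ix P" using eta V_coord[OF eta] by (auto simp: box_def Zp_iff)
      thus "\<eta> \<in> U" using sub d(2) by auto
    qed
    thus "\<exists>F e. finite F \<and> F \<subseteq> Ix \<and> e > 0 \<and> (\<forall>\<eta>\<in>V. vsub p Ix \<eta> \<xi> \<in> nbhd F e \<longrightarrow> \<eta> \<in> U)"
      using F by blast
  qed
next
  assume R: ?R
  have "prod_rel_open p Ix (box p Ix P) (U \<inter> box p Ix P)" if P: "finite P" "P \<subseteq> Ix" for P
    unfolding prod_rel_open_def
  proof (intro conjI ballI)
    fix \<xi> assume "\<xi> \<in> U \<inter> box p Ix P"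
    hence xi: "\<xi> \<in> U" "\<xi> \<in> box p Ix P" by auto
    have xiV: "\<xi> \<in> V" using xi R by auto
    obtain F e where F: "finite F" "F \<subseteq> Ix" "e > 0" and sub: "\<And>\<eta>. \<eta> \<in> V \<Longrightarrow> vsub p Ix \<eta> \<xi> \<in> nbhd F e \<Longrightarrow> \<eta> \<in> U"
      using conjunct2[OF R, THEN bspec, OF xi(1)] by blast
    \<comment> \<open>The box leaves the coordinates in \<open>P\<close> unbounded. Testing them as
      well, with radius at most 1, makes every coordinate of the difference integral.\<close>
    have "\<eta> \<in> U" if eta: "\<eta> \<in> box p Ix P" "\<forall>i\<in>F \<union> P. qp_abs p (qp_sub p (\<eta> i) (\<xi> i)) < min e 1" for \<eta>
    proof -
      have etaV: "\<eta> \<in> V" using eta by (auto simp: box_def)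
      have "qp_abs p (qp_sub p (\<eta> i) (\<xi> i)) \<le> 1" for i
      proof (cases "i \<in> P")
        case False
        have "qp_abs p (\<eta> i) \<le> 1" "qp_abs p (\<xi> i) \<le> 1"
          using False eta(1) xi(2) V_outside[OF etaV] V_outside[OF xiV] Qabs_zero
          by (cases "i \<in> Ix"; auto simp: box_def Zp_iff)+
        thus ?thesis using qp_abs_sub[OF V_coord[OF etaV] V_coord[OF xiV], of i i] by simp
      qed (use eta(2) in force)
      hence "vsub p Ix \<eta> \<xi> \<in> nbhd F e"
        using vsub_V[OF etaV xiV] eta(2) by (auto simp: nbhd_def vsub_eq etaV xiV)
      thus ?thesis using sub etaV by blast
    qed
    thus "\<exists>F e. finite F \<and> F \<subseteq> Ix \<and> e > 0 \<and>
        {eta \<in> box p Ix P. \<forall>i\<in>F. qp_abs p (qp_sub p (eta i) (\<xi> i)) < e} \<subseteq> U \<inter> box p Ix P"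
      using F P by (intro exI[of _ "F \<union> P"] exI[of _ "min e 1"]) auto
  qed auto
  thus "tau_open p Ix U" using R by (simp add: tau_open_def)
qed

lemma tau_openE:
  assumes "tau_open p Ix U" "\<xi> \<in> U"
  obtains F e where "finite F" "F \<subseteq> Ix" "e > 0" "\<forall>\<eta>\<in>V. vsub p Ix \<eta> \<xi> \<in> nbhd F e \<longrightarrow> \<eta> \<in> U"
  using assms(1)[unfolded tau_open_iff, THEN conjunct2, THEN bspec, OF assms(2)] by blast

definition cont0 :: "'x qpop \<Rightarrow> bool" where
  "cont0 T \<longleftrightarrow> (\<forall>F e. finite F \<longrightarrow> F \<subseteq> Ix \<longrightarrow> e > 0 \<longrightarrow>
     (\<exists>F' e'. finite F' \<and> F' \<subseteq> Ix \<and> e' > 0 \<and> (\<forall>\<zeta>\<in>nbhd F' e'. T \<zeta> \<in> nbhd F e)))"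

lemma additive_sub:
  assumes T: "\<And>\<xi>. \<xi> \<in> V \<Longrightarrow> T \<xi> \<in> V"
    and add: "\<And>\<xi> \<eta>. \<xi> \<in> V \<Longrightarrow> \<eta> \<in> V \<Longrightarrow> T (vadd p Ix \<xi> \<eta>) = vadd p Ix (T \<xi>) (T \<eta>)"
    and xi: "\<xi> \<in> V" and eta: "\<eta> \<in> V"
  shows "T (vsub p Ix \<xi> \<eta>) = vsub p Ix (T \<xi>) (T \<eta>)"
proof -
  have dV: "vsub p Ix \<xi> \<eta> \<in> V" using vsub_V xi eta .
  have "vadd p Ix (vsub p Ix \<xi> \<eta>) \<eta> = \<xi>"
    unfolding vadd_eq[OF dV eta] unfolding vsub_eq[OF xi eta] using xi eta by (simp add: Qsub_add V_coord)
  hence "T \<xi> = vadd p Ix (T (vsub p Ix \<xi> \<eta>)) (T \<eta>)" using add[OF dV eta] by simp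
  hence "T \<xi> i = qp_add p (T (vsub p Ix \<xi> \<eta>) i) (T \<eta> i)" for i
    unfolding vadd_eq[OF T[OF dV] T[OF eta]] by (rule fun_cong)
  hence "T (vsub p Ix \<xi> \<eta>) i = qp_sub p (T \<xi> i) (T \<eta> i)" for i
    using Qadd_eq_iff[OF V_coord[OF T[OF xi]] V_coord[OF T[OF eta]] V_coord[OF T[OF dV]]] by blast
  thus ?thesis unfolding vsub_eq[OF T[OF xi] T[OF eta]] by blast
qed

lemma vsub_self: "\<xi> \<in> V \<Longrightarrow> vsub p Ix \<xi> \<xi> = vzero p Ix"
  using Q.r_right_minus_eq V_coord[of \<xi>]
  by (intro ext[of "vsub p Ix \<xi> \<xi>"]) (simp add: vsub_eq qp_sub_eq vzero_def)

lemma vsub_zero: "\<xi> \<in> V \<Longrightarrow> vsub p Ix \<xi> (vzero p Ix) = \<xi>"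
  using V_coord[of \<xi>] Q.minus_plus[of "\<xi> _" "qp_zero p"] Q.r_zero Q.minus_closed Qzero
  by (simp add: vsub_eq vzero_V qp_sub_eq) (simp add: vzero_def qp_sub_eq a_minus_def flip: Qp_ring_simps(4))

text \<open>Additivity carries continuity at zero to every point. In the other direction the sets
  \<open>nbhd F e\<close> must be open, and they are, because the strong triangle inequality makes
  them stable under addition.\<close>

lemma tau_continuous_iff_cont0:
  assumes T: "\<And>\<xi>. \<xi> \<in> V \<Longrightarrow> T \<xi> \<in> V"
    and add: "\<And>\<xi> \<eta>. \<xi> \<in> V \<Longrightarrow> \<eta> \<in> V \<Longrightarrow> T (vadd p Ix \<xi> \<eta>) = vadd p Ix (T \<xi>) (T \<eta>)"
  shows "tau_continuous p Ix T \<longleftrightarrow> cont0 T"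
proof
  assume cont: "tau_continuous p Ix T"
  show "cont0 T" unfolding cont0_def
  proof (intro allI impI)
    fix F :: "'x set" and e :: real assume F: "finite F" "F \<subseteq> Ix" "e > 0"
    have zn: "vzero p Ix \<in> nbhd F e" using F vzero_V Qabs_zero by (auto simp: nbhd_def vzero_def)
    have "tau_open p Ix (nbhd F e)" unfolding tau_open_iff
    proof (intro conjI ballI)
      show "nbhd F e \<subseteq> V" by (auto simp: nbhd_def)
      fix \<xi> assume xi: "\<xi> \<in> nbhd F e"
      hence xiV: "\<xi> \<in> V" by (auto simp: nbhd_def)
      have "\<eta> \<in> nbhd F e" if eta: "\<eta> \<in> V" "vsub p Ix \<eta> \<xi> \<in> nbhd F e" for \<eta>
      proof -
        have a: "qp_abs p (\<eta> i) \<le> max (qp_abs p (qp_sub p (\<eta> i) (\<xi> i))) (qp_abs p (\<xi> i))" for i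
          using Qabs_add[OF Qsub[OF V_coord[OF eta(1)] V_coord[OF xiV]] V_coord[OF xiV], of i i i]
          by (simp add: Qsub_add V_coord eta xiV)
        have b: "qp_abs p (qp_sub p (\<eta> i) (\<xi> i)) \<le> 1" "i \<in> F \<Longrightarrow> qp_abs p (qp_sub p (\<eta> i) (\<xi> i)) < e"
          "qp_abs p (\<xi> i) \<le> 1" "i \<in> F \<Longrightarrow> qp_abs p (\<xi> i) < e" for i
          using eta(2) xi by (auto simp: nbhd_def vsub_eq eta xiV)
        have "qp_abs p (\<eta> i) \<le> 1" for i using a[of i] b(1,3)[of i] by linarith
        moreover have "qp_abs p (\<eta> i) < e" if "i \<in> F" for i using a[of i] b(2,4)[OF that] by linarith
        ultimately show ?thesis using eta(1) unfolding nbhd_def by blast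
      qed
      thus "\<exists>F' e'. finite F' \<and> F' \<subseteq> Ix \<and> e' > 0 \<and> (\<forall>\<eta>\<in>V. vsub p Ix \<eta> \<xi> \<in> nbhd F' e' \<longrightarrow> \<eta> \<in> nbhd F e)"
        using F by blast
    qed
    hence "tau_open p Ix {\<xi> \<in> V. T \<xi> \<in> nbhd F e}" using cont by (simp add: tau_continuous_def)
    moreover have "T (vzero p Ix) = vzero p Ix"
      using additive_sub[OF T add vzero_V vzero_V] unfolding vsub_self[OF vzero_V] vsub_self[OF T[OF vzero_V]] .
    hence "vzero p Ix \<in> {\<xi> \<in> V. T \<xi> \<in> nbhd F e}" using zn vzero_V by simp
    ultimately obtain F' e' where F': "finite F'" "F' \<subseteq> Ix" "e' > 0"
      "\<forall>\<eta>\<in>V. vsub p Ix \<eta> (vzero p Ix) \<in> nbhd F' e' \<longrightarrow> \<eta> \<in> {\<xi> \<in> V. T \<xi> \<in> nbhd F e}"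
      by (rule tau_openE) (rule that, assumption+)
    have "T \<zeta> \<in> nbhd F e" if "\<zeta> \<in> nbhd F' e'" for \<zeta>
    proof -
      have "\<zeta> \<in> V" using that by (simp add: nbhd_def)
      thus ?thesis using F'(4)[rule_format, of \<zeta>] vsub_zero[of \<zeta>] that by simp
    qed
    thus "\<exists>F' e'. finite F' \<and> F' \<subseteq> Ix \<and> e' > 0 \<and> (\<forall>\<zeta>\<in>nbhd F' e'. T \<zeta> \<in> nbhd F e)" using F' by blast
  qed
next
  assume cont: "cont0 T"
  show "tau_continuous p Ix T" unfolding tau_continuous_def
  proof (intro allI impI)
    fix U assume U: "tau_open p Ix U"
    show "tau_open p Ix {\<xi> \<in> V. T \<xi> \<in> U}" unfolding tau_open_iff
    proof (intro conjI ballI)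
      fix \<xi> assume "\<xi> \<in> {\<xi> \<in> V. T \<xi> \<in> U}"
      hence xi: "\<xi> \<in> V" "T \<xi> \<in> U" by auto
      obtain F e where F: "finite F" "F \<subseteq> Ix" "e > 0" and sub: "\<And>\<eta>. \<eta> \<in> V \<Longrightarrow> vsub p Ix \<eta> (T \<xi>) \<in> nbhd F e \<Longrightarrow> \<eta> \<in> U"
        using tau_openE[OF U xi(2)] by metis
      obtain F' e' where F': "finite F'" "F' \<subseteq> Ix" "e' > 0" "\<And>\<zeta>. \<zeta> \<in> nbhd F' e' \<Longrightarrow> T \<zeta> \<in> nbhd F e"
        using cont[unfolded cont0_def, rule_format, OF F] by blast
      have "T \<eta> \<in> U" if eta: "\<eta> \<in> V" "vsub p Ix \<eta> \<xi> \<in> nbhd F' e'" for \<eta>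
        by (rule sub[OF T[OF eta(1)]]) (use F'(4)[OF eta(2)] in \<open>simp only: additive_sub[OF T add eta(1) xi(1)]\<close>)
      thus "\<exists>F e. finite F \<and> F \<subseteq> Ix \<and> e > 0 \<and> (\<forall>\<eta>\<in>V. vsub p Ix \<eta> \<xi> \<in> nbhd F e \<longrightarrow> \<eta> \<in> {\<xi> \<in> V. T \<xi> \<in> U})"
        using F' by blast
    qed auto
  qed
qed

end

section \<open>The normed ring of continuous operators\<close>

lemma Bring_simps [simp]:
  "carrier (Bring p Ix) = Bops p Ix"
  "S \<otimes>\<^bsub>Bring p Ix\<^esub> T = restrict (\<lambda>xi. S (T xi)) (QpX p Ix)"
  "\<one>\<^bsub>Bring p Ix\<^esub> = restrict (\<lambda>xi. xi) (QpX p Ix)"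
  "\<zero>\<^bsub>Bring p Ix\<^esub> = restrict (\<lambda>xi. vzero p Ix) (QpX p Ix)"
  "S \<oplus>\<^bsub>Bring p Ix\<^esub> T = restrict (\<lambda>xi. vadd p Ix (S xi) (T xi)) (QpX p Ix)"
  by (simp_all add: Bring_def)

context padic_space begin

abbreviation "B \<equiv> Bops p Ix"
abbreviation "\<B> \<equiv> Bring p Ix"

definition unit_ball :: "('x \<Rightarrow> qp) set" where "unit_ball = {\<xi> \<in> V. \<forall>i. qp_abs p (\<xi> i) \<le> 1}"

lemma B_V: "T \<in> B \<Longrightarrow> \<xi> \<in> V \<Longrightarrow> T \<xi> \<in> V"
  by (auto simp: Bops_def)

lemma B_add: "T \<in> B \<Longrightarrow> \<xi> \<in> V \<Longrightarrow> \<eta> \<in> V \<Longrightarrow> T (vadd p Ix \<xi> \<eta>) = vadd p Ix (T \<xi>) (T \<eta>)"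
  by (simp add: Bops_def zp_linear_def)

lemma B_smul: "T \<in> B \<Longrightarrow> a \<in> Zp p \<Longrightarrow> \<xi> \<in> V \<Longrightarrow> T (vsmul p Ix a \<xi>) = vsmul p Ix a (T \<xi>)"
  by (simp add: Bops_def zp_linear_def)

lemma B_cont0: assumes T: "T \<in> B" shows "cont0 T"
proof -
  have "tau_continuous p Ix T \<longleftrightarrow> cont0 T"
    by (rule tau_continuous_iff_cont0) (use B_V[OF T] B_add[OF T] in auto)
  thus ?thesis using T by (simp add: Bops_def)
qed

lemma B_sub: "T \<in> B \<Longrightarrow> \<xi> \<in> V \<Longrightarrow> \<eta> \<in> V \<Longrightarrow> T (vsub p Ix \<xi> \<eta>) = vsub p Ix (T \<xi>) (T \<eta>)"
  by (rule additive_sub[OF B_V B_add])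

lemma B_zero: assumes "T \<in> B" shows "T (vzero p Ix) = vzero p Ix"
  using B_sub[OF assms vzero_V vzero_V] unfolding vsub_self[OF vzero_V] vsub_self[OF B_V[OF assms vzero_V]] .

text \<open>Members of \<open>Bops\<close> are extensional; with the restriction built in, the
  conditions can be verified for a plain function.\<close>

lemma BI:
  assumes V: "\<And>\<xi>. \<xi> \<in> V \<Longrightarrow> T \<xi> \<in> V"
    and add: "\<And>\<xi> \<eta>. \<xi> \<in> V \<Longrightarrow> \<eta> \<in> V \<Longrightarrow> T (vadd p Ix \<xi> \<eta>) = vadd p Ix (T \<xi>) (T \<eta>)"
    and smul: "\<And>a \<xi>. a \<in> Zp p \<Longrightarrow> \<xi> \<in> V \<Longrightarrow> T (vsmul p Ix a \<xi>) = vsmul p Ix a (T \<xi>)"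
    and cont: "cont0 T"
  shows "restrict T V \<in> B"
proof -
  let ?T = "restrict T V"
  have V': "?T \<xi> \<in> V" if "\<xi> \<in> V" for \<xi> using V that by simp
  have add': "?T (vadd p Ix \<xi> \<eta>) = vadd p Ix (?T \<xi>) (?T \<eta>)" if "\<xi> \<in> V" "\<eta> \<in> V" for \<xi> \<eta>
    using add vadd_V that by simp
  have smul': "?T (vsmul p Ix a \<xi>) = vsmul p Ix a (?T \<xi>)" if "a \<in> Zp p" "\<xi> \<in> V" for a \<xi>
    using smul vsmul_V that by simp
  have "?T \<zeta> = T \<zeta>" if "\<zeta> \<in> nbhd F e" for \<zeta> F e using that by (simp add: nbhd_def)
  hence "cont0 ?T" using cont by (simp add: cont0_def)
  hence "tau_continuous p Ix ?T" using tau_continuous_iff_cont0[OF V' add'] by blast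
  thus ?thesis unfolding Bops_def zp_linear_def using V' add' smul' by auto
qed

lemma B_ext: "S \<in> B \<Longrightarrow> T \<in> B \<Longrightarrow> (\<And>\<xi>. \<xi> \<in> V \<Longrightarrow> S \<xi> = T \<xi>) \<Longrightarrow> S = T"
  by (rule PiE_ext[of S V "\<lambda>_. V" T]) (auto simp: Bops_def)

lemma nbhd_mono: "F' \<subseteq> F \<Longrightarrow> e \<le> e' \<Longrightarrow> nbhd F e \<subseteq> nbhd F' e'"
  by (auto simp: nbhd_def intro: order.strict_trans2)

lemma nbhd_V: "\<zeta> \<in> nbhd F e \<Longrightarrow> \<zeta> \<in> V"
  by (simp add: nbhd_def)

lemma cont0D:
  assumes "cont0 T" "finite F" "F \<subseteq> Ix" "e > 0"
  obtains F' e' where "finite F'" "F' \<subseteq> Ix" "e' > 0" "\<forall>\<zeta>\<in>nbhd F' e'. T \<zeta> \<in> nbhd F e"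
  using assms(1)[unfolded cont0_def, rule_format, OF assms(2-4)] by blast

text \<open>Made for sums and differences: every \<open>nbhd F e\<close> is closed under both
  operations.\<close>

lemma cont0_pointwise:
  assumes S: "cont0 S" and T: "cont0 T"
    and U: "\<And>\<xi> F e. S \<xi> \<in> nbhd F e \<Longrightarrow> T \<xi> \<in> nbhd F e \<Longrightarrow> U \<xi> \<in> nbhd F e"
  shows "cont0 U"
  unfolding cont0_def
proof (intro allI impI)
  fix F :: "'x set" and e :: real assume F: "finite F" "F \<subseteq> Ix" "e > 0"
  obtain F1 e1 where 1: "finite F1" "F1 \<subseteq> Ix" "e1 > 0" "\<forall>\<zeta>\<in>nbhd F1 e1. S \<zeta> \<in> nbhd F e" by (rule cont0D[OF S F])
  obtain F2 e2 where 2: "finite F2" "F2 \<subseteq> Ix" "e2 > 0" "\<forall>\<zeta>\<in>nbhd F2 e2. T \<zeta> \<in> nbhd F e" by (rule cont0D[OF T F])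
  have sub: "nbhd (F1 \<union> F2) (min e1 e2) \<subseteq> nbhd F1 e1" "nbhd (F1 \<union> F2) (min e1 e2) \<subseteq> nbhd F2 e2"
    by (rule nbhd_mono; simp)+
  have "U \<zeta> \<in> nbhd F e" if "\<zeta> \<in> nbhd (F1 \<union> F2) (min e1 e2)" for \<zeta>
    using U subsetD[OF sub(1) that] subsetD[OF sub(2) that] 1(4) 2(4) by blast
  thus "\<exists>F' e'. finite F' \<and> F' \<subseteq> Ix \<and> e' > 0 \<and> (\<forall>\<zeta>\<in>nbhd F' e'. U \<zeta> \<in> nbhd F e)"
    using 1 2 by (intro exI[of _ "F1 \<union> F2"] exI[of _ "min e1 e2"]) auto
qed

lemma nbhd_add: assumes "\<xi> \<in> nbhd F e" "\<eta> \<in> nbhd F e" shows "vadd p Ix \<xi> \<eta> \<in> nbhd F e"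
proof -
  have V: "\<xi> \<in> V" "\<eta> \<in> V" using assms nbhd_V by auto
  have b: "qp_abs p (qp_add p (\<xi> i) (\<eta> i)) \<le> max (qp_abs p (\<xi> i)) (qp_abs p (\<eta> i))" for i
    by (rule Qabs_add[OF V_coord[OF V(1)] V_coord[OF V(2)]])
  have "qp_abs p (qp_add p (\<xi> i) (\<eta> i)) \<le> 1" for i
    using b[of i] assms unfolding nbhd_def by (simp add: le_max_iff_disj) (meson order_trans)
  moreover have "qp_abs p (qp_add p (\<xi> i) (\<eta> i)) < e" if "i \<in> F" for i
    using b[of i] assms that unfolding nbhd_def by (simp add: le_max_iff_disj) (meson order_le_less_trans)
  ultimately show ?thesis using vadd_V[OF V] by (simp add: nbhd_def vadd_eq V)
qed

lemma nbhd_sub: assumes "\<xi> \<in> nbhd F e" "\<eta> \<in> nbhd F e" shows "vsub p Ix \<xi> \<eta> \<in> nbhd F e"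
proof -
  have V: "\<xi> \<in> V" "\<eta> \<in> V" using assms nbhd_V by auto
  have b: "qp_abs p (qp_sub p (\<xi> i) (\<eta> i)) \<le> max (qp_abs p (\<xi> i)) (qp_abs p (\<eta> i))" for i
    by (rule qp_abs_sub[OF V_coord[OF V(1)] V_coord[OF V(2)]])
  have "qp_abs p (qp_sub p (\<xi> i) (\<eta> i)) \<le> 1" for i
    using b[of i] assms unfolding nbhd_def by (simp add: le_max_iff_disj) (meson order_trans)
  moreover have "qp_abs p (qp_sub p (\<xi> i) (\<eta> i)) < e" if "i \<in> F" for i
    using b[of i] assms that unfolding nbhd_def by (simp add: le_max_iff_disj) (meson order_le_less_trans)
  ultimately show ?thesis using vsub_V[OF V] by (simp add: nbhd_def vsub_eq V)
qed

lemma vzero_nbhd: "e > 0 \<Longrightarrow> vzero p Ix \<in> nbhd F e"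
  using vzero_V Qabs_zero by (simp add: nbhd_def vzero_def)

lemma mul_add: "a \<in> Qp p \<Longrightarrow> x \<in> Qp p \<Longrightarrow> y \<in> Qp p \<Longrightarrow> qp_mul p a (qp_add p x y) = qp_add p (qp_mul p a x) (qp_mul p a y)"
  using Q.r_distr[of x y a] by simp

lemma mul_sub: "a \<in> Qp p \<Longrightarrow> x \<in> Qp p \<Longrightarrow> y \<in> Qp p \<Longrightarrow> qp_mul p a (qp_sub p x y) = qp_sub p (qp_mul p a x) (qp_mul p a y)"
  using Q.r_distr[of x "\<ominus>\<^bsub>Qp_ring p\<^esub> y" a] Q.r_minus[of a y] Q.a_inv_closed[of y] Qmul[of a]
  by (simp add: qp_sub_eq a_minus_def)

lemma add_interchange:
  assumes "a \<in> Qp p" "b \<in> Qp p" "c \<in> Qp p" "d \<in> Qp p"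
  shows "qp_add p (qp_add p a b) (qp_add p c d) = qp_add p (qp_add p a c) (qp_add p b d)"
  using Q.a_ac assms Qadd by (metis Qp_ring_simps(1,5))

lemma add_sub_interchange:
  assumes "a \<in> Qp p" "b \<in> Qp p" "c \<in> Qp p" "d \<in> Qp p"
  shows "qp_sub p (qp_add p a b) (qp_add p c d) = qp_add p (qp_sub p a c) (qp_sub p b d)"
proof -
  have "a \<oplus>\<^bsub>Qp_ring p\<^esub> b \<ominus>\<^bsub>Qp_ring p\<^esub> (c \<oplus>\<^bsub>Qp_ring p\<^esub> d) = (a \<ominus>\<^bsub>Qp_ring p\<^esub> c) \<oplus>\<^bsub>Qp_ring p\<^esub> (b \<ominus>\<^bsub>Qp_ring p\<^esub> d)"
    using assms[folded Qp_ring_simps(1)] by algebra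
  thus ?thesis using assms Qadd by (simp add: qp_sub_eq)
qed

lemma vsmul_eq': "a \<in> Zp p \<Longrightarrow> \<xi> \<in> V \<Longrightarrow> vsmul p Ix a \<xi> = (\<lambda>i. qp_mul p a (\<xi> i))"
  by (simp add: vsmul_eq Zp_iff)

lemma add_B: assumes S: "S \<in> B" and T: "T \<in> B" shows "restrict (\<lambda>\<xi>. vadd p Ix (S \<xi>) (T \<xi>)) V \<in> B"
proof (rule BI)
  fix \<xi> \<eta> assume xe: "\<xi> \<in> V" "\<eta> \<in> V"
  note v = B_V[OF S xe(1)] B_V[OF T xe(1)] B_V[OF S xe(2)] B_V[OF T xe(2)]
  show "vadd p Ix (S (vadd p Ix \<xi> \<eta>)) (T (vadd p Ix \<xi> \<eta>)) = vadd p Ix (vadd p Ix (S \<xi>) (T \<xi>)) (vadd p Ix (S \<eta>) (T \<eta>))"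
    unfolding B_add[OF S xe] B_add[OF T xe] vadd_eq[OF vadd_V[OF v(1,3)] vadd_V[OF v(2,4)]] vadd_eq[OF vadd_V[OF v(1,2)] vadd_V[OF v(3,4)]]
    unfolding vadd_eq[OF v(1,3)] vadd_eq[OF v(2,4)] vadd_eq[OF v(1,2)] vadd_eq[OF v(3,4)]
    by (intro ext add_interchange v[THEN V_coord])
next
  fix \<xi> assume "\<xi> \<in> V" thus "vadd p Ix (S \<xi>) (T \<xi>) \<in> V" using B_V S T vadd_V by blast
next
  fix a \<xi> assume a: "a \<in> Zp p" and xi: "\<xi> \<in> V"
  note v = B_V[OF S xi] B_V[OF T xi]
  show "vadd p Ix (S (vsmul p Ix a \<xi>)) (T (vsmul p Ix a \<xi>)) = vsmul p Ix a (vadd p Ix (S \<xi>) (T \<xi>))"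
    unfolding B_smul[OF S a xi] B_smul[OF T a xi] vadd_eq[OF vsmul_V[OF a v(1)] vsmul_V[OF a v(2)]] vsmul_eq'[OF a vadd_V[OF v]]
    unfolding vsmul_eq'[OF a v(1)] vsmul_eq'[OF a v(2)] vadd_eq[OF v]
    using a v[THEN V_coord] by (intro ext) (simp add: mul_add Zp_iff)
qed (rule cont0_pointwise[OF B_cont0[OF S] B_cont0[OF T] nbhd_add])

lemma opsub_B: assumes S: "S \<in> B" and T: "T \<in> B" shows "opsub p Ix S T \<in> B"
  unfolding opsub_def
proof (rule BI)
  fix \<xi> \<eta> assume xe: "\<xi> \<in> V" "\<eta> \<in> V"
  note v = B_V[OF S xe(1)] B_V[OF T xe(1)] B_V[OF S xe(2)] B_V[OF T xe(2)]
  show "vsub p Ix (S (vadd p Ix \<xi> \<eta>)) (T (vadd p Ix \<xi> \<eta>)) = vadd p Ix (vsub p Ix (S \<xi>) (T \<xi>)) (vsub p Ix (S \<eta>) (T \<eta>))"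
    unfolding B_add[OF S xe] B_add[OF T xe] vsub_eq[OF vadd_V[OF v(1,3)] vadd_V[OF v(2,4)]] vadd_eq[OF vsub_V[OF v(1,2)] vsub_V[OF v(3,4)]]
    unfolding vadd_eq[OF v(1,3)] vadd_eq[OF v(2,4)] vsub_eq[OF v(1,2)] vsub_eq[OF v(3,4)]
    by (intro ext add_sub_interchange v[THEN V_coord])
next
  fix \<xi> assume "\<xi> \<in> V" thus "vsub p Ix (S \<xi>) (T \<xi>) \<in> V" using B_V S T vsub_V by blast
next
  fix a \<xi> assume a: "a \<in> Zp p" and xi: "\<xi> \<in> V"
  note v = B_V[OF S xi] B_V[OF T xi]
  show "vsub p Ix (S (vsmul p Ix a \<xi>)) (T (vsmul p Ix a \<xi>)) = vsmul p Ix a (vsub p Ix (S \<xi>) (T \<xi>))"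
    unfolding B_smul[OF S a xi] B_smul[OF T a xi] vsub_eq[OF vsmul_V[OF a v(1)] vsmul_V[OF a v(2)]] vsmul_eq'[OF a vsub_V[OF v]]
    unfolding vsmul_eq'[OF a v(1)] vsmul_eq'[OF a v(2)] vsub_eq[OF v]
    using a v[THEN V_coord] by (intro ext) (simp add: mul_sub Zp_iff)
qed (rule cont0_pointwise[OF B_cont0[OF S] B_cont0[OF T] nbhd_sub])

lemma zero_B: "restrict (\<lambda>\<xi>. vzero p Ix) V \<in> B"
proof (rule BI)
  show "cont0 (\<lambda>\<xi>. vzero p Ix)" unfolding cont0_def using vzero_nbhd by (metis subset_refl zero_less_one finite.emptyI empty_subsetI)
  show "vzero p Ix = vadd p Ix (vzero p Ix) (vzero p Ix)"
    using Q.l_zero[OF Q.zero_closed] by (simp add: vadd_eq vzero_V) (simp add: vzero_def)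
  show "vzero p Ix = vsmul p Ix a (vzero p Ix)" if "a \<in> Zp p" for a
    using Q.r_null[of a] that by (simp add: vsmul_eq' vzero_V) (simp add: vzero_def Zp_iff)
qed (rule vzero_V)

lemma one_B: "restrict (\<lambda>\<xi>. \<xi>) V \<in> B"
  by (rule BI) (auto simp: cont0_def)

lemma mult_B: assumes S: "S \<in> B" and T: "T \<in> B" shows "restrict (\<lambda>\<xi>. S (T \<xi>)) V \<in> B"
proof (rule BI)
  show "cont0 (\<lambda>\<xi>. S (T \<xi>))" unfolding cont0_def
  proof (intro allI impI)
    fix F :: "'x set" and e :: real assume F: "finite F" "F \<subseteq> Ix" "e > 0"
    obtain F1 e1 where 1: "finite F1" "F1 \<subseteq> Ix" "e1 > 0" "\<forall>\<zeta>\<in>nbhd F1 e1. S \<zeta> \<in> nbhd F e" by (rule cont0D[OF B_cont0[OF S] F])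
    obtain F2 e2 where 2: "finite F2" "F2 \<subseteq> Ix" "e2 > 0" "\<forall>\<zeta>\<in>nbhd F2 e2. T \<zeta> \<in> nbhd F1 e1" by (rule cont0D[OF B_cont0[OF T] 1(1-3)])
    show "\<exists>F' e'. finite F' \<and> F' \<subseteq> Ix \<and> e' > 0 \<and> (\<forall>\<zeta>\<in>nbhd F' e'. S (T \<zeta>) \<in> nbhd F e)" using 1(4) 2 by blast
  qed
qed (simp_all add: B_V[OF S] B_V[OF T] B_add[OF S] B_add[OF T] B_smul[OF S] B_smul[OF T])

lemma ring_Bring: "ring \<B>"
proof (rule ringI)
  show "abelian_group \<B>"
  proof (rule abelian_groupI)
    fix R S T assume "R \<in> carrier \<B>" "S \<in> carrier \<B>" "T \<in> carrier \<B>"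
    hence R: "R \<in> B" and S: "S \<in> B" and T: "T \<in> B" by auto
    show "R \<oplus>\<^bsub>\<B>\<^esub> S \<in> carrier \<B>" using add_B[OF R S] by simp
    have assoc: "vadd p Ix (vadd p Ix \<xi> \<eta>) \<zeta> = vadd p Ix \<xi> (vadd p Ix \<eta> \<zeta>)" if "\<xi> \<in> V" "\<eta> \<in> V" "\<zeta> \<in> V" for \<xi> \<eta> \<zeta>
      unfolding vadd_eq[OF vadd_V[OF that(1,2)] that(3)] vadd_eq[OF that(1) vadd_V[OF that(2,3)]]
      unfolding vadd_eq[OF that(1,2)] vadd_eq[OF that(2,3)]
      using Q.a_assoc that[THEN V_coord] by simp
    show "R \<oplus>\<^bsub>\<B>\<^esub> S \<oplus>\<^bsub>\<B>\<^esub> T = R \<oplus>\<^bsub>\<B>\<^esub> (S \<oplus>\<^bsub>\<B>\<^esub> T)"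
      using assoc B_V R S T by (auto intro!: restrict_ext)
    have comm: "vadd p Ix \<xi> \<eta> = vadd p Ix \<eta> \<xi>" if "\<xi> \<in> V" "\<eta> \<in> V" for \<xi> \<eta>
      using Q.a_comm that[THEN V_coord] by (simp add: vadd_eq that)
    show "R \<oplus>\<^bsub>\<B>\<^esub> S = S \<oplus>\<^bsub>\<B>\<^esub> R"
      using comm B_V R S by (auto intro!: restrict_ext)
    have zero: "vadd p Ix (vzero p Ix) \<xi> = \<xi>" if "\<xi> \<in> V" for \<xi>
      unfolding vadd_eq[OF vzero_V that] using Q.l_zero V_coord[OF that] by (simp add: vzero_def)
    show "\<zero>\<^bsub>\<B>\<^esub> \<oplus>\<^bsub>\<B>\<^esub> R = R"
    proof (rule B_ext[OF _ R])
      show "\<zero>\<^bsub>\<B>\<^esub> \<oplus>\<^bsub>\<B>\<^esub> R \<in> B" using add_B[OF zero_B R] by (simp only: Bring_simps)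
    qed (use zero B_V[OF R] in simp)
    have inv: "vadd p Ix (vsub p Ix (vzero p Ix) \<xi>) \<xi> = vzero p Ix" if "\<xi> \<in> V" for \<xi>
      unfolding vadd_eq[OF vsub_V[OF vzero_V that] that] unfolding vsub_eq[OF vzero_V that]
      using Qsub_add[OF Qzero V_coord[OF that]] by (simp add: vzero_def)
    show "\<exists>y\<in>carrier \<B>. y \<oplus>\<^bsub>\<B>\<^esub> R = \<zero>\<^bsub>\<B>\<^esub>"
    proof (rule bexI[of _ "opsub p Ix (restrict (\<lambda>\<xi>. vzero p Ix) V) R"])
      show "opsub p Ix (restrict (\<lambda>\<xi>. vzero p Ix) V) R \<oplus>\<^bsub>\<B>\<^esub> R = \<zero>\<^bsub>\<B>\<^esub>"
        using inv B_V[OF R] by (auto simp: opsub_def intro!: restrict_ext)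
    qed (use opsub_B[OF zero_B R] in simp)
  next
    show "\<zero>\<^bsub>\<B>\<^esub> \<in> carrier \<B>" using zero_B by simp
  qed
  show "monoid \<B>"
  proof (rule monoidI)
    fix R S T assume "R \<in> carrier \<B>" "S \<in> carrier \<B>" "T \<in> carrier \<B>"
    hence R: "R \<in> B" and S: "S \<in> B" and T: "T \<in> B" by auto
    show "R \<otimes>\<^bsub>\<B>\<^esub> S \<in> carrier \<B>" using mult_B[OF R S] by simp
    show "R \<otimes>\<^bsub>\<B>\<^esub> S \<otimes>\<^bsub>\<B>\<^esub> T = R \<otimes>\<^bsub>\<B>\<^esub> (S \<otimes>\<^bsub>\<B>\<^esub> T)"
      using B_V[OF T] by (auto intro!: restrict_ext)
  next
    show "\<one>\<^bsub>\<B>\<^esub> \<in> carrier \<B>" using one_B by simp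
    fix R assume "R \<in> carrier \<B>"
    hence R: "R \<in> B" by simp
    show "\<one>\<^bsub>\<B>\<^esub> \<otimes>\<^bsub>\<B>\<^esub> R = R"
    proof (rule B_ext[OF _ R])
      show "\<one>\<^bsub>\<B>\<^esub> \<otimes>\<^bsub>\<B>\<^esub> R \<in> B" using mult_B[OF one_B R] by (simp only: Bring_simps)
    qed (use B_V[OF R] in simp)
    show "R \<otimes>\<^bsub>\<B>\<^esub> \<one>\<^bsub>\<B>\<^esub> = R"
    proof (rule B_ext[OF _ R])
      show "R \<otimes>\<^bsub>\<B>\<^esub> \<one>\<^bsub>\<B>\<^esub> \<in> B" using mult_B[OF R one_B] by (simp only: Bring_simps)
    qed simp
  qed
next
  fix R S T assume "R \<in> carrier \<B>" "S \<in> carrier \<B>" "T \<in> carrier \<B>"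
  hence R: "R \<in> B" and S: "S \<in> B" and T: "T \<in> B" by auto
  show "(R \<oplus>\<^bsub>\<B>\<^esub> S) \<otimes>\<^bsub>\<B>\<^esub> T = R \<otimes>\<^bsub>\<B>\<^esub> T \<oplus>\<^bsub>\<B>\<^esub> S \<otimes>\<^bsub>\<B>\<^esub> T"
    using B_V[OF T] by (auto intro!: restrict_ext)
  show "T \<otimes>\<^bsub>\<B>\<^esub> (R \<oplus>\<^bsub>\<B>\<^esub> S) = T \<otimes>\<^bsub>\<B>\<^esub> R \<oplus>\<^bsub>\<B>\<^esub> T \<otimes>\<^bsub>\<B>\<^esub> S"
    using B_V[OF R] B_V[OF S] B_add[OF T] by (auto intro!: restrict_ext)
qed

lemma opsub_eq: assumes S: "S \<in> B" and T: "T \<in> B" shows "opsub p Ix S T = S \<ominus>\<^bsub>\<B>\<^esub> T"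
proof -
  interpret R: ring \<B> by (rule ring_Bring)
  have "opsub p Ix S T \<oplus>\<^bsub>\<B>\<^esub> T = S"
  proof (rule B_ext[OF _ S])
    fix \<xi> assume xi: "\<xi> \<in> V"
    note v = B_V[OF S xi] B_V[OF T xi]
    have "vadd p Ix (vsub p Ix (S \<xi>) (T \<xi>)) (T \<xi>) = S \<xi>"
      unfolding vadd_eq[OF vsub_V[OF v] v(2)] unfolding vsub_eq[OF v] using Qsub_add v[THEN V_coord] by simp
    thus "(opsub p Ix S T \<oplus>\<^bsub>\<B>\<^esub> T) \<xi> = S \<xi>" using xi by (simp add: opsub_def)
  qed (use add_B[OF opsub_B[OF S T] T] in simp)
  moreover have "opsub p Ix S T \<in> carrier \<B>" "T \<in> carrier \<B>" using opsub_B S T by auto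
  ultimately show ?thesis by (metis R.a_assoc R.minus_eq R.r_neg R.r_zero R.a_inv_closed)
qed

section \<open>The operator norm\<close>

lemma opsub_apply: "\<xi> \<in> V \<Longrightarrow> opsub p Ix S T \<xi> = vsub p Ix (S \<xi>) (T \<xi>)"
  by (simp add: opsub_def)

lemma unit_ball_V: "\<xi> \<in> unit_ball \<Longrightarrow> \<xi> \<in> V"
  by (simp add: unit_ball_def)

lemma unit_ball_eq: "{xi \<in> V. vnorm p Ix xi \<le> 1} = unit_ball"
  using vnorm_le_iff by (auto simp: unit_ball_def)

text \<open>Continuity at 0 bounds an operator on \<open>p\<^sup>k\<close> times the unit ball, for some \<open>k\<close>.\<close>
lemma B_bounded:
  assumes T: "T \<in> B" obtains k where "\<And>\<xi> i. \<xi> \<in> unit_ball \<Longrightarrow> qp_abs p (T \<xi> i) \<le> real p ^ k"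
proof -
  \<comment> \<open>With no distinguished coordinates, \<open>nbhd {} 1\<close> is the whole unit
    ball; continuity at zero thus yields a neighbourhood mapped to integral vectors.\<close>
  obtain F e where F: "finite F" "F \<subseteq> Ix" "e > 0" "\<forall>\<zeta>\<in>nbhd F e. T \<zeta> \<in> nbhd {} 1"
    by (rule cont0D[OF B_cont0[OF T], of "{}" 1]) auto
  obtain k where k: "inverse e < real p ^ k" using real_arch_pow[OF p_gt_1] by blast
  have pk: "0 < real p ^ k" using p_gt_1 by simp
  have "qp_abs p (T \<xi> i) \<le> real p ^ k" if xi: "\<xi> \<in> unit_ball" for \<xi> i
  proof -
    have xiV: "\<xi> \<in> V" using xi by (rule unit_ball_V)
    let ?\<eta> = "vsmul p Ix (ppow k) \<xi>"
    have eta: "qp_abs p (?\<eta> j) \<le> 1 / real p ^ k" for j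
    proof -
      have "qp_abs p (?\<eta> j) = 1 / real p ^ k * qp_abs p (\<xi> j)"
        by (simp add: vsmul_eq'[OF ppow_Zp xiV] qp_abs_mul ppow V_coord[OF xiV])
      also have "\<dots> \<le> 1 / real p ^ k * 1" using xi pk by (intro mult_left_mono) (auto simp: unit_ball_def)
      finally show ?thesis by simp
    qed
    have "1 / real p ^ k < e" using k F(3) pk by (simp add: field_simps)
    moreover have "1 / real p ^ k \<le> 1" using p_gt_1 by simp
    ultimately have "?\<eta> \<in> nbhd F e" using vsmul_V[OF ppow_Zp xiV] eta unfolding nbhd_def
      by (auto intro: order.trans order.strict_trans1)
    hence "T ?\<eta> \<in> nbhd {} 1" using F(4) by blast
    hence "qp_abs p (T ?\<eta> i) \<le> 1" by (simp add: nbhd_def)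
    moreover have "T ?\<eta> i = qp_mul p (ppow k) (T \<xi> i)"
      by (simp add: B_smul[OF T ppow_Zp xiV] vsmul_eq'[OF ppow_Zp B_V[OF T xiV]])
    ultimately have "1 / real p ^ k * qp_abs p (T \<xi> i) \<le> 1"
      by (simp add: qp_abs_mul ppow V_coord[OF B_V[OF T xiV]])
    thus ?thesis using pk by (simp add: field_simps)
  qed
  thus ?thesis using that by blast
qed

lemma vzero_ball: "vzero p Ix \<in> unit_ball"
  using vzero_V Qabs_zero by (simp add: unit_ball_def vzero_def)

lemma opnorm_bdd: assumes "T \<in> B" shows "bdd_above ((\<lambda>xi. vnorm p Ix (T xi)) ` unit_ball)"
proof -
  obtain k where k: "\<And>\<xi> i. \<xi> \<in> unit_ball \<Longrightarrow> qp_abs p (T \<xi> i) \<le> real p ^ k" using B_bounded[OF assms] by blast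
  have "vnorm p Ix (T \<xi>) \<le> real p ^ k" if "\<xi> \<in> unit_ball" for \<xi>
    using vnorm_le_iff[OF B_V[OF assms unit_ball_V[OF that]], of "real p ^ k"] k[OF that] by simp
  thus ?thesis by (intro bdd_aboveI[of _ "real p ^ k"]) auto
qed

lemma opnorm_eq: "opnorm p Ix T = Sup ((\<lambda>xi. vnorm p Ix (T xi)) ` unit_ball)"
  by (simp add: opnorm_def unit_ball_eq)

lemma opnorm_le_iff:
  assumes T: "T \<in> B" and r: "0 \<le> r"
  shows "opnorm p Ix T \<le> r \<longleftrightarrow> (\<forall>\<xi>\<in>unit_ball. \<forall>i. qp_abs p (T \<xi> i) \<le> r)"
proof -
  have "opnorm p Ix T \<le> r \<longleftrightarrow> (\<forall>y\<in>(\<lambda>xi. vnorm p Ix (T xi)) ` unit_ball. y \<le> r)"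
    unfolding opnorm_eq by (rule cSup_le_iff) (use opnorm_bdd[OF T] vzero_ball in auto)
  also have "\<dots> \<longleftrightarrow> (\<forall>\<xi>\<in>unit_ball. \<forall>i. qp_abs p (T \<xi> i) \<le> r)"
    using vnorm_le_iff[OF B_V[OF T unit_ball_V] r] by auto
  finally show ?thesis .
qed

lemma opnorm_nonneg: assumes "T \<in> B" shows "0 \<le> opnorm p Ix T"
proof -
  have "vnorm p Ix (T (vzero p Ix)) \<le> opnorm p Ix T"
    unfolding opnorm_eq by (rule cSup_upper[OF _ opnorm_bdd[OF assms]]) (use vzero_ball in auto)
  thus ?thesis using vnorm_nonneg[OF B_V[OF assms vzero_V]] by simp
qed

lemma opnorm_bound: "T \<in> B \<Longrightarrow> \<xi> \<in> unit_ball \<Longrightarrow> qp_abs p (T \<xi> i) \<le> opnorm p Ix T"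
  using opnorm_le_iff[of T "opnorm p Ix T"] opnorm_nonneg by blast

lemma opnorm_pvals: assumes "T \<in> B" shows "opnorm p Ix T \<in> pvals"
  unfolding opnorm_eq
  by (rule pvals_Sup[OF _ _ opnorm_bdd[OF assms]]) (use vnorm_pvals B_V[OF assms unit_ball_V] vzero_ball in auto)

text \<open>Multiplication by \<open>ppow k\<close> brings \<open>\<xi>\<close> into the unit ball,
  and linearity takes the scalar out again.\<close>

lemma opnorm_scale_nat:
  assumes T: "T \<in> B" and xi: "\<xi> \<in> V" "\<And>i. qp_abs p (\<xi> i) \<le> real p ^ k"
  shows "qp_abs p (T \<xi> i) \<le> real p ^ k * opnorm p Ix T"
proof -
  have pk: "0 < real p ^ k" using p_gt_1 by simp
  let ?\<eta> = "vsmul p Ix (ppow k) \<xi>"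
  have "qp_abs p (?\<eta> j) \<le> 1" for j
    using xi(2)[of j] pk by (simp add: vsmul_eq'[OF ppow_Zp xi(1)] qp_abs_mul ppow V_coord[OF xi(1)])
  hence "?\<eta> \<in> unit_ball" using vsmul_V[OF ppow_Zp xi(1)] by (simp add: unit_ball_def)
  hence "qp_abs p (T ?\<eta> i) \<le> opnorm p Ix T" by (rule opnorm_bound[OF T])
  moreover have "T ?\<eta> i = qp_mul p (ppow k) (T \<xi> i)"
    by (simp add: B_smul[OF T ppow_Zp xi(1)] vsmul_eq'[OF ppow_Zp B_V[OF T xi(1)]])
  ultimately have "1 / real p ^ k * qp_abs p (T \<xi> i) \<le> opnorm p Ix T"
    by (simp add: qp_abs_mul ppow V_coord[OF B_V[OF T xi(1)]])
  thus ?thesis using pk by (simp add: field_simps)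
qed

text \<open>Division by a power of \<open>p\<close> does not act on all of \<open>V\<close>, since
  it could make infinitely many coordinates non-integral. Here \<open>\<xi>\<close> is so small that
  the quotient lies in the unit ball, and linearity is applied to the quotient with the integral
  scalar \<open>ppow k\<close>.\<close>

lemma opnorm_scale_inverse:
  assumes T: "T \<in> B" and xi: "\<xi> \<in> V" "\<And>i. qp_abs p (\<xi> i) \<le> 1 / real p ^ k"
  shows "qp_abs p (T \<xi> i) \<le> 1 / real p ^ k * opnorm p Ix T"
proof -
  have pk: "0 < real p ^ k" using p_gt_1 by simp
  let ?\<eta> = "\<lambda>i. qp_mul p (pinv k) (\<xi> i)"
  have "qp_abs p (?\<eta> j) \<le> 1" for j
    using xi(2)[of j] pk by (simp add: qp_abs_mul pinv V_coord[OF xi(1)] field_simps)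
  moreover have "?\<eta> j = qp_zero p" if "j \<notin> Ix" for j
    using Q.r_null[of "pinv k"] pinv(1) V_outside[OF xi(1) that] by simp
  moreover have "?\<eta> j \<in> Qp p" for j by (rule Qmul[OF pinv(1) V_coord[OF xi(1)]])
  ultimately have eta: "?\<eta> \<in> unit_ball" unfolding unit_ball_def by (auto intro!: VI_ball)
  note etaV = unit_ball_V[OF eta]
  have eq: "vsmul p Ix (ppow k) ?\<eta> = \<xi>"
    unfolding vsmul_eq'[OF ppow_Zp etaV] using ppow_pinv[OF V_coord[OF xi(1)]] by blast
  have "T (vsmul p Ix (ppow k) ?\<eta>) i = qp_mul p (ppow k) (T ?\<eta> i)"
    unfolding B_smul[OF T ppow_Zp etaV] vsmul_eq'[OF ppow_Zp B_V[OF T etaV]] ..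
  hence "T \<xi> i = qp_mul p (ppow k) (T ?\<eta> i)" by (simp only: eq)
  hence "qp_abs p (T \<xi> i) = 1 / real p ^ k * qp_abs p (T ?\<eta> i)"
    by (simp only: qp_abs_mul[OF ppow(1) V_coord[OF B_V[OF T etaV]]] ppow(2))
  also have "\<dots> \<le> 1 / real p ^ k * opnorm p Ix T" using pk by (intro mult_left_mono opnorm_bound[OF T eta]) simp
  finally show ?thesis .
qed

lemma opnorm_scale:
  assumes T: "T \<in> B" and xi: "\<xi> \<in> V" "\<And>i. qp_abs p (\<xi> i) \<le> real p powr real_of_int k"
  shows "qp_abs p (T \<xi> i) \<le> real p powr real_of_int k * opnorm p Ix T"
proof (cases "k \<ge> 0")
  case True
  have "real p powr real_of_int k = real p ^ nat k" using True p_gt_1 by (simp add: powr_realpow[symmetric])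
  thus ?thesis using opnorm_scale_nat[OF T xi(1), of "nat k"] xi(2) by simp
next
  case False
  have "real p powr real_of_int k = inverse (real p powr (- real_of_int k))" by (simp add: powr_minus)
  also have "real p powr (- real_of_int k) = real p ^ nat (- k)" using False p_gt_1 by (simp add: powr_realpow[symmetric])
  finally have eq: "real p powr real_of_int k = 1 / real p ^ nat (- k)" by (simp add: divide_inverse)
  show ?thesis unfolding eq by (rule opnorm_scale_inverse[OF T xi(1)]) (use xi(2) eq in simp)
qed

lemma opnorm_eq_0: assumes T: "T \<in> B" "opnorm p Ix T = 0" and xi: "\<xi> \<in> V" shows "T \<xi> = vzero p Ix"
proof -
  obtain k where k: "\<And>i. qp_abs p (\<xi> i) \<le> real p ^ k" using V_bounded[OF xi] by blast
  have "qp_abs p (T \<xi> i) = 0" for i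
    using opnorm_scale_nat[OF T(1) xi k, of i] Qabs_nonneg[OF V_coord[OF B_V[OF T(1) xi]], of i] T(2) by simp
  thus ?thesis unfolding vzero_def using qp_abs_eq_0[OF V_coord[OF B_V[OF T(1) xi]]] by blast
qed

text \<open>Since the norm of \<open>T\<close> is 0 or a power of \<open>p\<close>,
  \<open>opnorm_scale\<close> applies to \<open>T \<xi>\<close> with exactly this norm as radius.
  Rounding the radius up to the next power would lose a factor and with it
  submultiplicativity.\<close>

lemma opnorm_mult:
  assumes S: "S \<in> B" and T: "T \<in> B"
  shows "opnorm p Ix (restrict (\<lambda>\<xi>. S (T \<xi>)) V) \<le> opnorm p Ix S * opnorm p Ix T"
proof -
  have nn: "0 \<le> opnorm p Ix S * opnorm p Ix T" using opnorm_nonneg S T by simp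
  have "qp_abs p (S (T \<xi>) i) \<le> opnorm p Ix S * opnorm p Ix T" if xi: "\<xi> \<in> unit_ball" for \<xi> i
  proof (cases "opnorm p Ix T = 0")
    case True
    hence "T \<xi> = vzero p Ix" using opnorm_eq_0[OF T] unit_ball_V[OF xi] by blast
    thus ?thesis using B_zero[OF S] nn Qabs_zero by (simp add: vzero_def)
  next
    case False
    then obtain k :: int where k: "opnorm p Ix T = real p powr k" using opnorm_pvals[OF T] by (auto simp: pvals_def)
    have "qp_abs p (T \<xi> j) \<le> real p powr real_of_int k" for j using opnorm_bound[OF T xi] k by simp
    from opnorm_scale[OF S B_V[OF T unit_ball_V[OF xi]] this] show ?thesis by (simp add: k mult.commute)
  qed
  thus ?thesis unfolding opnorm_le_iff[OF mult_B[OF S T] nn] using unit_ball_V by auto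
qed

lemma opnorm_opsub:
  assumes S: "S \<in> B" and T: "T \<in> B"
  shows "opnorm p Ix (opsub p Ix S T) \<le> max (opnorm p Ix S) (opnorm p Ix T)"
proof -
  have nn: "0 \<le> max (opnorm p Ix S) (opnorm p Ix T)" using opnorm_nonneg[OF S] by simp
  have "qp_abs p (opsub p Ix S T \<xi> i) \<le> max (opnorm p Ix S) (opnorm p Ix T)" if xi: "\<xi> \<in> unit_ball" for \<xi> i
  proof -
    have xiV: "\<xi> \<in> V" using xi by (rule unit_ball_V)
    show ?thesis unfolding opsub_apply[OF xiV] vsub_eq[OF B_V[OF S xiV] B_V[OF T xiV]]
      using qp_abs_sub[OF V_coord[OF B_V[OF S xiV]] V_coord[OF B_V[OF T xiV]], of i i]
        opnorm_bound[OF S xi, of i] opnorm_bound[OF T xi, of i] by linarith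
  qed
  thus ?thesis unfolding opnorm_le_iff[OF opsub_B[OF S T] nn] by blast
qed

lemma opnorm_small:
  assumes T: "T \<in> B" and xi: "\<xi> \<in> V" "\<And>i. qp_abs p (\<xi> i) \<le> real p ^ k" and small: "opnorm p Ix T \<le> r / real p ^ k"
  shows "qp_abs p (T \<xi> i) \<le> r"
proof -
  have pk: "0 < real p ^ k" using p_gt_1 by simp
  have "qp_abs p (T \<xi> i) \<le> real p ^ k * opnorm p Ix T" by (rule opnorm_scale_nat[OF T xi])
  also have "\<dots> \<le> real p ^ k * (r / real p ^ k)" using small pk by (intro mult_left_mono) auto
  also have "\<dots> = r" using pk by simp
  finally show ?thesis .
qed

lemma opsub_telescope:
  assumes "R \<in> B" "S \<in> B" "T \<in> B"
  shows "opnorm p Ix (opsub p Ix R T) \<le> max (opnorm p Ix (opsub p Ix R S)) (opnorm p Ix (opsub p Ix T S))"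
proof -
  interpret R: ring \<B> by (rule ring_Bring)
  have c: "R \<in> carrier \<B>" "S \<in> carrier \<B>" "T \<in> carrier \<B>" using assms by auto
  have "R \<ominus>\<^bsub>\<B>\<^esub> T = (R \<ominus>\<^bsub>\<B>\<^esub> S) \<ominus>\<^bsub>\<B>\<^esub> (T \<ominus>\<^bsub>\<B>\<^esub> S)"
    using c by algebra
  hence "opsub p Ix R T = opsub p Ix (opsub p Ix R S) (opsub p Ix T S)"
    by (simp only: opsub_eq[OF assms(1,3)] opsub_eq[OF assms(1,2)] opsub_eq[OF assms(3,2)]
      opsub_eq[OF opsub_B[OF assms(1,2), unfolded opsub_eq[OF assms(1,2)]] opsub_B[OF assms(3,2), unfolded opsub_eq[OF assms(3,2)]]])
  thus ?thesis using opnorm_opsub[OF opsub_B[OF assms(1,2)] opsub_B[OF assms(3,2)]] by simp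
qed

lemma opnorm_opsub_self: "T \<in> B \<Longrightarrow> opnorm p Ix (opsub p Ix T T) = 0"
proof -
  assume T: "T \<in> B"
  have "opnorm p Ix (opsub p Ix T T) \<le> 0"
    unfolding opnorm_le_iff[OF opsub_B[OF T T] order_refl]
  proof (intro ballI allI)
    fix \<xi> i assume "\<xi> \<in> unit_ball"
    hence "\<xi> \<in> V" by (rule unit_ball_V)
    thus "qp_abs p (opsub p Ix T T \<xi> i) \<le> 0"
      using vsub_self[OF B_V[OF T]] Qabs_zero by (simp add: opsub_apply vzero_def)
  qed
  thus ?thesis using opnorm_nonneg[OF opsub_B[OF T T]] by simp
qed

text \<open>The limit is formed coordinate by coordinate in Q_p, and convergence turns out to be
  uniform on every ball. Uniformity shows that the limit maps \<open>V\<close> to itself, is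
  continuous, and is a limit in norm; linearity comes from uniqueness of limits in Q_p.\<close>

lemma B_complete:
  assumes T: "\<And>n. T n \<in> B" and lim: "(\<lambda>n. opnorm p Ix (opsub p Ix (T (Suc n)) (T n))) \<longlonglongrightarrow> 0"
  shows "\<exists>L\<in>B. (\<lambda>n. opnorm p Ix (opsub p Ix L (T n))) \<longlonglongrightarrow> 0"
proof -
  note TV = B_V[OF T]
  have ex: "\<exists>l\<in>Qp p. (\<lambda>n. qp_abs p (qp_sub p l (T n \<xi> i))) \<longlonglongrightarrow> 0" if xi: "\<xi> \<in> V" for \<xi> i
  proof -
    obtain k where k: "\<And>i. qp_abs p (\<xi> i) \<le> real p ^ k" using V_bounded[OF xi] by blast
    have lim': "(\<lambda>n. real p ^ k * opnorm p Ix (opsub p Ix (T (Suc n)) (T n))) \<longlonglongrightarrow> 0"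
      using tendsto_mult_left[OF lim, of "real p ^ k"] by simp
    have "(\<lambda>n. qp_abs p (T (Suc n) \<xi> i \<ominus>\<^bsub>Qp_ring p\<^esub> T n \<xi> i)) \<longlonglongrightarrow> 0"
    proof (rule tendsto_0_squeeze[OF _ _ lim'])
      fix n
      have "qp_abs p (opsub p Ix (T (Suc n)) (T n) \<xi> i) \<le> real p ^ k * opnorm p Ix (opsub p Ix (T (Suc n)) (T n))"
        by (rule opnorm_scale_nat[OF opsub_B[OF T T] xi k])
      thus "qp_abs p (T (Suc n) \<xi> i \<ominus>\<^bsub>Qp_ring p\<^esub> T n \<xi> i) \<le> real p ^ k * opnorm p Ix (opsub p Ix (T (Suc n)) (T n))"
        by (simp add: opsub_apply[OF xi] vsub_eq[OF TV[OF xi] TV[OF xi]] qp_sub_eq V_coord[OF TV[OF xi]])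
      show "0 \<le> qp_abs p (T (Suc n) \<xi> i \<ominus>\<^bsub>Qp_ring p\<^esub> T n \<xi> i)"
        using V_coord[OF TV[OF xi]] by (intro Q.N_nonneg Q.minus_closed) auto
    qed
    then obtain l where l: "l \<in> Qp p" "(\<lambda>n. qp_abs p (l \<ominus>\<^bsub>Qp_ring p\<^esub> T n \<xi> i)) \<longlonglongrightarrow> 0"
      using Q.complete[of "\<lambda>n. T n \<xi> i"] V_coord[OF TV[OF xi]] by auto
    have "(\<lambda>n. qp_abs p (qp_sub p l (T n \<xi> i))) \<longlonglongrightarrow> 0"
      using l by (simp add: qp_sub_eq V_coord[OF TV[OF xi]])
    thus ?thesis using l(1) by blast
  qed
  \<comment> \<open>Coordinates outside \<open>Ix\<close> are set to zero as \<open>QpX\<close>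
    demands.\<close>
  define L where "L \<xi> i = (if i \<in> Ix then SOME l. l \<in> Qp p \<and> (\<lambda>n. qp_abs p (qp_sub p l (T n \<xi> i))) \<longlonglongrightarrow> 0 else qp_zero p)" for \<xi> i
  have L: "L \<xi> i \<in> Qp p \<and> (\<lambda>n. qp_abs p (qp_sub p (L \<xi> i) (T n \<xi> i))) \<longlonglongrightarrow> 0" if xi: "\<xi> \<in> V" for \<xi> i
  proof (cases "i \<in> Ix")
    case True
    thus ?thesis using someI_ex[OF ex[OF xi, of i, unfolded Bex_def]] by (simp add: L_def)
  next
    case False
    have "qp_sub p (qp_zero p) (qp_zero p) = qp_zero p"
      using Q.r_right_minus_eq[of "qp_zero p" "qp_zero p"] Qzero by (simp add: qp_sub_eq)
    thus ?thesis using False V_outside[OF TV[OF xi] False] by (simp add: L_def Qzero Qabs_zero)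
  qed
  have LQ: "L \<xi> i \<in> Qp p" and Llim: "(\<lambda>n. qp_abs p (qp_sub p (L \<xi> i) (T n \<xi> i))) \<longlonglongrightarrow> 0" if "\<xi> \<in> V" for \<xi> i
    using L[OF that] by auto
  \<comment> \<open>By the strong triangle inequality, a tail with small consecutive differences has
    all its differences small.\<close>
  have unif: "\<exists>M. \<forall>m\<ge>M. \<forall>n\<ge>m. opnorm p Ix (opsub p Ix (T n) (T m)) \<le> e" if e: "e > 0" for e :: real
  proof -
    obtain M where M: "\<And>n. n \<ge> M \<Longrightarrow> opnorm p Ix (opsub p Ix (T (Suc n)) (T n)) < e"
      using order_tendstoD(2)[OF lim e] by (auto simp: eventually_sequentially)
    have "opnorm p Ix (opsub p Ix (T n) (T m)) \<le> e" if "m \<ge> M" "n \<ge> m" for m n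
      using that(2)
    proof (induction n rule: dec_induct)
      case base
      show ?case using opnorm_opsub_self[OF T] e by simp
    next
      case (step n)
      have "opnorm p Ix (opsub p Ix (T m) (T n)) \<le> e"
        using opsub_telescope[OF T[of m] T[of m] T[of n]] opnorm_opsub_self[OF T[of m]] step e by simp
      thus ?case using opsub_telescope[OF T[of "Suc n"] T[of n] T[of m]] M[of n] step that(1) by simp
    qed
    thus ?thesis by blast
  qed
  have close: "\<exists>M. \<forall>m\<ge>M. \<forall>\<xi>\<in>V. (\<forall>i. qp_abs p (\<xi> i) \<le> real p ^ k) \<longrightarrow> (\<forall>i. qp_abs p (qp_sub p (L \<xi> i) (T m \<xi> i)) \<le> e)"
    if e: "e > 0" for e :: real and k
  proof -
    have "e / real p ^ k > 0" using e p_gt_1 by simp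
    then obtain M where M: "\<And>m n. m \<ge> M \<Longrightarrow> n \<ge> m \<Longrightarrow> opnorm p Ix (opsub p Ix (T n) (T m)) \<le> e / real p ^ k"
      using unif by meson
    have "qp_abs p (qp_sub p (L \<xi> i) (T m \<xi> i)) \<le> e"
      if m: "m \<ge> M" and xi: "\<xi> \<in> V" "\<And>i. qp_abs p (\<xi> i) \<le> real p ^ k" for m \<xi> i
    proof -
      \<comment> \<open>The index \<open>n0\<close> depends on the vector and the coordinate, but it
        does not enter the final bound, and so the estimate is uniform.\<close>
      obtain n0 where n0: "\<And>n. n \<ge> n0 \<Longrightarrow> qp_abs p (qp_sub p (L \<xi> i) (T n \<xi> i)) < e"
        using order_tendstoD(2)[OF Llim[OF xi(1)] e, of i] by (auto simp: eventually_sequentially)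
      define n where "n = max n0 m"
      have Tc: "T j \<xi> i \<in> Qp p" for j by (rule V_coord[OF TV[OF xi(1)]])
      have 1: "qp_abs p (qp_sub p (L \<xi> i) (T n \<xi> i)) \<le> e" using n0[of n] by (simp add: n_def)
      have "qp_abs p (opsub p Ix (T n) (T m) \<xi> i) \<le> e"
        by (rule opnorm_small[OF opsub_B[OF T T] xi M[OF m]]) (simp add: n_def)
      hence 2: "qp_abs p (qp_sub p (T n \<xi> i) (T m \<xi> i)) \<le> e"
        by (simp add: opsub_apply[OF xi(1)] vsub_eq[OF TV[OF xi(1)] TV[OF xi(1)]])
      have "qp_sub p (L \<xi> i) (T m \<xi> i) = qp_add p (qp_sub p (L \<xi> i) (T n \<xi> i)) (qp_sub p (T n \<xi> i) (T m \<xi> i))"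
        using Q.minus_telescope[of "L \<xi> i" "T n \<xi> i" "T m \<xi> i"] LQ[OF xi(1)] Tc by (simp add: qp_sub_eq)
      thus ?thesis using Qabs_add[OF Qsub[OF LQ[OF xi(1)] Tc] Qsub[OF Tc Tc], of i n n m] 1 2 by simp
    qed
    thus ?thesis by blast
  qed
  have LV: "L \<xi> \<in> V" if xi: "\<xi> \<in> V" for \<xi>
  proof (rule VI)
    obtain k where k: "\<And>i. qp_abs p (\<xi> i) \<le> real p ^ k" using V_bounded[OF xi] by blast
    \<comment> \<open>One operator \<open>T m\<close> that is within distance 1 of the limit at
      \<open>\<xi>\<close> suffices: the non-integral coordinates of \<open>L \<xi>\<close> are
      among those of \<open>T m \<xi>\<close>, which are finite in number.\<close>
    obtain m where m: "\<And>i. qp_abs p (qp_sub p (L \<xi> i) (T m \<xi> i)) \<le> 1" using close[of 1 k] xi k by fastforce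
    show "finite {i. 1 < qp_abs p (L \<xi> i)}"
    proof (rule finite_subset[OF _ V_finite[OF TV[OF xi, of m]]], rule subsetI)
      fix i assume "i \<in> {i. 1 < qp_abs p (L \<xi> i)}"
      moreover have "qp_abs p (L \<xi> i) \<le> max (qp_abs p (qp_sub p (L \<xi> i) (T m \<xi> i))) (qp_abs p (T m \<xi> i))"
        using Qabs_add[OF Qsub[OF LQ[OF xi] V_coord[OF TV[OF xi]]] V_coord[OF TV[OF xi]], of i m i m i]
        by (simp add: Qsub_add LQ[OF xi] V_coord[OF TV[OF xi]])
      ultimately show "i \<in> {i. 1 < qp_abs p (T m \<xi> i)}" using m[of i] by auto
    qed
    show "L \<xi> i \<in> Qp p" for i by (rule LQ[OF xi])
    show "L \<xi> i = qp_zero p" if "i \<notin> Ix" for i using that by (simp add: L_def)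
  qed
  have uniq: "x = L \<xi> i" if "\<xi> \<in> V" "x \<in> Qp p" "(\<lambda>n. qp_abs p (qp_sub p x (T n \<xi> i))) \<longlonglongrightarrow> 0" for x \<xi> i
    using Q.tendsto_N_unique[of x "L \<xi> i" "\<lambda>n. T n \<xi> i"] that(2,3) LQ[OF that(1), of i] Llim[OF that(1), of i] V_coord[OF TV[OF that(1)]]
    by (simp add: qp_sub_eq)
  have LB: "restrict L V \<in> B"
  proof (rule BI)
    fix \<xi> \<eta> assume xe: "\<xi> \<in> V" "\<eta> \<in> V"
    show "L (vadd p Ix \<xi> \<eta>) = vadd p Ix (L \<xi>) (L \<eta>)"
      unfolding vadd_eq[OF LV[OF xe(1)] LV[OF xe(2)]]
    proof (intro ext uniq[symmetric] vadd_V xe Qadd LQ)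
      fix i
      have lm: "(\<lambda>n. max (qp_abs p (qp_sub p (L \<xi> i) (T n \<xi> i))) (qp_abs p (qp_sub p (L \<eta> i) (T n \<eta> i)))) \<longlonglongrightarrow> 0"
        using tendsto_max[OF Llim[OF xe(1), of i] Llim[OF xe(2), of i]] by simp
      have eq: "qp_sub p (qp_add p (L \<xi> i) (L \<eta> i)) (T n (vadd p Ix \<xi> \<eta>) i)
          = qp_add p (qp_sub p (L \<xi> i) (T n \<xi> i)) (qp_sub p (L \<eta> i) (T n \<eta> i))" for n
        unfolding B_add[OF T xe] vadd_eq[OF TV[OF xe(1)] TV[OF xe(2)]]
        by (rule add_sub_interchange[OF LQ[OF xe(1)] LQ[OF xe(2)] V_coord[OF TV[OF xe(1)]] V_coord[OF TV[OF xe(2)]]])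
      show "(\<lambda>n. qp_abs p (qp_sub p (qp_add p (L \<xi> i) (L \<eta> i)) (T n (vadd p Ix \<xi> \<eta>) i))) \<longlonglongrightarrow> 0"
        unfolding eq
        by (rule tendsto_0_squeeze[OF Qabs_nonneg Qabs_add lm])
           (intro Qadd Qsub LQ xe V_coord[OF TV[OF xe(1)]] V_coord[OF TV[OF xe(2)]])+
    qed
  next
    fix a \<xi> assume a: "a \<in> Zp p" and xi: "\<xi> \<in> V"
    have aQ: "a \<in> Qp p" using a by (simp add: Zp_iff)
    show "L (vsmul p Ix a \<xi>) = vsmul p Ix a (L \<xi>)"
      unfolding vsmul_eq'[OF a LV[OF xi]]
    proof (intro ext uniq[symmetric] vsmul_V a xi Qmul aQ LQ)
      fix i
      have eq: "qp_sub p (qp_mul p a (L \<xi> i)) (T n (vsmul p Ix a \<xi>) i) = qp_mul p a (qp_sub p (L \<xi> i) (T n \<xi> i))" for n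
        unfolding B_smul[OF T a xi] vsmul_eq'[OF a TV[OF xi]]
        by (rule mul_sub[OF aQ LQ[OF xi] V_coord[OF TV[OF xi]], symmetric])
      have "(\<lambda>n. qp_abs p a * qp_abs p (qp_sub p (L \<xi> i) (T n \<xi> i))) \<longlonglongrightarrow> 0"
        using tendsto_mult_left[OF Llim[OF xi, of i], of "qp_abs p a"] by simp
      thus "(\<lambda>n. qp_abs p (qp_sub p (qp_mul p a (L \<xi> i)) (T n (vsmul p Ix a \<xi>) i))) \<longlonglongrightarrow> 0"
        unfolding eq by (simp add: qp_abs_mul[OF aQ Qsub[OF LQ[OF xi] V_coord[OF TV[OF xi]]]])
    qed
  next
    show "cont0 L" unfolding cont0_def
    proof (intro allI impI)
      fix F :: "'x set" and e :: real assume F: "finite F" "F \<subseteq> Ix" "e > 0"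
      \<comment> \<open>The bound 1 preserves integrality of all coordinates; \<open>e / 2\<close>
        preserves the strict inequality for those in \<open>F\<close>.\<close>
      define d where "d = min 1 (e / 2)"
      have d: "d > 0" "d \<le> 1" "d < e" using F by (auto simp: d_def)
      obtain m where m: "\<forall>\<xi>\<in>V. (\<forall>i. qp_abs p (\<xi> i) \<le> 1) \<longrightarrow> (\<forall>i. qp_abs p (qp_sub p (L \<xi> i) (T m \<xi> i)) \<le> d)"
        using close[OF d(1), of 0] unfolding power_0 by blast
      obtain F' e' where F': "finite F'" "F' \<subseteq> Ix" "e' > 0" "\<forall>\<zeta>\<in>nbhd F' e'. T m \<zeta> \<in> nbhd F e"
        by (rule cont0D[OF B_cont0[OF T] F])
      have "L \<zeta> \<in> nbhd F e" if z: "\<zeta> \<in> nbhd F' e'" for \<zeta>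
      proof -
        have zV: "\<zeta> \<in> V" using z by (rule nbhd_V)
        have b: "qp_abs p (L \<zeta> i) \<le> max (qp_abs p (qp_sub p (L \<zeta> i) (T m \<zeta> i))) (qp_abs p (T m \<zeta> i))" for i
          using Qabs_add[OF Qsub[OF LQ[OF zV] V_coord[OF TV[OF zV]]] V_coord[OF TV[OF zV]], of i m i m i]
          by (simp add: Qsub_add LQ[OF zV] V_coord[OF TV[OF zV]])
        have dm: "qp_abs p (qp_sub p (L \<zeta> i) (T m \<zeta> i)) \<le> d" for i
          using m[rule_format, OF zV] z by (simp add: nbhd_def)
        have Tn: "T m \<zeta> \<in> nbhd F e" using F'(4) z by blast
        have "qp_abs p (T m \<zeta> i) \<le> 1" for i using Tn by (simp add: nbhd_def)
        hence "qp_abs p (L \<zeta> i) \<le> 1" for i using b[of i] dm[of i] d(2) by (meson le_max_iff_disj order_trans)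
        moreover have "qp_abs p (L \<zeta> i) < e" if "i \<in> F" for i
        proof -
          have "qp_abs p (T m \<zeta> i) < e" using Tn that by (simp add: nbhd_def)
          thus ?thesis using b[of i] dm[of i] d(3) by linarith
        qed
        ultimately show ?thesis using LV[OF zV] by (simp add: nbhd_def)
      qed
      thus "\<exists>F' e'. finite F' \<and> F' \<subseteq> Ix \<and> e' > 0 \<and> (\<forall>\<zeta>\<in>nbhd F' e'. L \<zeta> \<in> nbhd F e)" using F' by blast
    qed
  qed (rule LV)
  have "(\<lambda>n. opnorm p Ix (opsub p Ix (restrict L V) (T n))) \<longlonglongrightarrow> 0"
  proof (rule LIMSEQ_I)
    fix e :: real assume e: "e > 0"
    hence e2: "e / 2 > 0" by simp
    obtain M where M: "\<forall>m\<ge>M. \<forall>\<xi>\<in>V. (\<forall>i. qp_abs p (\<xi> i) \<le> 1) \<longrightarrow> (\<forall>i. qp_abs p (qp_sub p (L \<xi> i) (T m \<xi> i)) \<le> e / 2)"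
      using close[OF e2, of 0] unfolding power_0 by blast
    have half: "opnorm p Ix (opsub p Ix (restrict L V) (T m)) \<le> e / 2" if m: "m \<ge> M" for m
      unfolding opnorm_le_iff[OF opsub_B[OF LB T] less_imp_le[OF e2]]
    proof (intro ballI allI)
      fix \<xi> i assume xi: "\<xi> \<in> unit_ball"
      hence xiV: "\<xi> \<in> V" by (rule unit_ball_V)
      show "qp_abs p (opsub p Ix (restrict L V) (T m) \<xi> i) \<le> e / 2"
        using M[rule_format, OF m xiV] xi by (simp add: opsub_apply[OF xiV] xiV vsub_eq[OF LV[OF xiV] TV[OF xiV]] unit_ball_def)
    qed
    have "opnorm p Ix (opsub p Ix (restrict L V) (T m)) < e" if "m \<ge> M" for m
      using half[OF that] e by linarith
    thus "\<exists>no. \<forall>n\<ge>no. norm (opnorm p Ix (opsub p Ix (restrict L V) (T n)) - 0) < e"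
      using opnorm_nonneg[OF opsub_B[OF LB T]] by (intro exI[of _ M]) simp
  qed
  thus ?thesis using LB by blast
qed

lemma ultrametric_Bring: "ultrametric_ring \<B> (opnorm p Ix)"
proof (intro ultrametric_ring.intro ultrametric_ring_axioms.intro)
  show "ring \<B>" by (rule ring_Bring)
  have zb: "\<zero>\<^bsub>\<B>\<^esub> \<in> B" using zero_B by simp
  have "opnorm p Ix \<zero>\<^bsub>\<B>\<^esub> \<le> 0" unfolding opnorm_le_iff[OF zb order_refl]
    using unit_ball_V Qabs_zero by (simp add: vzero_def)
  thus "opnorm p Ix \<zero>\<^bsub>\<B>\<^esub> = 0" using opnorm_nonneg[OF zb] by simp
  have ob: "\<one>\<^bsub>\<B>\<^esub> \<in> B" using one_B by simp
  show "opnorm p Ix \<one>\<^bsub>\<B>\<^esub> \<le> 1" unfolding opnorm_le_iff[OF ob zero_le_one]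
    using unit_ball_V by (auto simp: unit_ball_def)
  show "0 \<le> opnorm p Ix T" if "T \<in> carrier \<B>" for T using opnorm_nonneg that by simp
  show "T = \<zero>\<^bsub>\<B>\<^esub>" if "T \<in> carrier \<B>" "opnorm p Ix T = 0" for T
    by (rule B_ext[OF _ zb]) (use that opnorm_eq_0 in auto)
  show "opnorm p Ix (S \<ominus>\<^bsub>\<B>\<^esub> T) \<le> max (opnorm p Ix S) (opnorm p Ix T)"
    if "S \<in> carrier \<B>" "T \<in> carrier \<B>" for S T
    using opnorm_opsub[of S T] opsub_eq[of S T] that by simp
  show "opnorm p Ix (S \<otimes>\<^bsub>\<B>\<^esub> T) \<le> opnorm p Ix S * opnorm p Ix T"
    if "S \<in> carrier \<B>" "T \<in> carrier \<B>" for S T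
    using opnorm_mult[of S T] that by simp
  show "\<exists>l\<in>carrier \<B>. (\<lambda>n. opnorm p Ix (l \<ominus>\<^bsub>\<B>\<^esub> s n)) \<longlonglongrightarrow> 0"
    if s: "\<And>n. s n \<in> carrier \<B>" and lim: "(\<lambda>n. opnorm p Ix (s (Suc n) \<ominus>\<^bsub>\<B>\<^esub> s n)) \<longlonglongrightarrow> 0" for s
  proof -
    have sB: "s n \<in> B" for n using s by simp
    have "(\<lambda>n. opnorm p Ix (opsub p Ix (s (Suc n)) (s n))) \<longlonglongrightarrow> 0" unfolding opsub_eq[OF sB sB] by (rule lim)
    then obtain L where L: "L \<in> B" "(\<lambda>n. opnorm p Ix (opsub p Ix L (s n))) \<longlonglongrightarrow> 0" using B_complete[of s] sB by blast
    thus ?thesis unfolding opsub_eq[OF L(1) sB] by auto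
  qed
qed

end

section \<open>Closed subalgebras and the closure of the union\<close>

lemma (in ultrametric_ring) N_diff_diff:
  assumes "l \<in> carrier R" "m \<in> carrier R" "s \<in> carrier R" "t \<in> carrier R"
  shows "N ((l \<ominus> m) \<ominus> (s \<ominus> t)) \<le> max (N (l \<ominus> s)) (N (m \<ominus> t))"
proof -
  have "(l \<ominus> m) \<ominus> (s \<ominus> t) = (l \<ominus> s) \<ominus> (m \<ominus> t)" using assms by algebra
  thus ?thesis using N_minus[of "l \<ominus> s" "m \<ominus> t"] assms by simp
qed

context padic_space begin

lemma subalg_sub: "is_subalg p Ix A \<Longrightarrow> S \<in> A \<Longrightarrow> T \<in> A \<Longrightarrow> opsub p Ix S T \<in> A"
  and subalg_mult: "is_subalg p Ix A \<Longrightarrow> S \<in> A \<Longrightarrow> T \<in> A \<Longrightarrow> S \<otimes>\<^bsub>\<B>\<^esub> T \<in> A"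
  and subalg_zero: "is_subalg p Ix A \<Longrightarrow> \<zero>\<^bsub>\<B>\<^esub> \<in> A"
  and subalg_B: "is_subalg p Ix A \<Longrightarrow> A \<subseteq> B"
  unfolding is_subalg_def by blast+

lemma nonunital_subring_subalg: "is_subalg p Ix A \<Longrightarrow> nonunital_subring \<B> A"
proof (intro nonunital_subring.intro nonunital_subring_axioms.intro ring_Bring)
  assume A: "is_subalg p Ix A"
  show "A \<subseteq> carrier \<B>" using subalg_B[OF A] by simp
  show "\<zero>\<^bsub>\<B>\<^esub> \<in> A" by (rule subalg_zero[OF A])
  fix S T assume ST: "S \<in> A" "T \<in> A"
  hence "S \<in> B" "T \<in> B" using subalg_B[OF A] by auto
  thus "S \<ominus>\<^bsub>\<B>\<^esub> T \<in> A" using subalg_sub[OF A ST] opsub_eq[of S T] by simp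
  show "S \<otimes>\<^bsub>\<B>\<^esub> T \<in> A" by (rule subalg_mult[OF A ST])
qed

text \<open>No halving of \<open>e\<close> is required: two ultrametric distances below
  \<open>e\<close> compose to a distance below \<open>e\<close>.\<close>

lemma norm_closure_closed:
  assumes s: "\<And>n. s n \<in> norm_closure p Ix A" and A: "A \<subseteq> B" and l: "l \<in> B"
    and lim: "(\<lambda>n. opnorm p Ix (l \<ominus>\<^bsub>\<B>\<^esub> s n)) \<longlonglongrightarrow> 0"
  shows "l \<in> norm_closure p Ix A"
  unfolding norm_closure_def
proof (intro CollectI conjI allI impI)
  interpret R: ultrametric_ring \<B> "opnorm p Ix" by (rule ultrametric_Bring)
  fix e :: real assume e: "e > 0"
  have sB: "s n \<in> B" for n using s by (auto simp: norm_closure_def)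
  obtain n where n: "opnorm p Ix (l \<ominus>\<^bsub>\<B>\<^esub> s n) < e"
    using order_tendstoD(2)[OF lim e] by (auto simp: eventually_sequentially)
  obtain S where S: "S \<in> A" "opnorm p Ix (opsub p Ix (s n) S) < e" using s[of n] e by (auto simp: norm_closure_def)
  have SB: "S \<in> B" using S A by auto
  have c: "l \<in> carrier \<B>" "s n \<in> carrier \<B>" "S \<in> carrier \<B>" using l sB SB by auto
  have "l \<ominus>\<^bsub>\<B>\<^esub> S = (l \<ominus>\<^bsub>\<B>\<^esub> s n) \<oplus>\<^bsub>\<B>\<^esub> (s n \<ominus>\<^bsub>\<B>\<^esub> S)"
    by (rule R.minus_telescope[OF c])
  hence "opnorm p Ix (opsub p Ix l S) < e"
    using R.N_add[OF R.minus_closed[OF c(1,2)] R.minus_closed[OF c(2,3)]] n S(2)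
    unfolding opsub_eq[OF l SB] opsub_eq[OF sB SB] by simp
  thus "\<exists>S\<in>A. opnorm p Ix (opsub p Ix l S) < e" using S(1) by blast
qed (rule l)

lemma norm_closure_incl: "A \<subseteq> B \<Longrightarrow> A \<subseteq> norm_closure p Ix A"
  unfolding norm_closure_def using opnorm_opsub_self by force

lemma closed_subring_subalg:
  assumes A: "is_subalg p Ix A" and cl: "norm_closed p Ix A"
  shows "closed_nonunital_subring \<B> (opnorm p Ix) A"
proof (intro closed_nonunital_subring.intro closed_nonunital_subring_axioms.intro
    ultrametric_Bring nonunital_subring_subalg[OF A])
  fix s l assume s: "\<And>n. s n \<in> A" and l: "l \<in> carrier \<B>"
    and lim: "(\<lambda>n. opnorm p Ix (l \<ominus>\<^bsub>\<B>\<^esub> s n)) \<longlonglongrightarrow> 0"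
  have "l \<in> norm_closure p Ix A"
    by (rule norm_closure_closed[OF _ subalg_B[OF A] _ lim])
       (use s l norm_closure_incl[OF subalg_B[OF A]] in auto)
  thus "l \<in> A" using cl by (auto simp: norm_closed_def)
qed

lemma norm_closure_approx:
  assumes "A \<subseteq> B" "T \<in> norm_closure p Ix A" "e > 0"
  obtains S where "S \<in> A" "opnorm p Ix (T \<ominus>\<^bsub>\<B>\<^esub> S) < e"
proof -
  obtain S where "S \<in> A" "opnorm p Ix (opsub p Ix T S) < e" using assms(2,3) by (auto simp: norm_closure_def)
  thus ?thesis using that[of S] opsub_eq[of T S] assms(1,2) by (auto simp: norm_closure_def)
qed

text \<open>Intended for the union of the chain, which need not be closed itself. Differences are
  approximated directly; for products the approximants have to be bounded as well.\<close>

lemma closed_subring_norm_closure: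
  assumes A: "nonunital_subring \<B> A"
  shows "closed_nonunital_subring \<B> (opnorm p Ix) (norm_closure p Ix A)"
proof -
  interpret R: ultrametric_ring \<B> "opnorm p Ix" by (rule ultrametric_Bring)
  interpret A: nonunital_subring \<B> A by (rule A)
  have AB: "A \<subseteq> B" using A.H_sub by simp
  have clB: "norm_closure p Ix A \<subseteq> B" by (auto simp: norm_closure_def)
  show ?thesis
  proof (intro closed_nonunital_subring.intro closed_nonunital_subring_axioms.intro
      ultrametric_Bring nonunital_subring.intro nonunital_subring_axioms.intro ring_Bring)
    show "norm_closure p Ix A \<subseteq> carrier \<B>" using clB by simp
    show "\<zero>\<^bsub>\<B>\<^esub> \<in> norm_closure p Ix A" using A.H_zero norm_closure_incl[OF AB] by blast
  next
    fix S T assume S: "S \<in> norm_closure p Ix A" and T: "T \<in> norm_closure p Ix A"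
    have c: "S \<in> carrier \<B>" "T \<in> carrier \<B>" using S T clB by auto
    note N_nonneg' = R.N_nonneg[OF c(1)] R.N_nonneg[OF c(2)]
    show "S \<ominus>\<^bsub>\<B>\<^esub> T \<in> norm_closure p Ix A" unfolding norm_closure_def
    proof (intro CollectI conjI allI impI)
      show "S \<ominus>\<^bsub>\<B>\<^esub> T \<in> B" using R.minus_closed[OF c] by simp
      fix e :: real assume e: "e > 0"
      obtain S' where S': "S' \<in> A" "opnorm p Ix (S \<ominus>\<^bsub>\<B>\<^esub> S') < e" by (rule norm_closure_approx[OF AB S e])
      obtain T' where T': "T' \<in> A" "opnorm p Ix (T \<ominus>\<^bsub>\<B>\<^esub> T') < e" by (rule norm_closure_approx[OF AB T e])
      have c': "S' \<in> carrier \<B>" "T' \<in> carrier \<B>" using S' T' A.H_carrier by auto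
      have "S \<ominus>\<^bsub>\<B>\<^esub> T \<in> B" "S' \<ominus>\<^bsub>\<B>\<^esub> T' \<in> B" using R.minus_closed c c' by simp_all
      hence "opnorm p Ix (opsub p Ix (S \<ominus>\<^bsub>\<B>\<^esub> T) (S' \<ominus>\<^bsub>\<B>\<^esub> T')) < e"
        using R.N_diff_diff[OF c c'] S'(2) T'(2) by (simp add: opsub_eq)
      thus "\<exists>R\<in>A. opnorm p Ix (opsub p Ix (S \<ominus>\<^bsub>\<B>\<^esub> T) R) < e"
        using A.H_minus[OF S'(1) T'(1)] by blast
    qed
    show "S \<otimes>\<^bsub>\<B>\<^esub> T \<in> norm_closure p Ix A" unfolding norm_closure_def
    proof (intro CollectI conjI allI impI)
      show "S \<otimes>\<^bsub>\<B>\<^esub> T \<in> B" using R.m_closed[OF c] by (simp only: Bring_simps)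
      fix e :: real assume e: "e > 0"
      define C where "C = 1 + opnorm p Ix S + opnorm p Ix T"
      have C: "1 \<le> C" "opnorm p Ix S \<le> C" "opnorm p Ix T \<le> C" using N_nonneg' by (auto simp: C_def)
      \<comment> \<open>A tolerance of at most 1 keeps the approximant \<open>S'\<close> within the
        bound \<open>C\<close>, and then \<open>C * d\<close> bounds the error of the
        product.\<close>
      define d where "d = min 1 (e / (2 * C))"
      have d: "d > 0" "d \<le> 1" "C * d < e"
      proof -
        show "d > 0" "d \<le> 1" using e C by (auto simp: d_def)
        have "C * d \<le> C * (e / (2 * C))" using C by (intro mult_left_mono) (auto simp: d_def)
        also have "\<dots> = e / 2" using C by simp
        finally show "C * d < e" using e by simp
      qed
      obtain S' where S': "S' \<in> A" "opnorm p Ix (S \<ominus>\<^bsub>\<B>\<^esub> S') < d" by (rule norm_closure_approx[OF AB S d(1)])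
      obtain T' where T': "T' \<in> A" "opnorm p Ix (T \<ominus>\<^bsub>\<B>\<^esub> T') < d" by (rule norm_closure_approx[OF AB T d(1)])
      have c': "S' \<in> carrier \<B>" "T' \<in> carrier \<B>" using S' T' A.H_carrier by auto
      have "S' = S \<ominus>\<^bsub>\<B>\<^esub> (S \<ominus>\<^bsub>\<B>\<^esub> S')" using c(1) c'(1) by algebra
      hence NS': "opnorm p Ix S' \<le> C"
        using R.N_minus[OF c(1) R.minus_closed[OF c(1) c'(1)]] S'(2) d(2) C by simp
      have eq: "S \<otimes>\<^bsub>\<B>\<^esub> T \<ominus>\<^bsub>\<B>\<^esub> S' \<otimes>\<^bsub>\<B>\<^esub> T'
          = (S \<ominus>\<^bsub>\<B>\<^esub> S') \<otimes>\<^bsub>\<B>\<^esub> T \<oplus>\<^bsub>\<B>\<^esub> S' \<otimes>\<^bsub>\<B>\<^esub> (T \<ominus>\<^bsub>\<B>\<^esub> T')"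
        using c c' by algebra
      have "opnorm p Ix ((S \<ominus>\<^bsub>\<B>\<^esub> S') \<otimes>\<^bsub>\<B>\<^esub> T) \<le> d * C"
        using c c' S'(2) C by (intro R.N_mult_le R.minus_closed) auto
      moreover have "opnorm p Ix (S' \<otimes>\<^bsub>\<B>\<^esub> (T \<ominus>\<^bsub>\<B>\<^esub> T')) \<le> C * d"
        using c c' T'(2) NS' by (intro R.N_mult_le R.minus_closed) auto
      ultimately have "opnorm p Ix (S \<otimes>\<^bsub>\<B>\<^esub> T \<ominus>\<^bsub>\<B>\<^esub> S' \<otimes>\<^bsub>\<B>\<^esub> T') \<le> C * d"
        unfolding eq by (intro R.N_add_le R.m_closed R.minus_closed c c') (simp_all only: mult.commute)
      moreover have "S \<otimes>\<^bsub>\<B>\<^esub> T \<in> B" "S' \<otimes>\<^bsub>\<B>\<^esub> T' \<in> B"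
        using R.m_closed[OF c] R.m_closed[OF c'] by (simp_all only: Bring_simps)
      ultimately have "opnorm p Ix (opsub p Ix (S \<otimes>\<^bsub>\<B>\<^esub> T) (S' \<otimes>\<^bsub>\<B>\<^esub> T')) < e"
        using d(3) by (simp only: opsub_eq)
      thus "\<exists>R\<in>A. opnorm p Ix (opsub p Ix (S \<otimes>\<^bsub>\<B>\<^esub> T) R) < e"
        using A.H_mult[OF S'(1) T'(1)] by blast
    qed
  next
    fix s l assume s: "\<And>n. s n \<in> norm_closure p Ix A" and l: "l \<in> carrier \<B>"
      and lim: "(\<lambda>n. opnorm p Ix (l \<ominus>\<^bsub>\<B>\<^esub> s n)) \<longlonglongrightarrow> 0"
    show "l \<in> norm_closure p Ix A" by (rule norm_closure_closed[OF s AB _ lim]) (use l in simp)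
  qed
qed

lemma nonunital_subring_Union:
  assumes A: "\<And>n. is_subalg p Ix (A n)" and mono: "\<And>n. A n \<subseteq> A (Suc n)"
  shows "nonunital_subring \<B> (\<Union>n. A n)"
proof (intro nonunital_subring.intro nonunital_subring_axioms.intro ring_Bring)
  interpret A: nonunital_subring \<B> "A n" for n by (rule nonunital_subring_subalg[OF A])
  show "(\<Union>n. A n) \<subseteq> carrier \<B>" using A.H_sub by blast
  show "\<zero>\<^bsub>\<B>\<^esub> \<in> (\<Union>n. A n)" using A.H_zero by blast
  fix S T assume "S \<in> (\<Union>n. A n)" "T \<in> (\<Union>n. A n)"
  then obtain n m where "S \<in> A n" "T \<in> A m" by blast
  moreover have "A n \<subseteq> A (max n m)" "A m \<subseteq> A (max n m)" using lift_Suc_mono_le[of A] mono by simp_all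
  ultimately have ST: "S \<in> A (max n m)" "T \<in> A (max n m)" by auto
  show "S \<ominus>\<^bsub>\<B>\<^esub> T \<in> (\<Union>n. A n)" "S \<otimes>\<^bsub>\<B>\<^esub> T \<in> (\<Union>n. A n)"
    using A.H_minus[OF ST] A.H_mult[OF ST] by blast+
qed

end

text \<open>The operations of \<open>unitz\<close> do not involve the subset, so all unitizations
  are carrier updates of \<open>unitz R UNIV\<close> and fit the chain locale.\<close>

lemma unitz_carrier_update: "(unitz R UNIV)\<lparr>carrier := UNIV \<times> H\<rparr> = unitz R H"
  by (simp add: unitz_def)

lemma K0_eq_kerK0: "K0 R H = kerK0 fst (unitz R H)"
  by (simp add: K0_def kerK0_def)

theorem theorem3p8:
  fixes p :: nat and Ix :: "'x set" and A :: "nat \<Rightarrow> 'x qpop set"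
  assumes "Factorial_Ring.prime p"
    and "countable Ix"
    and "\<And>n. is_subalg p Ix (A n)"
    and "\<And>n. norm_closed p Ix (A n)"
    and "\<And>n. A n \<subseteq> A (Suc n)"
  shows "K0 (Bring p Ix) (norm_closure p Ix (\<Union>n. A n))
           \<cong> dirlim (\<lambda>n. K0 (Bring p Ix) (A n)) (\<lambda>n m. k0_incl (Bring p Ix) (A m))"
proof -
  let ?B = "Bring p Ix" and ?D = "norm_closure p Ix (\<Union>n. A n)"
  interpret padic_space p Ix by (intro padic_space.intro padic.intro assms(1))
  interpret R: ultrametric_ring ?B "opnorm p Ix" by (rule ultrametric_Bring)
  have U: "nonunital_subring ?B (\<Union>n. A n)" by (rule nonunital_subring_Union[of A, OF assms(3,5)])
  have UB: "(\<Union>n. A n) \<subseteq> Bops p Ix" using nonunital_subring.H_sub[OF U] by simp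
  interpret D: closed_nonunital_subring ?B "opnorm p Ix" ?D by (rule closed_subring_norm_closure[OF U])
  interpret chain: dense_ultrametric_chain "unitz ?B UNIV" "\<lambda>n. UNIV \<times> A n" "UNIV \<times> ?D" "unorm (opnorm p Ix)" fst
  proof (rule dense_ultrametric_chain.intro, unfold unitz_carrier_update)
    fix x :: "int \<times> 'x qpop" and e :: real assume x: "x \<in> UNIV \<times> ?D" and e: "e > 0"
    have xD: "snd x \<in> ?D" using x by auto
    obtain S where S: "S \<in> (\<Union>n. A n)" "opnorm p Ix (snd x \<ominus>\<^bsub>?B\<^esub> S) < e"
      by (rule norm_closure_approx[OF UB xD e])
    then obtain n where n: "S \<in> A n" by blast
    have SD: "S \<in> ?D" using norm_closure_incl[OF UB] S by blast
    note c = D.H_carrier[OF SD] D.H_carrier[OF xD]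
    \<comment> \<open>The integral part is taken over exactly, so the error has integral part 0 and
      its norm is the operator norm of the second component.\<close>
    have "x = (fst x, S) \<oplus>\<^bsub>unitz ?B UNIV\<^esub> (0, snd x \<ominus>\<^bsub>?B\<^esub> S)"
      using R.minus_plus[OF c(2,1)] R.a_comm[OF c(1) R.minus_closed[OF c(2,1)]] by (simp only: unitz_simps fst_conv snd_conv add_0_right prod.collapse)
    moreover have "unorm (opnorm p Ix) (0, snd x \<ominus>\<^bsub>?B\<^esub> S) < e" using S(2) e by (simp add: unorm_def)
    moreover have "(fst x, S) \<in> UNIV \<times> A n" "(0, snd x \<ominus>\<^bsub>?B\<^esub> S) \<in> UNIV \<times> ?D"
      using n D.H_minus[OF xD SD] by auto
    ultimately show "\<exists>n. \<exists>y\<in>UNIV \<times> A n. \<exists>d\<in>UNIV \<times> ?D. x = y \<oplus>\<^bsub>unitz ?B UNIV\<^esub> d \<and> unorm (opnorm p Ix) d < e"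
      by blast
  next
    show "UNIV \<times> A n \<subseteq> UNIV \<times> A (Suc n)" for n using assms(5)[of n] by blast
    show "UNIV \<times> A n \<subseteq> UNIV \<times> ?D" for n using norm_closure_incl[OF UB] by blast
    \<comment> \<open>Closedness of each \<open>A n\<close> enters here: it makes the unitization at
      every stage complete, which the corrections at that stage presuppose.\<close>
    show "ultrametric_ring (unitz ?B (A n)) (unorm (opnorm p Ix))" for n
      by (rule closed_nonunital_subring.ultrametric_unitz[OF closed_subring_subalg[OF assms(3,4)]])
  qed (rule D.ultrametric_unitz D.ring_hom_fst_unitz)+
  show ?thesis
    using chain.kerK0_iso_dirlim unfolding unitz_carrier_update K0_eq_kerK0 k0_incl_def .
qed

end
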